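(* Let $X$ be a compact complex manifold of complex dimension $n$, and let $0\le p,q\le n$. Then $$\dim\operatorname{im}\left(\pi_{\bar\partial}:H^{p,q}_{BC}\to H^{p,q}_{\bar\partial}\right)=k^{p,q}+\dim\ker\left(\pi_A:H^{p,q}_{\bar\partial}\to H^{p,q}_A\right).$$
   Context: On smooth complex-valued $(p,q)$-forms on $X$, define $$H^{p,q}_{BC}=\frac{\ker(\partial)\cap\ker(\bar\partial)}{\operatorname{im}(\partial\bar\partial)},\quad H^{p,q}_A=\frac{\ker(\partial\bar\partial)}{\operatorname{im}(\partial)+\operatorname{im}(\bar\partial)},\quad H^{p,q}_{\bar\partial}=\frac{\ker(\bar\partial)}{\operatorname{im}(\bar\partial)},\quad K^{p,q}=\frac{\ker(\partial)\cap\ker(\bar\partial)}{\operatorname{im}(\partial)\cap\ker(\bar\partial)+\operatorname{im}(\bar\partial)\cap\ker(\partial)},$$ all spaces in bidegree $(p,q)$, and $k^{p,q}=\dim_{\mathbb C}K^{p,q}$. The maps $\pi_{\bar\partial}$ and $\pi_A$ are the natural maps induced by the identity on forms: $\pi_{\bar\partial}[\theta]_{BC}=[\theta]_{\bar\partial}$ and $\pi_A[\theta]_{\bar\partial}=[\theta]_A$. *)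

theory Defs
  imports
    "HOL-Analysis.Analysis"
    "HOL-Library.Extended_Nat"
    "HOL-Algebra.AbelCoset"
    "Jordan_Normal_Form.VS_Connect"
begin

section \<open>Calculus on \<open>\<complex>\<^sup>n\<close>\<close>

text \<open>
  \<open>\<complex>\<^sup>n\<close> is the set of complex sequences vanishing from index \<open>n\<close> on, with the topology induced by
  the product topology (the complex analogue of \<open>Euclidean_space n\<close> in HOL-Homology).
  This keeps \<open>n\<close> an ordinary natural number and includes \<open>n = 0\<close>.
\<close>

type_synonym cvec = "nat \<Rightarrow> complex"

definition cspace :: "nat \<Rightarrow> cvec set" where
  "cspace n = {z. \<forall>i\<ge>n. z i = 0}"

definition vecs :: "nat \<Rightarrow> nat \<Rightarrow> cvec list set" where
  "vecs n k = {vs. length vs = k \<and> set vs \<subseteq> cspace n}"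

definition dir_deriv :: "cvec \<Rightarrow> (cvec \<Rightarrow> complex) \<Rightarrow> cvec \<Rightarrow> complex" where
  "dir_deriv v f z = vector_derivative (\<lambda>t::real. f (\<lambda>i. z i + of_real t * v i)) (at 0)"

text \<open>
  \<open>W\<close> is meant to be relatively open in \<open>cspace n\<close>. Since \<open>cspace n\<close> is closed under multiplication
  by \<open>\<i>\<close>, the directions \<open>v\<close> below include those of all real coordinates, so \<open>smooth_on\<close> is
  \<open>C\<^sup>\<infinity>\<close> in the real sense.
\<close>

primrec Ck_on :: "nat \<Rightarrow> nat \<Rightarrow> cvec set \<Rightarrow> (cvec \<Rightarrow> complex) \<Rightarrow> bool" where
  "Ck_on n 0 W f \<longleftrightarrow> continuous_on W f"
| "Ck_on n (Suc k) W f \<longleftrightarrow> continuous_on W f \<and>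
     (\<forall>v\<in>cspace n.
        (\<forall>z\<in>W. (\<lambda>t::real. f (\<lambda>i. z i + of_real t * v i)) differentiable (at 0)) \<and>
        Ck_on n k W (dir_deriv v f))"

definition smooth_on :: "nat \<Rightarrow> cvec set \<Rightarrow> (cvec \<Rightarrow> complex) \<Rightarrow> bool" where
  "smooth_on n W f \<longleftrightarrow> (\<forall>k. Ck_on n k W f)"

text \<open>
  Wirtinger derivatives: \<open>dz_deriv v f z = \<Sum>\<^sub>l v\<^sub>l \<partial>f/\<partial>z\<^sub>l\<close> and
  \<open>dzbar_deriv v f z = \<Sum>\<^sub>l cnj v\<^sub>l \<partial>f/\<partial>cnj z\<^sub>l\<close>.
\<close>

definition dz_deriv :: "cvec \<Rightarrow> (cvec \<Rightarrow> complex) \<Rightarrow> cvec \<Rightarrow> complex" where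
  "dz_deriv v f z = (dir_deriv v f z - \<i> * dir_deriv (\<lambda>j. \<i> * v j) f z) / 2"

definition dzbar_deriv :: "cvec \<Rightarrow> (cvec \<Rightarrow> complex) \<Rightarrow> cvec \<Rightarrow> complex" where
  "dzbar_deriv v f z = (dir_deriv v f z + \<i> * dir_deriv (\<lambda>j. \<i> * v j) f z) / 2"

definition hol_map_on :: "nat \<Rightarrow> cvec set \<Rightarrow> (cvec \<Rightarrow> cvec) \<Rightarrow> bool" where
  "hol_map_on n W \<tau> \<longleftrightarrow>
     (\<forall>i<n. smooth_on n W (\<lambda>z. \<tau> z i) \<and>
            (\<forall>z\<in>W. \<forall>v\<in>cspace n. dzbar_deriv v (\<lambda>z. \<tau> z i) z = 0))"

definition differential :: "(cvec \<Rightarrow> cvec) \<Rightarrow> cvec \<Rightarrow> cvec \<Rightarrow> cvec" where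
  "differential \<tau> z v = (\<lambda>i. dir_deriv v (\<lambda>z. \<tau> z i) z)"


section \<open>Complex manifolds\<close>

text \<open>A chart is a pair \<open>(U, \<phi>)\<close>; the values of \<open>\<phi>\<close> outside \<open>U\<close> are irrelevant.\<close>

type_synonym 'a chart = "'a set \<times> ('a \<Rightarrow> cvec)"

definition transition :: "'a chart \<Rightarrow> 'a chart \<Rightarrow> cvec \<Rightarrow> cvec" where
  "transition c d = (\<lambda>z. snd d (inv_into (fst c) (snd c) z))"

text \<open>
  The atlas \<open>A\<close> need not be maximal. Second countability is not assumed separately: it follows from
  compactness, the only case considered here.
\<close>

locale complex_manifold =
  fixes n :: nat and X :: "'a topology" and A :: "'a chart set"
  assumes Hausdorff: "Hausdorff_space X"
    and covering: "(\<Union>(U, \<phi>)\<in>A. U) = topspace X"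
    and chart_domain: "(U, \<phi>) \<in> A \<Longrightarrow> openin X U"
    and chart_range: "(U, \<phi>) \<in> A \<Longrightarrow> openin (top_of_set (cspace n)) (\<phi> ` U)"
    and chart_homeo: "(U, \<phi>) \<in> A \<Longrightarrow>
          homeomorphic_map (subtopology X U) (top_of_set (\<phi> ` U)) \<phi>"
    and transition_holomorphic: "(U, \<phi>) \<in> A \<Longrightarrow> (V, \<psi>) \<in> A \<Longrightarrow>
          hol_map_on n (\<phi> ` (U \<inter> V)) (transition (U, \<phi>) (V, \<psi>))"

locale compact_complex_manifold = complex_manifold +
  assumes compact: "compact_space X"


section \<open>Smooth \<open>(p,q)\<close>-forms\<close>

text \<open>
  A \<open>(p,q)\<close>-form is a section of \<open>\<Lambda>\<^sup>p T\<^sup>*\<^sup>1\<^sup>,\<^sup>0 \<otimes> \<Lambda>\<^sup>q T\<^sup>*\<^sup>0\<^sup>,\<^sup>1\<close>. In a chart it is a function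
  \<open>\<omega> c z vs ws\<close> of a point \<open>z\<close> of the chart image, alternating and \<open>\<complex>\<close>-linear in \<open>p\<close> vectors \<open>vs\<close>,
  alternating and conjugate-linear in \<open>q\<close> vectors \<open>ws\<close>; the form
  \<open>\<Sum> f\<^sub>I\<^sub>J dz\<^sub>I \<and> d(cnj z)\<^sub>J\<close> corresponds to
  \<open>\<Sum> f\<^sub>I\<^sub>J(z) det (vs\<^sub>a at index I\<^sub>b) cnj (det (ws\<^sub>a at index J\<^sub>b))\<close>. Local expressions in different
  charts are related by pullback along the transition maps. A form is \<open>0\<close> wherever its arguments
  are meaningless, so that equality of forms is equality of functions.
\<close>

type_synonym 'a form = "'a chart \<Rightarrow> cvec \<Rightarrow> cvec list \<Rightarrow> cvec list \<Rightarrow> complex"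

text \<open>\<open>\<sigma>\<close> is the identity (\<open>\<complex>\<close>-linear) or \<open>cnj\<close> (conjugate-linear).\<close>

definition alternating_multilinear ::
    "nat \<Rightarrow> nat \<Rightarrow> (complex \<Rightarrow> complex) \<Rightarrow> (cvec list \<Rightarrow> complex) \<Rightarrow> bool" where
  "alternating_multilinear n k \<sigma> F \<longleftrightarrow>
     (\<forall>vs\<in>vecs n k. \<forall>i<k. \<forall>a\<in>cspace n. \<forall>b\<in>cspace n. \<forall>c.
        F (vs[i := (\<lambda>j. a j + c * b j)]) = F (vs[i := a]) + \<sigma> c * F (vs[i := b])) \<and>
     (\<forall>vs\<in>vecs n k. \<not> distinct vs \<longrightarrow> F vs = 0)"

definition is_form :: "nat \<Rightarrow> 'a chart set \<Rightarrow> nat \<Rightarrow> nat \<Rightarrow> 'a form \<Rightarrow> bool" where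
  "is_form n A p q \<omega> \<longleftrightarrow>
     (\<forall>(U, \<phi>)\<in>A. \<forall>z\<in>\<phi> ` U.
        (\<forall>ws\<in>vecs n q. alternating_multilinear n p (\<lambda>c. c) (\<lambda>vs. \<omega> (U, \<phi>) z vs ws)) \<and>
        (\<forall>vs\<in>vecs n p. alternating_multilinear n q cnj (\<lambda>ws. \<omega> (U, \<phi>) z vs ws))) \<and>
     (\<forall>(U, \<phi>)\<in>A. \<forall>vs\<in>vecs n p. \<forall>ws\<in>vecs n q.
        smooth_on n (\<phi> ` U) (\<lambda>z. \<omega> (U, \<phi>) z vs ws)) \<and>
     (\<forall>(U, \<phi>)\<in>A. \<forall>(V, \<psi>)\<in>A. \<forall>z\<in>\<phi> ` (U \<inter> V). \<forall>vs\<in>vecs n p. \<forall>ws\<in>vecs n q.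
        let \<tau> = transition (U, \<phi>) (V, \<psi>) in
        \<omega> (U, \<phi>) z vs ws =
          \<omega> (V, \<psi>) (\<tau> z) (map (differential \<tau> z) vs) (map (differential \<tau> z) ws)) \<and>
     (\<forall>U \<phi> z vs ws.
        \<not> ((U, \<phi>) \<in> A \<and> z \<in> \<phi> ` U \<and> vs \<in> vecs n p \<and> ws \<in> vecs n q) \<longrightarrow> \<omega> (U, \<phi>) z vs ws = 0)"

definition forms :: "nat \<Rightarrow> 'a chart set \<Rightarrow> nat \<Rightarrow> nat \<Rightarrow> (complex, 'a form) module" where
  "forms n A p q =
     \<lparr>carrier = {\<omega>. is_form n A p q \<omega>},
      mult = (\<lambda>_ _ _ _ _ _. 0),
      one = (\<lambda>_ _ _ _. 0),
      zero = (\<lambda>_ _ _ _. 0),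
      add = (\<lambda>\<omega> \<eta> c z vs ws. \<omega> c z vs ws + \<eta> c z vs ws),
      smult = (\<lambda>a \<omega> c z vs ws. a * \<omega> c z vs ws)\<rparr>"

definition omit :: "nat \<Rightarrow> 'b list \<Rightarrow> 'b list" where
  "omit i xs = take i xs @ drop (Suc i) xs"

text \<open>
  These are the evaluations of
  \<open>\<partial>(\<Sum> f\<^sub>I\<^sub>J dz\<^sub>I \<and> d(cnj z)\<^sub>J) = \<Sum> \<partial>f\<^sub>I\<^sub>J/\<partial>z\<^sub>l dz\<^sub>l \<and> dz\<^sub>I \<and> d(cnj z)\<^sub>J\<close> and its conjugate
  analogue. The sign \<open>(-1)\<^sup>p\<close>, \<open>p = length vs\<close>, in the second comes from moving \<open>d(cnj z)\<^sub>l\<close> past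
  \<open>dz\<^sub>I\<close>.
\<close>

definition del :: "nat \<Rightarrow> 'a chart set \<Rightarrow> 'a form \<Rightarrow> 'a form" where
  "del n A \<omega> = (\<lambda>(U, \<phi>) z vs ws.
     if (U, \<phi>) \<in> A \<and> z \<in> \<phi> ` U \<and> set vs \<subseteq> cspace n \<and> set ws \<subseteq> cspace n
     then \<Sum>i<length vs. (-1) ^ i * dz_deriv (vs ! i) (\<lambda>z. \<omega> (U, \<phi>) z (omit i vs) ws) z
     else 0)"

definition delbar :: "nat \<Rightarrow> 'a chart set \<Rightarrow> 'a form \<Rightarrow> 'a form" where
  "delbar n A \<omega> = (\<lambda>(U, \<phi>) z vs ws.
     if (U, \<phi>) \<in> A \<and> z \<in> \<phi> ` U \<and> set vs \<subseteq> cspace n \<and> set ws \<subseteq> cspace n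
     then (-1) ^ length vs *
       (\<Sum>j<length ws. (-1) ^ j * dzbar_deriv (ws ! j) (\<lambda>z. \<omega> (U, \<phi>) z vs (omit j ws)) z)
     else 0)"


section \<open>Quotients and dimension\<close>

text \<open>In the scalar action the union runs over equal cosets, for \<open>W\<close> a subspace.\<close>

definition quot_space :: "(complex, 'v) module \<Rightarrow> 'v set \<Rightarrow> (complex, 'v set) module" where
  "quot_space V W =
     \<lparr>carrier = a_rcosets\<^bsub>V\<^esub> W,
      mult = (\<lambda>_ _. W),
      one = W,
      zero = W,
      add = set_add V,
      smult = (\<lambda>c S. \<Union>v\<in>S. W +>\<^bsub>V\<^esub> (c \<odot>\<^bsub>V\<^esub> v))\<rparr>"

text \<open>
  The map into the quotient by \<open>W\<close> induced by the identity, from a quotient by some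
  \<open>W' \<subseteq> W\<close>: again a union of equal cosets.
\<close>

definition quot_map :: "(complex, 'v) module \<Rightarrow> 'v set \<Rightarrow> 'v set \<Rightarrow> 'v set" where
  "quot_map V W S = (\<Union>v\<in>S. W +>\<^bsub>V\<^esub> v)"

text \<open>The dimension \<open>dim\<close> of the library is meaningful for finite-dimensional spaces only.\<close>

definition edim :: "(complex, 'v) module \<Rightarrow> enat" where
  "edim V = (if vectorspace.fin_dim class_ring V then enat (vectorspace.dim class_ring V) else \<infinity>)"


section \<open>Cohomologies\<close>

definition ker_del :: "nat \<Rightarrow> 'a chart set \<Rightarrow> nat \<Rightarrow> nat \<Rightarrow> 'a form set" where
  "ker_del n A p q = a_kernel (forms n A p q) (forms n A (Suc p) q) (del n A)"

definition ker_delbar :: "nat \<Rightarrow> 'a chart set \<Rightarrow> nat \<Rightarrow> nat \<Rightarrow> 'a form set" where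
  "ker_delbar n A p q = a_kernel (forms n A p q) (forms n A p (Suc q)) (delbar n A)"

definition ker_deldelbar :: "nat \<Rightarrow> 'a chart set \<Rightarrow> nat \<Rightarrow> nat \<Rightarrow> 'a form set" where
  "ker_deldelbar n A p q =
     a_kernel (forms n A p q) (forms n A (Suc p) (Suc q)) (del n A \<circ> delbar n A)"

text \<open>The images are taken inside bidegree \<open>(p,q)\<close>; there are no forms of negative degree.\<close>

definition im_del :: "nat \<Rightarrow> 'a chart set \<Rightarrow> nat \<Rightarrow> nat \<Rightarrow> 'a form set" where
  "im_del n A p q =
     (if p = 0 then {\<zero>\<^bsub>forms n A p q\<^esub>} else del n A ` carrier (forms n A (p - 1) q))"

definition im_delbar :: "nat \<Rightarrow> 'a chart set \<Rightarrow> nat \<Rightarrow> nat \<Rightarrow> 'a form set" where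
  "im_delbar n A p q =
     (if q = 0 then {\<zero>\<^bsub>forms n A p q\<^esub>} else delbar n A ` carrier (forms n A p (q - 1)))"

definition im_deldelbar :: "nat \<Rightarrow> 'a chart set \<Rightarrow> nat \<Rightarrow> nat \<Rightarrow> 'a form set" where
  "im_deldelbar n A p q =
     (if p = 0 \<or> q = 0 then {\<zero>\<^bsub>forms n A p q\<^esub>}
      else (del n A \<circ> delbar n A) ` carrier (forms n A (p - 1) (q - 1)))"

definition H_BC :: "nat \<Rightarrow> 'a chart set \<Rightarrow> nat \<Rightarrow> nat \<Rightarrow> (complex, 'a form set) module" where
  "H_BC n A p q =
     quot_space ((forms n A p q)\<lparr>carrier := ker_del n A p q \<inter> ker_delbar n A p q\<rparr>)
       (im_deldelbar n A p q)"

definition H_A :: "nat \<Rightarrow> 'a chart set \<Rightarrow> nat \<Rightarrow> nat \<Rightarrow> (complex, 'a form set) module" where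
  "H_A n A p q =
     quot_space ((forms n A p q)\<lparr>carrier := ker_deldelbar n A p q\<rparr>)
       (im_del n A p q <+>\<^bsub>forms n A p q\<^esub> im_delbar n A p q)"

definition H_delbar :: "nat \<Rightarrow> 'a chart set \<Rightarrow> nat \<Rightarrow> nat \<Rightarrow> (complex, 'a form set) module" where
  "H_delbar n A p q =
     quot_space ((forms n A p q)\<lparr>carrier := ker_delbar n A p q\<rparr>) (im_delbar n A p q)"

definition K_space :: "nat \<Rightarrow> 'a chart set \<Rightarrow> nat \<Rightarrow> nat \<Rightarrow> (complex, 'a form set) module" where
  "K_space n A p q =
     quot_space ((forms n A p q)\<lparr>carrier := ker_del n A p q \<inter> ker_delbar n A p q\<rparr>)
       ((im_del n A p q \<inter> ker_delbar n A p q) <+>\<^bsub>forms n A p q\<^esub>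
        (im_delbar n A p q \<inter> ker_del n A p q))"

definition pi_delbar :: "nat \<Rightarrow> 'a chart set \<Rightarrow> nat \<Rightarrow> nat \<Rightarrow> 'a form set \<Rightarrow> 'a form set" where
  "pi_delbar n A p q = quot_map (forms n A p q) (im_delbar n A p q)"

definition pi_A :: "nat \<Rightarrow> 'a chart set \<Rightarrow> nat \<Rightarrow> nat \<Rightarrow> 'a form set \<Rightarrow> 'a form set" where
  "pi_A n A p q =
     quot_map (forms n A p q) (im_del n A p q <+>\<^bsub>forms n A p q\<^esub> im_delbar n A p q)"

end

theory Submission
  imports Defs
begin

text \<open>
  In bidegree \<open>(p,q)\<close> let \<open>R\<close> and \<open>B\<close> be the images of \<open>del\<close> and \<open>delbar\<close>, let \<open>Z\<close> be the
  intersection of their kernels, and let \<open>N = R \<inter> ker delbar + B \<inter> ker del\<close>. The image of \<open>pi_delbar\<close> is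
  \<open>(Z + B)/B\<close>, because the image of \<open>del \<circ> delbar\<close> lies in \<open>B\<close>, and the kernel of \<open>pi_A\<close> is \<open>(N + B)/B\<close>.
  As \<open>Z \<inter> B \<subseteq> N\<close>, the identity on forms induces a linear surjection \<open>(Z + B)/B \<rightarrow> Z/N = K\<close> with kernel
  \<open>(N + B)/B\<close>, and rank-nullity, with infinite dimensions allowed, gives the formula. The analytic input
  is that \<open>del\<close> and \<open>delbar\<close> map forms to forms, square to zero and anticommute. Under a holomorphic
  change of charts, the second derivatives of the transition map drop out of \<open>del\<close> because they are
  symmetric while forms are alternating.
\<close>

section \<open>Calculus on open subsets of \<open>\<complex>\<^sup>n\<close>\<close>

lemma cspace_linear: "a \<in> cspace n \<Longrightarrow> b \<in> cspace n \<Longrightarrow> (\<lambda>j. a j + c * b j) \<in> cspace n"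
  by (simp add: cspace_def)

lemma cspace_scale: "v \<in> cspace n \<Longrightarrow> (\<lambda>j. c * v j) \<in> cspace n"
  by (simp add: cspace_def)

lemma tendsto_fun:
  fixes f :: "'b \<Rightarrow> 'i \<Rightarrow> 'c::topological_space"
  assumes "\<And>i. ((\<lambda>x. f x i) \<longlongrightarrow> l i) F"
  shows "(f \<longlongrightarrow> l) F"
proof -
  have "limitin (product_topology (\<lambda>i. euclidean) UNIV) f l F"
    using assms by (simp add: limitin_componentwise)
  then show ?thesis
    by (simp add: euclidean_product_topology)
qed

lemma mixed_partials_eq:
  fixes G A B C D :: "real \<Rightarrow> real \<Rightarrow> real"
  assumes "e > 0"
    and A: "\<And>s t. \<bar>s\<bar> < e \<Longrightarrow> \<bar>t\<bar> < e \<Longrightarrow> ((\<lambda>s. G s t) has_real_derivative A s t) (at s)"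
    and B: "\<And>s t. \<bar>s\<bar> < e \<Longrightarrow> \<bar>t\<bar> < e \<Longrightarrow> ((\<lambda>t. G s t) has_real_derivative B s t) (at t)"
    and C: "\<And>s t. \<bar>s\<bar> < e \<Longrightarrow> \<bar>t\<bar> < e \<Longrightarrow> ((\<lambda>t. A s t) has_real_derivative C s t) (at t)"
    and D: "\<And>s t. \<bar>s\<bar> < e \<Longrightarrow> \<bar>t\<bar> < e \<Longrightarrow> ((\<lambda>s. B s t) has_real_derivative D s t) (at s)"
    and contC: "isCont (\<lambda>p. C (fst p) (snd p)) (0, 0)"
    and contD: "isCont (\<lambda>p. D (fst p) (snd p)) (0, 0)"
  shows "C 0 0 = D 0 0"
proof (rule ccontr)
  assume neq: "C 0 0 \<noteq> D 0 0"
  define d where "d = \<bar>C 0 0 - D 0 0\<bar> / 2"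
  have "d > 0" using neq by (simp add: d_def)
  obtain r1 where r1: "r1 > 0" "\<And>p. dist p (0,0) < r1 \<Longrightarrow> dist (C (fst p) (snd p)) (C 0 0) < d"
    using contC \<open>d > 0\<close> unfolding continuous_at_eps_delta by fastforce
  obtain r2 where r2: "r2 > 0" "\<And>p. dist p (0,0) < r2 \<Longrightarrow> dist (D (fst p) (snd p)) (D 0 0) < d"
    using contD \<open>d > 0\<close> unfolding continuous_at_eps_delta by fastforce
  define h where "h = min e (min r1 r2) / 3"
  have h: "0 < h" "h < e" "2 * h < r1" "2 * h < r2"
    using \<open>e > 0\<close> r1(1) r2(1) by (auto simp: h_def)
  obtain s1 where s1: "0 < s1" "s1 < h"
    "(G h h - G h 0) - (G 0 h - G 0 0) = (h - 0) * (A s1 h - A s1 0)"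
    using MVT2[OF h(1), of "\<lambda>s. G s h - G s 0" "\<lambda>s. A s h - A s 0"] h
    by (force intro!: derivative_eq_intros A)
  obtain t1 where t1: "0 < t1" "t1 < h" "A s1 h - A s1 0 = (h - 0) * C s1 t1"
    using MVT2[OF h(1), of "\<lambda>t. A s1 t" "\<lambda>t. C s1 t"] h s1
    by (force intro!: C)
  obtain t2 where t2: "0 < t2" "t2 < h"
    "(G h h - G 0 h) - (G h 0 - G 0 0) = (h - 0) * (B h t2 - B 0 t2)"
    using MVT2[OF h(1), of "\<lambda>t. G h t - G 0 t" "\<lambda>t. B h t - B 0 t"] h
    by (force intro!: derivative_eq_intros B)
  obtain s2 where s2: "0 < s2" "s2 < h" "B h t2 - B 0 t2 = (h - 0) * D s2 t2"
    using MVT2[OF h(1), of "\<lambda>s. B s t2" "\<lambda>s. D s t2"] h t2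
    by (force intro!: D)
  have "h * (h * C s1 t1) = h * (h * D s2 t2)"
    using s1(3) t1(3) t2(3) s2(3) by (simp add: algebra_simps)
  then have eq: "C s1 t1 = D s2 t2" using h(1) by auto
  have small: "dist (s, t) (0, 0) < r" if "0 < s" "s < h" "0 < t" "t < h" "2 * h < r" for s t r :: real
    using sqrt_sum_squares_le_sum_abs[of s t] that by (simp add: dist_Pair_Pair)
  have "dist (C s1 t1) (C 0 0) < d" "dist (D s2 t2) (D 0 0) < d"
    using r1(2)[of "(s1,t1)"] r2(2)[of "(s2,t2)"] small s1 t1 s2 t2 h by auto
  then show False using eq by (simp add: d_def dist_real_def abs_if split: if_splits)
qed

lemma dir_deriv_const [simp]: "dir_deriv v (\<lambda>z. c) z = 0"
  by (simp add: dir_deriv_def)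

lemma dz_deriv_const [simp]: "dz_deriv v (\<lambda>z. c) z = 0"
  by (simp add: dz_deriv_def)

lemma dzbar_deriv_const [simp]: "dzbar_deriv v (\<lambda>z. c) z = 0"
  by (simp add: dzbar_deriv_def)

locale cdomain =
  fixes n :: nat and W :: "cvec set"
  assumes open_W: "openin (top_of_set (cspace n)) W"
begin

lemma W_subset: "W \<subseteq> cspace n"
  using open_W openin_imp_subset by fastforce

lemma W_cspace: "z \<in> W \<Longrightarrow> z \<in> cspace n"
  using W_subset by blast

lemma eventually_in_W:
  assumes "z \<in> W" "\<And>i. ((\<lambda>t. y t i) \<longlongrightarrow> z i) F" "eventually (\<lambda>t. y t \<in> cspace n) F"
  shows "eventually (\<lambda>t. y t \<in> W) F"
proof -
  obtain T where T: "open T" "W = cspace n \<inter> T"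
    using open_W by (auto simp: openin_open)
  have "(y \<longlongrightarrow> z) F" by (rule tendsto_fun) (rule assms)
  then have "eventually (\<lambda>t. y t \<in> T) F"
    using T assms(1) by (auto intro: topological_tendstoD)
  then show ?thesis using assms(3) by eventually_elim (simp add: T)
qed

lemma eventually_line:
  assumes "z \<in> W" "v \<in> cspace n"
  shows "eventually (\<lambda>t::real. (\<lambda>i. z i + of_real t * v i) \<in> W) (nhds 0)"
proof (rule eventually_in_W[OF assms(1)])
  show "((\<lambda>t. z i + complex_of_real t * v i) \<longlongrightarrow> z i) (nhds 0)" for i
  proof -
    have "isCont (\<lambda>t. z i + complex_of_real t * v i) 0" by (intro continuous_intros)
    then show ?thesis
      using tendsto_at_iff_tendsto_nhds[of "\<lambda>t. z i + complex_of_real t * v i" 0] by (simp add: isCont_def)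
  qed
  show "eventually (\<lambda>t::real. (\<lambda>i. z i + of_real t * v i) \<in> cspace n) (nhds 0)"
    using assms by (intro always_eventually allI cspace_linear) (auto intro: W_cspace)
qed

lemma dir_deriv_cong:
  assumes "\<And>x. x \<in> W \<Longrightarrow> f x = g x" "z \<in> W" "v \<in> cspace n"
  shows "dir_deriv v f z = dir_deriv v g z"
  unfolding dir_deriv_def
  using eventually_line[OF assms(2,3)]
  by (intro vector_derivative_cong_eq) (auto elim!: eventually_mono simp: assms(1))

lemma dz_deriv_cong:
  assumes "\<And>x. x \<in> W \<Longrightarrow> f x = g x" "z \<in> W" "v \<in> cspace n"
  shows "dz_deriv v f z = dz_deriv v g z"
  unfolding dz_deriv_def
  using dir_deriv_cong[of f g z, OF assms(1,2)] assms(3) cspace_scale[OF assms(3), of \<i>] by simp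

lemma dzbar_deriv_cong:
  assumes "\<And>x. x \<in> W \<Longrightarrow> f x = g x" "z \<in> W" "v \<in> cspace n"
  shows "dzbar_deriv v f z = dzbar_deriv v g z"
  unfolding dzbar_deriv_def
  using dir_deriv_cong[of f g z, OF assms(1,2)] assms(3) cspace_scale[OF assms(3), of \<i>] by simp

lemma differentiable_line_cong:
  assumes "\<And>x. x \<in> W \<Longrightarrow> f x = g x" "z \<in> W" "v \<in> cspace n"
    "(\<lambda>t::real. f (\<lambda>i. z i + of_real t * v i)) differentiable (at 0)"
  shows "(\<lambda>t::real. g (\<lambda>i. z i + of_real t * v i)) differentiable (at 0)"
proof -
  have "((\<lambda>t::real. g (\<lambda>i. z i + of_real t * v i)) has_vector_derivative
      vector_derivative (\<lambda>t::real. f (\<lambda>i. z i + of_real t * v i)) (at 0)) (at 0)"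
    using assms(4) eventually_line[OF assms(2,3)]
    by (subst has_vector_derivative_cong_ev[where g = "\<lambda>t::real. f (\<lambda>i. z i + of_real t * v i)"])
       (auto elim!: eventually_mono simp: assms(1,2) vector_derivative_works)
  then show ?thesis by (rule differentiableI_vector)
qed

lemma Ck_on_cong:
  assumes "Ck_on n k W f" "\<And>x. x \<in> W \<Longrightarrow> f x = g x"
  shows "Ck_on n k W g"
  using assms
proof (induction k arbitrary: f g)
  case 0
  then show ?case using continuous_on_eq[of W f g] by simp
next
  case (Suc k)
  have "continuous_on W g"
    using Suc.prems(1) by (intro continuous_on_eq[OF _ Suc.prems(2)]) simp_all
  moreover have "Ck_on n k W (dir_deriv v g)" if "v \<in> cspace n" for v
  proof (rule Suc.IH)
    show "Ck_on n k W (dir_deriv v f)" using Suc.prems(1) that by simp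
  qed (rule dir_deriv_cong[OF Suc.prems(2) _ that])
  moreover have "(\<lambda>t::real. g (\<lambda>i. z i + of_real t * v i)) differentiable (at 0)"
    if "z \<in> W" "v \<in> cspace n" for z v
    using Suc.prems(1) that by (intro differentiable_line_cong[OF Suc.prems(2) that]) simp_all
  ultimately show ?case by simp
qed

lemma has_dir_deriv:
  assumes "Ck_on n (Suc k) W f" "z \<in> W" "v \<in> cspace n"
  shows "((\<lambda>t::real. f (\<lambda>i. z i + of_real t * v i)) has_vector_derivative dir_deriv v f z) (at 0)"
  using assms by (simp add: dir_deriv_def vector_derivative_works)

lemma dir_derivI:
  "((\<lambda>t::real. f (\<lambda>i. z i + of_real t * v i)) has_vector_derivative D) (at 0)
    \<Longrightarrow> dir_deriv v f z = D"
  by (simp add: dir_deriv_def vector_derivative_at)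

lemma has_dir_deriv_shift:
  assumes "Ck_on n (Suc k) W f" "(\<lambda>i. z i + of_real t * v i) \<in> W" "v \<in> cspace n"
  shows "((\<lambda>t::real. f (\<lambda>i. z i + of_real t * v i)) has_vector_derivative
     dir_deriv v f (\<lambda>i. z i + of_real t * v i)) (at t)"
proof -
  have "((\<lambda>s::real. f (\<lambda>i. (z i + of_real t * v i) + of_real s * v i)) has_vector_derivative
     dir_deriv v f (\<lambda>i. z i + of_real t * v i)) (at (t - t))"
    using has_dir_deriv[OF assms] by simp
  moreover have "((\<lambda>s. s - t) has_vector_derivative 1) (at t)"
    by (auto intro!: derivative_eq_intros)
  ultimately have "((\<lambda>s::real. f (\<lambda>i. (z i + of_real t * v i) + of_real s * v i)) \<circ> (\<lambda>s. s - t)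
      has_vector_derivative 1 *\<^sub>R dir_deriv v f (\<lambda>i. z i + of_real t * v i)) (at t)"
    by (intro vector_diff_chain_at)
  then show ?thesis by (simp add: o_def algebra_simps)
qed

lemma dir_deriv_bounded_linear:
  assumes "bounded_linear h" "Ck_on n (Suc k) W f" "z \<in> W" "v \<in> cspace n"
  shows "dir_deriv v (\<lambda>z. h (f z)) z = h (dir_deriv v f z)"
  by (rule dir_derivI) (rule bounded_linear.has_vector_derivative[OF assms(1) has_dir_deriv[OF assms(2-4)]])

lemma dir_deriv_add:
  assumes "Ck_on n (Suc k) W f" "Ck_on n (Suc k) W g" "z \<in> W" "v \<in> cspace n"
  shows "dir_deriv v (\<lambda>z. f z + g z) z = dir_deriv v f z + dir_deriv v g z"
  by (rule dir_derivI) (rule has_vector_derivative_add[OF has_dir_deriv[OF assms(1,3,4)] has_dir_deriv[OF assms(2,3,4)]])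

lemma Ck_on_bounded_linear:
  assumes "bounded_linear h"
  shows "Ck_on n k W f \<Longrightarrow> Ck_on n k W (\<lambda>z. h (f z))"
proof (induction k arbitrary: f)
  case 0
  then show ?case using bounded_linear.continuous_on[OF assms] by simp
next
  case (Suc k)
  have "continuous_on W (\<lambda>z. h (f z))"
    using Suc.prems by (intro bounded_linear.continuous_on[OF assms]) simp
  moreover have "(\<lambda>t::real. h (f (\<lambda>i. z i + of_real t * v i))) differentiable (at 0)"
    if "z \<in> W" "v \<in> cspace n" for z v
    using bounded_linear.has_vector_derivative[OF assms has_dir_deriv[OF Suc.prems that]]
    by (rule differentiableI_vector)
  moreover have "Ck_on n k W (dir_deriv v (\<lambda>z. h (f z)))" if "v \<in> cspace n" for v
  proof (rule Ck_on_cong)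
    show "Ck_on n k W (\<lambda>z. h (dir_deriv v f z))"
      by (rule Suc.IH) (use Suc.prems that in simp)
  qed (use that in \<open>simp add: dir_deriv_bounded_linear[OF assms Suc.prems]\<close>)
  ultimately show ?case by simp
qed

lemma Ck_on_add: "Ck_on n k W f \<Longrightarrow> Ck_on n k W g \<Longrightarrow> Ck_on n k W (\<lambda>z. f z + g z)"
proof (induction k arbitrary: f g)
  case 0
  then show ?case by (auto intro: continuous_intros)
next
  case (Suc k)
  have "continuous_on W (\<lambda>z. f z + g z)"
    using Suc.prems by (auto intro: continuous_intros)
  moreover have "(\<lambda>t::real. f (\<lambda>i. z i + of_real t * v i) + g (\<lambda>i. z i + of_real t * v i))
      differentiable (at 0)"
    if "z \<in> W" "v \<in> cspace n" for z v
    using has_vector_derivative_add[OF has_dir_deriv[OF Suc.prems(1) that] has_dir_deriv[OF Suc.prems(2) that]]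
    by (rule differentiableI_vector)
  moreover have "Ck_on n k W (dir_deriv v (\<lambda>z. f z + g z))" if "v \<in> cspace n" for v
  proof (rule Ck_on_cong)
    show "Ck_on n k W (\<lambda>z. dir_deriv v f z + dir_deriv v g z)"
      by (rule Suc.IH) (use Suc.prems that in simp_all)
  qed (use that in \<open>simp add: dir_deriv_add[OF Suc.prems]\<close>)
  ultimately show ?case by simp
qed

lemma Ck_on_const: "Ck_on n k W (\<lambda>z. c)"
proof (induction k arbitrary: c)
  case (Suc k)
  have "dir_deriv v (\<lambda>z. c) = (\<lambda>z. 0)" for v by (rule ext) simp
  then show ?case using Suc by simp
qed simp

lemma smooth_on_const: "smooth_on n W (\<lambda>z. c)"
  by (simp add: smooth_on_def Ck_on_const)

lemma smooth_on_cong: "smooth_on n W f \<Longrightarrow> (\<And>x. x \<in> W \<Longrightarrow> f x = g x) \<Longrightarrow> smooth_on n W g"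
  unfolding smooth_on_def using Ck_on_cong by blast

lemma smooth_on_add: "smooth_on n W f \<Longrightarrow> smooth_on n W g \<Longrightarrow> smooth_on n W (\<lambda>z. f z + g z)"
  by (simp add: smooth_on_def Ck_on_add)

lemma smooth_on_bounded_linear:
  "bounded_linear h \<Longrightarrow> smooth_on n W f \<Longrightarrow> smooth_on n W (\<lambda>z. h (f z))"
  by (simp add: smooth_on_def Ck_on_bounded_linear)

lemma smooth_on_cmult: "smooth_on n W f \<Longrightarrow> smooth_on n W (\<lambda>z. c * f z)"
  by (rule smooth_on_bounded_linear) (rule bounded_linear_mult_right)

lemma smooth_on_cnj: "smooth_on n W f \<Longrightarrow> smooth_on n W (\<lambda>z. cnj (f z))"
  by (rule smooth_on_bounded_linear) (rule bounded_linear_cnj)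

lemma smooth_on_diff:
  "smooth_on n W f \<Longrightarrow> smooth_on n W g \<Longrightarrow> smooth_on n W (\<lambda>z. f z - g z)"
  using smooth_on_add[of f "\<lambda>z. -1 * g z"] smooth_on_cmult[of g "-1"] by simp

lemma smooth_on_sum:
  "(\<And>i. i \<in> I \<Longrightarrow> smooth_on n W (f i)) \<Longrightarrow> smooth_on n W (\<lambda>z. \<Sum>i\<in>I. f i z)"
  by (induction I rule: infinite_finite_induct) (auto intro: smooth_on_const smooth_on_add)

lemma smooth_on_dir_deriv: "smooth_on n W f \<Longrightarrow> v \<in> cspace n \<Longrightarrow> smooth_on n W (dir_deriv v f)"
  unfolding smooth_on_def by (metis Ck_on.simps(2))

lemma smooth_on_dz_deriv:
  assumes "smooth_on n W f" "v \<in> cspace n"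
  shows "smooth_on n W (dz_deriv v f)"
proof -
  have "smooth_on n W (\<lambda>z. 1/2 * (dir_deriv v f z - \<i> * dir_deriv (\<lambda>j. \<i> * v j) f z))"
    using assms by (intro smooth_on_cmult smooth_on_diff smooth_on_dir_deriv cspace_scale)
  then show ?thesis by (simp add: dz_deriv_def[abs_def])
qed

lemma smooth_on_dzbar_deriv:
  assumes "smooth_on n W f" "v \<in> cspace n"
  shows "smooth_on n W (dzbar_deriv v f)"
proof -
  have "smooth_on n W (\<lambda>z. 1/2 * (dir_deriv v f z + \<i> * dir_deriv (\<lambda>j. \<i> * v j) f z))"
    using assms by (intro smooth_on_cmult smooth_on_add smooth_on_dir_deriv cspace_scale)
  then show ?thesis by (simp add: dzbar_deriv_def[abs_def])
qed

lemma smooth_dir_deriv_add: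
  assumes "smooth_on n W f" "smooth_on n W g" "z \<in> W" "v \<in> cspace n"
  shows "dir_deriv v (\<lambda>z. f z + g z) z = dir_deriv v f z + dir_deriv v g z"
  using assms dir_deriv_add[of 0 f g] by (simp add: smooth_on_def del: Ck_on.simps)

lemma smooth_dir_deriv_bounded_linear:
  assumes "bounded_linear h" "smooth_on n W f" "z \<in> W" "v \<in> cspace n"
  shows "dir_deriv v (\<lambda>z. h (f z)) z = h (dir_deriv v f z)"
  using assms dir_deriv_bounded_linear[of h 0 f] by (simp add: smooth_on_def del: Ck_on.simps)

lemma dir_deriv_cmult:
  assumes "smooth_on n W f" "z \<in> W" "v \<in> cspace n"
  shows "dir_deriv v (\<lambda>z. c * f z) z = c * dir_deriv v f z"
  using smooth_dir_deriv_bounded_linear[OF bounded_linear_mult_right assms] .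

lemma dir_deriv_cnj:
  assumes "smooth_on n W f" "z \<in> W" "v \<in> cspace n"
  shows "dir_deriv v (\<lambda>z. cnj (f z)) z = cnj (dir_deriv v f z)"
  using smooth_dir_deriv_bounded_linear[OF bounded_linear_cnj assms] .

lemma dz_deriv_add:
  assumes "smooth_on n W f" "smooth_on n W g" "z \<in> W" "v \<in> cspace n"
  shows "dz_deriv v (\<lambda>z. f z + g z) z = dz_deriv v f z + dz_deriv v g z"
  using assms by (simp add: dz_deriv_def smooth_dir_deriv_add cspace_scale field_simps)

lemma dz_deriv_cmult:
  assumes "smooth_on n W f" "z \<in> W" "v \<in> cspace n"
  shows "dz_deriv v (\<lambda>z. c * f z) z = c * dz_deriv v f z"
  using assms by (simp add: dz_deriv_def dir_deriv_cmult cspace_scale field_simps)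

lemma dz_deriv_cnj:
  assumes "smooth_on n W f" "z \<in> W" "v \<in> cspace n"
  shows "dz_deriv v (\<lambda>z. cnj (f z)) z = cnj (dzbar_deriv v f z)"
  using assms by (simp add: dz_deriv_def dzbar_deriv_def dir_deriv_cnj cspace_scale)

lemma dzbar_deriv_add:
  assumes "smooth_on n W f" "smooth_on n W g" "z \<in> W" "v \<in> cspace n"
  shows "dzbar_deriv v (\<lambda>z. f z + g z) z = dzbar_deriv v f z + dzbar_deriv v g z"
  using assms by (simp add: dzbar_deriv_def smooth_dir_deriv_add cspace_scale field_simps)

lemma dzbar_deriv_cmult:
  assumes "smooth_on n W f" "z \<in> W" "v \<in> cspace n"
  shows "dzbar_deriv v (\<lambda>z. c * f z) z = c * dzbar_deriv v f z"
  using assms by (simp add: dzbar_deriv_def dir_deriv_cmult cspace_scale field_simps)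

lemma dz_deriv_sum:
  assumes "\<And>i. i \<in> I \<Longrightarrow> smooth_on n W (f i)" "z \<in> W" "v \<in> cspace n"
  shows "dz_deriv v (\<lambda>z. \<Sum>i\<in>I. f i z) z = (\<Sum>i\<in>I. dz_deriv v (f i) z)"
  using assms(1)
  by (induction I rule: infinite_finite_induct)
     (auto simp: dz_deriv_add smooth_on_sum assms(2,3))

lemma dzbar_deriv_sum:
  assumes "\<And>i. i \<in> I \<Longrightarrow> smooth_on n W (f i)" "z \<in> W" "v \<in> cspace n"
  shows "dzbar_deriv v (\<lambda>z. \<Sum>i\<in>I. f i z) z = (\<Sum>i\<in>I. dzbar_deriv v (f i) z)"
  using assms(1)
  by (induction I rule: infinite_finite_induct)
     (auto simp: dzbar_deriv_add dzbar_deriv_def[of _ "\<lambda>z. 0"] smooth_on_sum assms(2,3))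

end

definition re_unit :: "nat \<Rightarrow> cvec" where
  "re_unit k = (\<lambda>j. if j = k then 1 else 0)"

definition im_unit :: "nat \<Rightarrow> cvec" where
  "im_unit k = (\<lambda>j. if j = k then \<i> else 0)"

lemma re_unit_cspace: "k < n \<Longrightarrow> re_unit k \<in> cspace n"
  by (auto simp: re_unit_def cspace_def)

lemma im_unit_cspace: "k < n \<Longrightarrow> im_unit k \<in> cspace n"
  by (auto simp: im_unit_def cspace_def)

lemma real_linear_expansion:
  fixes L :: "cvec \<Rightarrow> complex"
  assumes lin: "\<And>a b r. a \<in> cspace n \<Longrightarrow> b \<in> cspace n \<Longrightarrow>
      L (\<lambda>j. a j + complex_of_real r * b j) = L a + of_real r * L b"
    and x: "x \<in> cspace n"
  shows "L x = (\<Sum>k<n. of_real (Re (x k)) * L (re_unit k) + of_real (Im (x k)) * L (im_unit k))"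
proof -
  have zero: "(\<lambda>j. 0) \<in> cspace n" by (simp add: cspace_def)
  have L0: "L (\<lambda>j. 0) = 0" using lin[OF zero zero, of 1] by simp
  have "L (\<lambda>j. if j < m then x j else 0) =
      (\<Sum>k<m. of_real (Re (x k)) * L (re_unit k) + of_real (Im (x k)) * L (im_unit k))"
    if "m \<le> n" for m
    using that
  proof (induction m)
    case 0
    then show ?case by (simp add: L0)
  next
    case (Suc m)
    define a where "a = (\<lambda>j. if j < m then x j else 0)"
    define b where "b = (\<lambda>j. a j + complex_of_real (Re (x m)) * re_unit m j)"
    have a: "a \<in> cspace n" using Suc.prems by (auto simp: a_def cspace_def)
    have b: "b \<in> cspace n" unfolding b_def using a Suc.prems by (intro cspace_linear re_unit_cspace) auto
    have "(\<lambda>j. if j < Suc m then x j else 0) = (\<lambda>j. b j + complex_of_real (Im (x m)) * im_unit m j)"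
      by (auto simp: b_def a_def re_unit_def im_unit_def fun_eq_iff complex_eq_iff less_Suc_eq)
    then have "L (\<lambda>j. if j < Suc m then x j else 0) = L b + of_real (Im (x m)) * L (im_unit m)"
      using lin[OF b im_unit_cspace] Suc.prems by simp
    also have "L b = L a + of_real (Re (x m)) * L (re_unit m)"
      unfolding b_def using lin[OF a re_unit_cspace] Suc.prems by simp
    finally show ?case using Suc by (simp add: a_def)
  qed
  from this[OF order_refl]
  have "L (\<lambda>j. if j < n then x j else 0) =
      (\<Sum>k<n. of_real (Re (x k)) * L (re_unit k) + of_real (Im (x k)) * L (im_unit k))" .
  moreover have "(\<lambda>j. if j < n then x j else 0) = x"
    using x by (auto simp: cspace_def fun_eq_iff)
  ultimately show ?thesis by simp
qed

context cdomain
begin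

lemma curve_add_direction:
  assumes f: "Ck_on n (Suc 0) W f" and z: "z \<in> W" and v: "v \<in> cspace n"
    and Y: "\<And>t. Y t \<in> cspace n" "Y 0 = z" "\<And>i. isCont (\<lambda>t. Y t i) 0"
    and D: "((\<lambda>t. f (Y t)) has_vector_derivative D) (at 0)"
    and a: "(a has_real_derivative a') (at 0)" "a 0 = 0"
  shows "((\<lambda>t. f (\<lambda>i. Y t i + of_real (a t) * v i)) has_vector_derivative
     D + of_real a' * dir_deriv v f z) (at 0)"
proof -
  define P where "P = (\<lambda>p i. Y (fst p) i + complex_of_real (snd p) * v i)"
  have lim: "((\<lambda>p. P p i) \<longlongrightarrow> z i) (nhds (0, 0))" for i
  proof -
    have "isCont (\<lambda>p. Y (fst p) i) (0, 0)"
      by (rule isCont_o2[of _ fst]) (use Y in \<open>auto intro: continuous_intros\<close>)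
    then have "isCont (\<lambda>p. P p i) (0, 0)"
      unfolding P_def by (intro continuous_intros)
    then show ?thesis
      using tendsto_at_iff_tendsto_nhds[of "\<lambda>p. P p i" "(0,0)"] Y by (simp add: isCont_def P_def)
  qed
  have "P p \<in> cspace n" for p
    unfolding P_def using Y(1) v by (intro cspace_linear) auto
  then have ev: "eventually (\<lambda>p. P p \<in> W) (nhds (0, 0))"
    by (intro eventually_in_W[OF z lim]) simp
  then obtain d where d: "d > 0" "\<And>p. dist p (0, 0) < d \<Longrightarrow> P p \<in> W"
    unfolding eventually_nhds_metric by blast
  define S where "S = {- (d/2) <..< d/2}"
  have S: "0 \<in> S" "convex S" "open S" using d by (auto simp: S_def)
  have PW: "P (s, t) \<in> W" if "s \<in> S" "t \<in> S" for s t
    using sqrt_sum_squares_le_sum_abs[of s t] that by (intro d) (auto simp: dist_Pair_Pair S_def)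
  have P0: "P (0, 0) = z" by (simp add: P_def Y)
  have "((\<lambda>(s, t). f (P (s, t))) has_derivative
      (\<lambda>(tx, ty). tx *\<^sub>R D + blinfun_apply (blinfun_scaleR_left (dir_deriv v f (P (0, 0)))) ty))
      (at (0, 0) within S \<times> S)"
  proof (rule has_derivative_partialsI[where f = "\<lambda>s t. f (P (s, t))"
        and fy = "\<lambda>s t. blinfun_scaleR_left (dir_deriv v f (P (s, t)))"])
    show "((\<lambda>s. f (P (s, 0))) has_derivative (\<lambda>tx. tx *\<^sub>R D)) (at 0 within S)"
      using D unfolding has_vector_derivative_def P_def by (simp add: has_derivative_at_withinI)
    show "((\<lambda>t. f (P (s, t))) has_derivative
        blinfun_apply (blinfun_scaleR_left (dir_deriv v f (P (s, t))))) (at t within S)"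
      if "s \<in> S" "t \<in> S" for s t
      using has_dir_deriv_shift[OF f, of "Y s" t v] PW[OF that] v
      unfolding has_vector_derivative_def P_def
      by (simp add: has_derivative_at_withinI fun_eq_iff)
    have "(P \<longlongrightarrow> z) (nhds (0, 0))" by (rule tendsto_fun) (rule lim)
    then have "((\<lambda>p. dir_deriv v f (P p)) \<longlongrightarrow> dir_deriv v f z) (nhds (0, 0))"
      using f z v ev by (intro continuous_on_tendsto_compose[of W "dir_deriv v f"]) simp_all
    then have "((\<lambda>p. dir_deriv v f (P p)) \<longlongrightarrow> dir_deriv v f z) (at (0, 0) within S \<times> S)"
      by (rule tendsto_mono[rotated]) (simp add: at_within_def)
    then have "((\<lambda>p. blinfun_scaleR_left (dir_deriv v f (P p))) \<longlongrightarrow>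
        blinfun_scaleR_left (dir_deriv v f z)) (at (0, 0) within S \<times> S)"
      by (rule bounded_linear.tendsto[OF bounded_linear_blinfun_scaleR_left])
    then show "continuous (at (0, 0) within S \<times> S)
        (\<lambda>(s, t). blinfun_scaleR_left (dir_deriv v f (P (s, t))))"
      by (simp add: continuous_within P0 case_prod_unfold)
  qed (use S in auto)
  then have F: "((\<lambda>p. f (P p)) has_derivative
      (\<lambda>(tx, ty). tx *\<^sub>R D + ty *\<^sub>R dir_deriv v f z)) (at (0, 0))"
    using S by (simp add: P0 case_prod_unfold at_within_open[of _ "S \<times> S"] open_Times)
  have "((\<lambda>t. (t, a t)) has_derivative (\<lambda>h. (h, h * a'))) (at 0)"
    using a(1) mult_commute_abs[of a']
    by (auto intro!: has_derivative_Pair derivative_eq_intros simp: has_field_derivative_def)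
  then have "((\<lambda>t. f (P (t, a t))) has_derivative (\<lambda>h. h *\<^sub>R D + (h * a') *\<^sub>R dir_deriv v f z)) (at 0)"
    using has_derivative_compose[of "\<lambda>t. (t, a t)" _ 0 UNIV "\<lambda>p. f (P p)"] F a(2) by fastforce
  then show ?thesis
    unfolding has_vector_derivative_def P_def
    by (simp add: scaleR_conv_of_real algebra_simps)
qed

lemma chain_rule_coordinates:
  assumes f: "Ck_on n (Suc 0) W f" and z: "z \<in> W"
    and y: "y 0 = z" "\<And>i. i < n \<Longrightarrow> ((\<lambda>t. y t i) has_vector_derivative y' i) (at 0)"
    and m: "m \<le> n"
  shows "((\<lambda>t. f (\<lambda>i. if i < m then y t i else z i)) has_vector_derivative
     (\<Sum>k<m. of_real (Re (y' k)) * dir_deriv (re_unit k) f z + of_real (Im (y' k)) * dir_deriv (im_unit k) f z)) (at 0)"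
  using m
proof (induction m)
  case 0
  then show ?case by simp
next
  case (Suc m)
  then have m: "m < n" by simp
  define Y where "Y = (\<lambda>t i. if i < m then y t i else z i)"
  define Y1 where "Y1 = (\<lambda>t i. Y t i + of_real (Re (y t m) - Re (z m)) * re_unit m i)"
  have zc: "z i = 0" if "i \<ge> n" for i using W_cspace[OF z] that by (simp add: cspace_def)
  have y_cont: "isCont (\<lambda>t. y t i) 0" if "i < n" for i
    using y(2)[OF that] by (rule has_vector_derivative_continuous)
  have Yc: "Y t \<in> cspace n" for t using m zc by (auto simp: Y_def cspace_def)
  have Y0: "Y 0 = z" by (auto simp: Y_def y)
  have Ycont: "isCont (\<lambda>t. Y t i) 0" for i
    using m y_cont[of i] by (cases "i < m") (auto simp: Y_def)
  have dRe: "((\<lambda>t. Re (y t m) - Re (z m)) has_real_derivative Re (y' m)) (at 0)"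
    using bounded_linear.has_vector_derivative[OF bounded_linear_Re y(2)[OF m]]
    by (auto intro!: derivative_eq_intros simp: has_real_derivative_iff_has_vector_derivative)
  have dIm: "((\<lambda>t. Im (y t m) - Im (z m)) has_real_derivative Im (y' m)) (at 0)"
    using bounded_linear.has_vector_derivative[OF bounded_linear_Im y(2)[OF m]]
    by (auto intro!: derivative_eq_intros simp: has_real_derivative_iff_has_vector_derivative)
  have IH: "((\<lambda>t. f (Y t)) has_vector_derivative
     (\<Sum>k<m. of_real (Re (y' k)) * dir_deriv (re_unit k) f z + of_real (Im (y' k)) * dir_deriv (im_unit k) f z)) (at 0)"
    using Suc unfolding Y_def by simp
  have 1: "((\<lambda>t. f (Y1 t)) has_vector_derivative
     (\<Sum>k<m. of_real (Re (y' k)) * dir_deriv (re_unit k) f z + of_real (Im (y' k)) * dir_deriv (im_unit k) f z)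
      + of_real (Re (y' m)) * dir_deriv (re_unit m) f z) (at 0)"
    unfolding Y1_def
    by (rule curve_add_direction[OF f z re_unit_cspace[OF m] Yc Y0 Ycont IH dRe]) (simp add: y)
  have Y1c: "Y1 t \<in> cspace n" for t
    unfolding Y1_def using Yc re_unit_cspace[OF m] by (rule cspace_linear)
  have Y10: "Y1 0 = z" by (auto simp: Y1_def Y0 y)
  have Y1cont: "isCont (\<lambda>t. Y1 t i) 0" for i
    unfolding Y1_def using Ycont y_cont[OF m] by (intro continuous_intros isCont_Re)
  have 2: "((\<lambda>t. f (\<lambda>i. Y1 t i + of_real (Im (y t m) - Im (z m)) * im_unit m i)) has_vector_derivative
     ((\<Sum>k<m. of_real (Re (y' k)) * dir_deriv (re_unit k) f z + of_real (Im (y' k)) * dir_deriv (im_unit k) f z)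
      + of_real (Re (y' m)) * dir_deriv (re_unit m) f z)
      + of_real (Im (y' m)) * dir_deriv (im_unit m) f z) (at 0)"
    by (rule curve_add_direction[OF f z im_unit_cspace[OF m] Y1c Y10 Y1cont 1 dIm]) (simp add: y)
  have "(\<lambda>i. Y1 t i + of_real (Im (y t m) - Im (z m)) * im_unit m i) = (\<lambda>i. if i < Suc m then y t i else z i)" for t
    by (auto simp: Y1_def Y_def re_unit_def im_unit_def fun_eq_iff complex_eq_iff less_Suc_eq)
  then show ?case using 2 by (simp add: add.assoc)
qed

lemma dir_deriv_expansion:
  assumes f: "Ck_on n (Suc 0) W f" and z: "z \<in> W" and v: "v \<in> cspace n"
  shows "dir_deriv v f z = (\<Sum>k<n. of_real (Re (v k)) * dir_deriv (re_unit k) f z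
    + of_real (Im (v k)) * dir_deriv (im_unit k) f z)"
proof (rule dir_derivI)
  have "((\<lambda>t. z i + complex_of_real t * v i) has_vector_derivative v i) (at 0)" for i
    by (auto intro!: derivative_eq_intros simp: scaleR_conv_of_real)
  from chain_rule_coordinates[OF f z _ this order_refl]
  have "((\<lambda>t::real. f (\<lambda>i. if i < n then z i + of_real t * v i else z i)) has_vector_derivative
     (\<Sum>k<n. of_real (Re (v k)) * dir_deriv (re_unit k) f z + of_real (Im (v k)) * dir_deriv (im_unit k) f z)) (at 0)"
    by simp
  moreover have "(\<lambda>i. if i < n then z i + complex_of_real t * v i else z i) = (\<lambda>i. z i + of_real t * v i)" for t
    using v by (auto simp: cspace_def)
  ultimately show "((\<lambda>t::real. f (\<lambda>i. z i + of_real t * v i)) has_vector_derivative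
     (\<Sum>k<n. of_real (Re (v k)) * dir_deriv (re_unit k) f z + of_real (Im (v k)) * dir_deriv (im_unit k) f z)) (at 0)"
    by simp
qed

lemma chain_rule_curve:
  assumes f: "Ck_on n (Suc 0) W f" and z: "z \<in> W"
    and y: "y 0 = z" "eventually (\<lambda>t. y t \<in> cspace n) (nhds 0)"
      "\<And>i. ((\<lambda>t. y t i) has_vector_derivative y' i) (at 0)"
    and y': "y' \<in> cspace n"
  shows "((\<lambda>t. f (y t)) has_vector_derivative dir_deriv y' f z) (at 0)"
proof -
  have "((\<lambda>t. f (\<lambda>i. if i < n then y t i else z i)) has_vector_derivative dir_deriv y' f z) (at 0)"
    unfolding dir_deriv_expansion[OF f z y'] using y by (intro chain_rule_coordinates[OF f z]) auto
  moreover have "eventually (\<lambda>t. f (\<lambda>i. if i < n then y t i else z i) = f (y t)) (nhds 0)"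
    using y(2)
  proof eventually_elim
    case (elim t)
    have "(\<lambda>i. if i < n then y t i else z i) = y t"
      using elim W_cspace[OF z] by (auto simp: cspace_def fun_eq_iff)
    then show ?case by simp
  qed
  ultimately show ?thesis
    using y(1) W_cspace[OF z]
    by (subst has_vector_derivative_cong_ev[where g = "\<lambda>t. f (\<lambda>i. if i < n then y t i else z i)"])
       (auto elim!: eventually_mono simp: if_distrib)
qed

lemma dir_deriv_linear:
  assumes f: "smooth_on n W f" and z: "z \<in> W" and a: "a \<in> cspace n" and b: "b \<in> cspace n"
  shows "dir_deriv (\<lambda>j. a j + of_real r * b j) f z = dir_deriv a f z + of_real r * dir_deriv b f z"
proof -
  have f1: "Ck_on n (Suc 0) W f" using f unfolding smooth_on_def by blast
  show ?thesis
    unfolding dir_deriv_expansion[OF f1 z a] dir_deriv_expansion[OF f1 z b]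
      dir_deriv_expansion[OF f1 z cspace_linear[OF a b]]
    by (simp add: sum.distrib sum_distrib_left algebra_simps)
qed

lemma dir_deriv_complex_linear:
  assumes f: "smooth_on n W f" and z: "z \<in> W" and a: "a \<in> cspace n" and b: "b \<in> cspace n"
  shows "dir_deriv (\<lambda>j. a j + c * b j) f z =
    dir_deriv a f z + of_real (Re c) * dir_deriv b f z + of_real (Im c) * dir_deriv (\<lambda>j. \<i> * b j) f z"
proof -
  have "(\<lambda>j. a j + c * b j) = (\<lambda>j. (a j + of_real (Re c) * b j) + of_real (Im c) * (\<i> * b j))"
    by (rule ext) (simp add: complex_eq_iff)
  then show ?thesis
    using dir_deriv_linear[OF f z cspace_linear[OF a b] cspace_scale[OF b]]
      dir_deriv_linear[OF f z a b] by simp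
qed

lemma dz_deriv_linear:
  assumes f: "smooth_on n W f" and z: "z \<in> W" and a: "a \<in> cspace n" and b: "b \<in> cspace n"
  shows "dz_deriv (\<lambda>j. a j + c * b j) f z = dz_deriv a f z + c * dz_deriv b f z"
proof -
  have "(\<lambda>j. \<i> * (a j + c * b j)) = (\<lambda>j. \<i> * a j + (\<i> * c) * b j)"
    by (simp add: algebra_simps)
  then have "dz_deriv (\<lambda>j. a j + c * b j) f z =
     (dir_deriv (\<lambda>j. a j + c * b j) f z - \<i> * dir_deriv (\<lambda>j. \<i> * a j + (\<i> * c) * b j) f z) / 2"
    unfolding dz_deriv_def by simp
  also have "\<dots> = dz_deriv a f z + c * dz_deriv b f z"
    unfolding dir_deriv_complex_linear[OF f z a b] dir_deriv_complex_linear[OF f z cspace_scale[OF a] b] dz_deriv_def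
    by (simp add: complex_eq_iff field_simps)
  finally show ?thesis .
qed

lemma dir_deriv_commute:
  assumes f: "smooth_on n W f" and z: "z \<in> W" and u: "u \<in> cspace n" and v: "v \<in> cspace n"
  shows "dir_deriv u (dir_deriv v f) z = dir_deriv v (dir_deriv u f) z"
proof -
  have Ck: "Ck_on n k W f" "Ck_on n k W (dir_deriv w f)" "Ck_on n k W (dir_deriv x (dir_deriv w f))"
    if "w \<in> cspace n" "x \<in> cspace n" for w x k
    using f smooth_on_dir_deriv that unfolding smooth_on_def by blast+
  define P where "P = (\<lambda>s t i. z i + complex_of_real s * u i + complex_of_real t * v i)"
  have PC: "P s t \<in> cspace n" for s t
    using z u v unfolding P_def by (intro cspace_linear) (auto intro: W_cspace)
  have P0: "P 0 0 = z" by (simp add: P_def)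
  have lim: "((\<lambda>p. P (fst p) (snd p) i) \<longlongrightarrow> z i) (nhds (0, 0))" for i
  proof -
    have "isCont (\<lambda>p. P (fst p) (snd p) i) (0, 0)"
      unfolding P_def by (intro continuous_intros)
    then show ?thesis
      using tendsto_at_iff_tendsto_nhds[of "\<lambda>p. P (fst p) (snd p) i" "(0,0)"] by (simp add: isCont_def P_def)
  qed
  have ev: "eventually (\<lambda>p. P (fst p) (snd p) \<in> W) (nhds (0, 0))"
    by (rule eventually_in_W[OF z lim]) (simp add: PC)
  then obtain d where d: "d > 0" "\<And>p. dist p (0, 0) < d \<Longrightarrow> P (fst p) (snd p) \<in> W"
    unfolding eventually_nhds_metric by blast
  have PW: "P s t \<in> W" if "\<bar>s\<bar> < d/2" "\<bar>t\<bar> < d/2" for s t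
    using sqrt_sum_squares_le_sum_abs[of s t] that d(2)[of "(s,t)"] by (auto simp: dist_Pair_Pair)
  have limP: "((\<lambda>p. P (fst p) (snd p)) \<longlongrightarrow> z) (nhds (0, 0))"
    by (rule tendsto_fun) (rule lim)
  have ds: "((\<lambda>s. g (P s t)) has_vector_derivative dir_deriv u g (P s t)) (at s)"
    if "Ck_on n (Suc 0) W g" "\<bar>s\<bar> < d/2" "\<bar>t\<bar> < d/2" for g s t
    using has_dir_deriv_shift[OF that(1), of "\<lambda>i. z i + of_real t * v i" s u] PW[OF that(2,3)] u
    unfolding P_def by (simp add: algebra_simps)
  have dt: "((\<lambda>t. g (P s t)) has_vector_derivative dir_deriv v g (P s t)) (at t)"
    if "Ck_on n (Suc 0) W g" "\<bar>s\<bar> < d/2" "\<bar>t\<bar> < d/2" for g s t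
    using has_dir_deriv_shift[OF that(1), of "\<lambda>i. z i + of_real s * u i" t v] PW[OF that(2,3)] v
    unfolding P_def by (simp add: algebra_simps)
  have cont: "isCont (\<lambda>p. h (g (P (fst p) (snd p)))) (0, 0)"
    if "Ck_on n 0 W g" "bounded_linear h" for g and h :: "complex \<Rightarrow> real"
  proof -
    have "((\<lambda>p. g (P (fst p) (snd p))) \<longlongrightarrow> g z) (nhds (0, 0))"
      using that(1) z ev by (intro continuous_on_tendsto_compose[OF _ limP]) simp_all
    then have "((\<lambda>p. h (g (P (fst p) (snd p)))) \<longlongrightarrow> h (g z)) (nhds (0, 0))"
      by (rule bounded_linear.tendsto[OF that(2)])
    then have "((\<lambda>p. h (g (P (fst p) (snd p)))) \<longlongrightarrow> h (g z)) (at (0, 0))"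
      by (rule tendsto_mono[rotated]) (simp add: at_within_def)
    then show ?thesis by (simp add: isCont_def P0)
  qed
  have "h (dir_deriv v (dir_deriv u f) z) = h (dir_deriv u (dir_deriv v f) z)"
    if h: "bounded_linear h" for h :: "complex \<Rightarrow> real"
  proof -
    note hd = bounded_linear.has_vector_derivative[OF h]
    have "h (dir_deriv v (dir_deriv u f) (P 0 0)) = h (dir_deriv u (dir_deriv v f) (P 0 0))"
    proof (rule mixed_partials_eq[where e = "d / 2" and G = "\<lambda>s t. h (f (P s t))"
          and A = "\<lambda>s t. h (dir_deriv u f (P s t))" and B = "\<lambda>s t. h (dir_deriv v f (P s t))"
          and C = "\<lambda>s t. h (dir_deriv v (dir_deriv u f) (P s t))"
          and D = "\<lambda>s t. h (dir_deriv u (dir_deriv v f) (P s t))"])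
      show "d / 2 > 0" using d by simp
      show "((\<lambda>s. h (f (P s t))) has_real_derivative h (dir_deriv u f (P s t))) (at s)"
        if "\<bar>s\<bar> < d / 2" "\<bar>t\<bar> < d / 2" for s t
        using hd[OF ds[OF Ck(1)[OF u u] that]] by (simp add: has_real_derivative_iff_has_vector_derivative)
      show "((\<lambda>t. h (f (P s t))) has_real_derivative h (dir_deriv v f (P s t))) (at t)"
        if "\<bar>s\<bar> < d / 2" "\<bar>t\<bar> < d / 2" for s t
        using hd[OF dt[OF Ck(1)[OF u u] that]] by (simp add: has_real_derivative_iff_has_vector_derivative)
      show "((\<lambda>t. h (dir_deriv u f (P s t))) has_real_derivative h (dir_deriv v (dir_deriv u f) (P s t))) (at t)"
        if "\<bar>s\<bar> < d / 2" "\<bar>t\<bar> < d / 2" for s t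
        using hd[OF dt[OF Ck(2)[OF u u] that]] by (simp add: has_real_derivative_iff_has_vector_derivative)
      show "((\<lambda>s. h (dir_deriv v f (P s t))) has_real_derivative h (dir_deriv u (dir_deriv v f) (P s t))) (at s)"
        if "\<bar>s\<bar> < d / 2" "\<bar>t\<bar> < d / 2" for s t
        using hd[OF ds[OF Ck(2)[OF v v] that]] by (simp add: has_real_derivative_iff_has_vector_derivative)
      show "isCont (\<lambda>p. h (dir_deriv v (dir_deriv u f) (P (fst p) (snd p)))) (0, 0)"
        by (rule cont[OF Ck(3)[OF u v] h])
      show "isCont (\<lambda>p. h (dir_deriv u (dir_deriv v f) (P (fst p) (snd p)))) (0, 0)"
        by (rule cont[OF Ck(3)[OF v u] h])
    qed
    then show ?thesis by (simp add: P0)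
  qed
  from this[OF bounded_linear_Re] this[OF bounded_linear_Im] show ?thesis
    by (simp add: complex_eq_iff)
qed

lemma dir_deriv_wirtinger:
  assumes f: "smooth_on n W f" and z: "z \<in> W" and u: "u \<in> cspace n" and v: "v \<in> cspace n"
  shows "dir_deriv u (dz_deriv v f) z = (dir_deriv u (dir_deriv v f) z - \<i> * dir_deriv u (dir_deriv (\<lambda>j. \<i> * v j) f) z) / 2"
    and "dir_deriv u (dzbar_deriv v f) z = (dir_deriv u (dir_deriv v f) z + \<i> * dir_deriv u (dir_deriv (\<lambda>j. \<i> * v j) f) z) / 2"
proof -
  note sm = smooth_on_dir_deriv[OF f v] smooth_on_dir_deriv[OF f cspace_scale[OF v], of \<i>]
  have "dz_deriv v f = (\<lambda>z. 1/2 * dir_deriv v f z + (-\<i>/2) * dir_deriv (\<lambda>j. \<i> * v j) f z)"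
    by (rule ext) (simp add: dz_deriv_def field_simps)
  then show "dir_deriv u (dz_deriv v f) z = (dir_deriv u (dir_deriv v f) z - \<i> * dir_deriv u (dir_deriv (\<lambda>j. \<i> * v j) f) z) / 2"
    using smooth_dir_deriv_add[OF smooth_on_cmult[OF sm(1)] smooth_on_cmult[OF sm(2)] z u, of "1/2" "-\<i>/2"]
      dir_deriv_cmult[OF sm(1) z u, of "1/2"] dir_deriv_cmult[OF sm(2) z u, of "-\<i>/2"] by (simp add: field_simps)
  have "dzbar_deriv v f = (\<lambda>z. 1/2 * dir_deriv v f z + (\<i>/2) * dir_deriv (\<lambda>j. \<i> * v j) f z)"
    by (rule ext) (simp add: dzbar_deriv_def field_simps)
  then show "dir_deriv u (dzbar_deriv v f) z = (dir_deriv u (dir_deriv v f) z + \<i> * dir_deriv u (dir_deriv (\<lambda>j. \<i> * v j) f) z) / 2"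
    using smooth_dir_deriv_add[OF smooth_on_cmult[OF sm(1)] smooth_on_cmult[OF sm(2)] z u, of "1/2" "\<i>/2"]
      dir_deriv_cmult[OF sm(1) z u, of "1/2"] dir_deriv_cmult[OF sm(2) z u, of "\<i>/2"] by (simp add: field_simps)
qed

lemma dz_deriv_commute:
  assumes f: "smooth_on n W f" and z: "z \<in> W" and u: "u \<in> cspace n" and v: "v \<in> cspace n"
  shows "dz_deriv u (dz_deriv v f) z = dz_deriv v (dz_deriv u f) z"
    and "dz_deriv u (dzbar_deriv v f) z = dzbar_deriv v (dz_deriv u f) z"
proof -
  note iu = cspace_scale[OF u, of \<i>] and iv = cspace_scale[OF v, of \<i>]
  note rules = dir_deriv_wirtinger[OF f z u v] dir_deriv_wirtinger[OF f z iu v]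
    dir_deriv_wirtinger[OF f z v u] dir_deriv_wirtinger[OF f z iv u]
    dir_deriv_commute[OF f z v u] dir_deriv_commute[OF f z v iu]
    dir_deriv_commute[OF f z iv u] dir_deriv_commute[OF f z iv iu]
  show "dz_deriv u (dz_deriv v f) z = dz_deriv v (dz_deriv u f) z"
    by (simp add: dz_deriv_def[of u "dz_deriv v f"] dz_deriv_def[of v "dz_deriv u f"] rules field_simps)
  show "dz_deriv u (dzbar_deriv v f) z = dzbar_deriv v (dz_deriv u f) z"
    by (simp add: dz_deriv_def[of u "dzbar_deriv v f"] dzbar_deriv_def[of v "dz_deriv u f"] rules field_simps)
qed

end

section \<open>Alternating multilinear maps\<close>

lemma length_omit [simp]: "k < length vs \<Longrightarrow> length (omit k vs) = length vs - 1"
  by (simp add: omit_def)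

lemma nth_omit: "k < length vs \<Longrightarrow> a < length vs - 1 \<Longrightarrow> omit k vs ! a = vs ! (if a < k then a else Suc a)"
  by (auto simp: omit_def nth_append min_def)

lemma map_omit: "map f (omit k vs) = omit k (map f vs)"
  by (simp add: omit_def take_map drop_map)

lemma set_omit_subset: "set (omit k vs) \<subseteq> set vs"
  unfolding omit_def using set_take_subset set_drop_subset by fastforce

lemma omit_vecs: "vs \<in> vecs n (Suc m) \<Longrightarrow> k \<le> m \<Longrightarrow> omit k vs \<in> vecs n m"
  using set_omit_subset[of k vs] by (auto simp: vecs_def)

lemma omit_list_update_same: "k < length vs \<Longrightarrow> omit k (vs[k := x]) = omit k vs"
  by (rule nth_equalityI) (auto simp: nth_omit nth_list_update)

lemma omit_list_update_neq:
  assumes "k < length vs" "i < length vs" "i \<noteq> k"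
  shows "omit k (vs[i := x]) = (omit k vs)[(if i < k then i else i - 1) := x]"
  using assms by (intro nth_equalityI) (auto simp: nth_omit nth_list_update)

lemma omit_omit: "i \<le> k \<Longrightarrow> Suc k < length vs \<Longrightarrow> omit k (omit i vs) = omit i (omit (Suc k) vs)"
  by (rule nth_equalityI) (auto simp: nth_omit)

lemma not_distinct_omit:
  assumes "i < j" "j < length vs" "vs ! i = vs ! j" "k < length vs" "k \<noteq> i" "k \<noteq> j"
  shows "\<not> distinct (omit k vs)"
proof -
  define a where "a = (if i < k then i else i - 1)"
  define b where "b = (if j < k then j else j - 1)"
  have "a < b" "b < length (omit k vs)" "omit k vs ! a = omit k vs ! b"
    using assms by (auto simp: a_def b_def nth_omit)
  then show ?thesis
    by (metis nat_neq_iff nth_eq_iff_index_eq order_less_trans)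
qed

lemma vecs_update: "vs \<in> vecs n m \<Longrightarrow> x \<in> cspace n \<Longrightarrow> vs[i := x] \<in> vecs n m"
  using set_update_subset_insert[of vs i x] by (auto simp: vecs_def)

lemma vecs_nth: "vs \<in> vecs n m \<Longrightarrow> i < m \<Longrightarrow> vs ! i \<in> cspace n"
  by (auto simp: vecs_def)

lemma zero_cspace: "(\<lambda>j. 0) \<in> cspace n"
  by (simp add: cspace_def)

lemma alternating_multilinear_scale:
  assumes F: "alternating_multilinear n m \<sigma> F" and \<sigma>: "\<sigma> 1 = 1"
    and vs: "vs \<in> vecs n m" "i < m" and x: "x \<in> cspace n"
  shows "F (vs[i := (\<lambda>j. c * x j)]) = \<sigma> c * F (vs[i := x])"
proof -
  have lin: "F (vs[i := (\<lambda>j. a j + c * b j)]) = F (vs[i := a]) + \<sigma> c * F (vs[i := b])"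
    if "a \<in> cspace n" "b \<in> cspace n" for a b c
    using F vs that unfolding alternating_multilinear_def by blast
  have "F (vs[i := (\<lambda>j. 0)]) = 0"
    using lin[OF zero_cspace zero_cspace, of 1] \<sigma> by simp
  then show ?thesis using lin[OF zero_cspace x, of c] by simp
qed

lemma alternating_multilinear_swap:
  assumes F: "alternating_multilinear n m \<sigma> F" and \<sigma>: "\<sigma> 1 = 1"
    and vs: "xs @ a # b # ys \<in> vecs n m"
  shows "F (xs @ a # b # ys) = - F (xs @ b # a # ys)"
proof -
  define G where "G = (\<lambda>a b. F (xs @ a # b # ys))"
  have len: "length xs + 2 + length ys = m" and a: "a \<in> cspace n" and b: "b \<in> cspace n"
    using vs by (auto simp: vecs_def)
  have in_vecs: "xs @ c # d # ys \<in> vecs n m" if "c \<in> cspace n" "d \<in> cspace n" for c d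
    using vs that by (auto simp: vecs_def)
  have lin: "F (us[i := (\<lambda>j. c j + 1 * d j)]) = F (us[i := c]) + \<sigma> 1 * F (us[i := d])"
    if "us \<in> vecs n m" "i < m" "c \<in> cspace n" "d \<in> cspace n" for us i c d
    using F that unfolding alternating_multilinear_def by blast
  have alt: "G c c = 0" if "c \<in> cspace n" for c
    using F in_vecs[OF that that] unfolding alternating_multilinear_def G_def by auto
  have G1: "G (\<lambda>j. c j + d j) e = G c e + G d e"
    if "c \<in> cspace n" "d \<in> cspace n" "e \<in> cspace n" for c d e
    using lin[OF in_vecs[OF that(1,3)] _ that(1,2), of "length xs"] len \<sigma> by (simp add: G_def)
  have G2: "G e (\<lambda>j. c j + d j) = G e c + G e d"
    if "c \<in> cspace n" "d \<in> cspace n" "e \<in> cspace n" for c d e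
    using lin[OF in_vecs[OF that(3,1)] _ that(1,2), of "Suc (length xs)"] len \<sigma>
    by (simp add: G_def list_update_append)
  have ab: "(\<lambda>j. a j + b j) \<in> cspace n" using cspace_linear[OF a b, of 1] by simp
  have "0 = G (\<lambda>j. a j + b j) (\<lambda>j. a j + b j)" using alt[OF ab] by simp
  also have "\<dots> = G a b + G b a"
    by (simp add: G1[OF a b ab] G2[OF a b a] G2[OF a b b] alt[OF a] alt[OF b])
  finally show ?thesis unfolding G_def by (simp add: eq_neg_iff_add_eq_0)
qed

lemma alternating_multilinear_move:
  assumes F: "alternating_multilinear n m \<sigma> F" and \<sigma>: "\<sigma> 1 = 1"
  shows "xs @ a # ys @ zs \<in> vecs n m \<Longrightarrow> F (xs @ a # ys @ zs) = (-1) ^ length ys * F (xs @ ys @ a # zs)"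
proof (induction ys arbitrary: xs)
  case (Cons y ys)
  have "F (xs @ a # (y # ys) @ zs) = - F ((xs @ [y]) @ a # ys @ zs)"
    using alternating_multilinear_swap[OF F \<sigma>, of xs a y "ys @ zs"] Cons.prems by simp
  also have "\<dots> = - ((-1) ^ length ys * F ((xs @ [y]) @ ys @ a # zs))"
    using Cons.prems by (subst Cons.IH) (auto simp: vecs_def)
  finally show ?case by simp
qed simp

lemma alternating_multilinear_omit:
  assumes F: "alternating_multilinear n m \<sigma> F" and \<sigma>: "\<sigma> 1 = 1"
    and vs: "vs \<in> vecs n (Suc m)" and x: "x \<in> cspace n" and ik: "i \<le> k" "k < m"
  shows "F ((omit i vs)[k := x]) = (-1) ^ (k - i) * F ((omit (Suc k) vs)[i := x])"
proof -
  define A B C where "A = take i vs" and "B = take (k - i) (drop (Suc i) vs)"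
    and "C = drop (Suc (Suc k)) vs"
  have len: "length vs = Suc m" using vs by (simp add: vecs_def)
  have lA: "length A = i" and lB: "length B = k - i" using len ik by (auto simp: A_def B_def)
  have "drop (Suc i) vs = B @ drop (Suc k) vs"
    unfolding B_def using append_take_drop_id[of "k - i" "drop (Suc i) vs"] ik by simp
  also have "drop (Suc k) vs = vs ! Suc k # C"
    unfolding C_def using len ik by (intro Cons_nth_drop_Suc[symmetric]) simp
  finally have drop_i: "drop (Suc i) vs = B @ vs ! Suc k # C" .
  have vs_eq: "vs = A @ vs ! i # B @ vs ! Suc k # C"
    unfolding A_def drop_i[symmetric] using len ik by (intro id_take_nth_drop) simp
  have o1: "(omit i vs)[k := x] = A @ B @ x # C"
    unfolding omit_def drop_i A_def[symmetric] using lA lB ik by (simp add: list_update_append)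
  have "take (Suc k) vs = A @ vs ! i # B"
    by (subst vs_eq) (use lA lB ik in \<open>simp add: Suc_diff_le\<close>)
  then have o2: "(omit (Suc k) vs)[i := x] = A @ x # B @ C"
    unfolding omit_def C_def[symmetric] using lA by (simp add: list_update_append)
  have "A @ x # B @ C \<in> vecs n m"
    using vecs_update[OF omit_vecs[OF vs] x, of "Suc k" i] ik o2 by simp
  from alternating_multilinear_move[OF F \<sigma> this] have
    "F (A @ x # B @ C) = (-1) ^ (k - i) * F (A @ B @ x # C)" by (simp add: lB)
  then show ?thesis unfolding o1 o2 by (simp add: power_mult_distrib[symmetric] flip: mult.assoc)
qed

lemma double_sum_cancel:
  fixes t :: "nat \<Rightarrow> nat \<Rightarrow> complex"
  assumes "\<And>i k. i \<le> k \<Longrightarrow> k < p \<Longrightarrow> t i k = - t (Suc k) i"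
  shows "(\<Sum>i<Suc p. \<Sum>k<p. t i k) = 0"
proof -
  define S where "S = {x \<in> {..<Suc p} \<times> {..<p}. fst x \<le> snd x}"
  define T where "T = {x \<in> {..<Suc p} \<times> {..<p}. snd x < fst x}"
  have "(\<Sum>i<Suc p. \<Sum>k<p. t i k) = (\<Sum>x\<in>{..<Suc p} \<times> {..<p}. t (fst x) (snd x))"
    by (simp add: sum.cartesian_product case_prod_unfold del: sum.lessThan_Suc)
  also have "{..<Suc p} \<times> {..<p} = S \<union> T" by (auto simp: S_def T_def)
  also have "(\<Sum>x\<in>S \<union> T. t (fst x) (snd x)) = (\<Sum>x\<in>S. t (fst x) (snd x)) + (\<Sum>x\<in>T. t (fst x) (snd x))"
    by (rule sum.union_disjoint) (auto simp: S_def T_def)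
  also have "(\<Sum>x\<in>T. t (fst x) (snd x)) = (\<Sum>x\<in>S. t (Suc (snd x)) (fst x))"
    by (rule sum.reindex_bij_witness[of _ "\<lambda>x. (Suc (snd x), fst x)" "\<lambda>x. (snd x, fst x - 1)"])
       (auto simp: S_def T_def)
  also have "(\<Sum>x\<in>S. t (fst x) (snd x)) = (\<Sum>x\<in>S. - t (Suc (snd x)) (fst x))"
    by (rule sum.cong[OF refl]) (use assms in \<open>auto simp: S_def\<close>)
  finally show ?thesis by (simp add: sum_negf)
qed

context cdomain
begin

lemma smooth_on_Ck: "smooth_on n W f \<Longrightarrow> Ck_on n k W f"
  by (simp add: smooth_on_def)

text \<open>
  By induction on the number \<open>k\<close> of slots that move: the last moving slot is expanded in the real
  basis of \<open>\<complex>\<^sup>n\<close>, so that only scalar factors are differentiated there.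
\<close>

lemma multilinear_curve_partial:
  fixes F :: "cvec \<Rightarrow> cvec list \<Rightarrow> complex" and X :: "nat \<Rightarrow> real \<Rightarrow> cvec"
  assumes lin: "\<And>w us i a b r. w \<in> W \<Longrightarrow> us \<in> vecs n m \<Longrightarrow> i < m \<Longrightarrow> a \<in> cspace n \<Longrightarrow> b \<in> cspace n \<Longrightarrow>
      F w (us[i := (\<lambda>j. a j + of_real r * b j)]) = F w (us[i := a]) + of_real r * F w (us[i := b])"
    and smooth: "\<And>us. us \<in> vecs n m \<Longrightarrow> smooth_on n W (\<lambda>w. F w us)"
    and z: "z \<in> W" and y: "y 0 = z" "eventually (\<lambda>t. y t \<in> W) (nhds 0)"
      "\<And>i. ((\<lambda>t. y t i) has_vector_derivative y' i) (at 0)" "y' \<in> cspace n"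
    and X: "\<And>j. j < m \<Longrightarrow> eventually (\<lambda>t. X j t \<in> cspace n) (nhds 0)"
      "\<And>j i. j < m \<Longrightarrow> ((\<lambda>t. X j t i) has_vector_derivative X' j i) (at 0)"
      "\<And>j. j < m \<Longrightarrow> X' j \<in> cspace n"
    and k: "k \<le> m"
  shows "((\<lambda>t. F (y t) (map (\<lambda>j. X j (if j < k then t else 0)) [0..<m])) has_vector_derivative
     dir_deriv y' (\<lambda>w. F w (map (\<lambda>j. X j 0) [0..<m])) z
     + (\<Sum>j<k. F z ((map (\<lambda>j. X j 0) [0..<m])[j := X' j]))) (at 0)"
  using X k
proof (induction k arbitrary: X X')
  case 0
  have x0: "map (\<lambda>j. X j 0) [0..<m] \<in> vecs n m"
    using eventually_nhds_x_imp_x[OF 0(1)] by (auto simp: vecs_def)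
  have "eventually (\<lambda>t. y t \<in> cspace n) (nhds 0)"
    using y(2) by eventually_elim (rule W_cspace)
  then show ?case
    using chain_rule_curve[OF smooth_on_Ck[OF smooth[OF x0]] z y(1) _ y(3,4)] by simp
next
  case (Suc k)
  note X = Suc.prems(1-3)
  have km: "k < m" using Suc.prems by simp
  define xs where "xs = (\<lambda>t. map (\<lambda>j. X j (if j < k then t else 0)) [0..<m])"
  define x0 where "x0 = map (\<lambda>j. X j 0) [0..<m]"
  define L where "L = (\<lambda>b. dir_deriv y' (\<lambda>w. F w (x0[k := b])) z + (\<Sum>j<k. F z (x0[k := b, j := X' j])))"
  have X0: "X j 0 \<in> cspace n" if "j < m" for j
    using X(1)[OF that] by (rule eventually_nhds_x_imp_x)
  have x0: "x0 \<in> vecs n m" using X0 by (auto simp: x0_def vecs_def)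
  have len: "length (xs t) = m" for t by (simp add: xs_def)
  have deriv_b: "((\<lambda>t. F (y t) ((xs t)[k := b])) has_vector_derivative L b) (at 0)"
    if b: "b \<in> cspace n" for b
  proof -
    define Y where "Y = X(k := \<lambda>t. b)"
    define Y' where "Y' = X'(k := \<lambda>i. 0)"
    have "((\<lambda>t. F (y t) (map (\<lambda>j. Y j (if j < k then t else 0)) [0..<m])) has_vector_derivative
     dir_deriv y' (\<lambda>w. F w (map (\<lambda>j. Y j 0) [0..<m])) z
     + (\<Sum>j<k. F z ((map (\<lambda>j. Y j 0) [0..<m])[j := Y' j]))) (at 0)"
    proof (rule Suc.IH)
      show "eventually (\<lambda>t. Y j t \<in> cspace n) (nhds 0)" if "j < m" for j
        using X(1)[OF that] b by (auto simp: Y_def)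
      show "((\<lambda>t. Y j t i) has_vector_derivative Y' j i) (at 0)" if "j < m" for j i
        using X(2)[OF that] by (auto simp: Y_def Y'_def)
      show "Y' j \<in> cspace n" if "j < m" for j
        using X(3)[OF that] zero_cspace by (auto simp: Y'_def)
    qed (use km in simp)
    moreover have "map (\<lambda>j. Y j (if j < k then t else 0)) [0..<m] = (xs t)[k := b]" for t
      by (rule nth_equalityI) (auto simp: Y_def xs_def nth_list_update)
    moreover have "map (\<lambda>j. Y j 0) [0..<m] = x0[k := b]"
      by (rule nth_equalityI) (auto simp: Y_def x0_def nth_list_update)
    ultimately show ?thesis by (simp add: L_def Y'_def)
  qed
  have Fexp: "F w (us[k := x]) = (\<Sum>i<n. of_real (Re (x i)) * F w (us[k := re_unit i])
      + of_real (Im (x i)) * F w (us[k := im_unit i]))"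
    if "w \<in> W" "us \<in> vecs n m" "x \<in> cspace n" for w us x
    by (rule real_linear_expansion[where L = "\<lambda>x. F w (us[k := x])" and n = n])
       (use lin that km in auto)
  have Lexp: "L x = (\<Sum>i<n. of_real (Re (x i)) * L (re_unit i) + of_real (Im (x i)) * L (im_unit i))"
    if "x \<in> cspace n" for x
  proof (rule real_linear_expansion[where n = n])
    fix a b r assume ab: "a \<in> cspace n" "b \<in> cspace n"
    note sa = smooth[OF vecs_update[OF x0 ab(1)], of k] and sb = smooth[OF vecs_update[OF x0 ab(2)], of k]
    have "dir_deriv y' (\<lambda>w. F w (x0[k := (\<lambda>j. a j + complex_of_real r * b j)])) z
       = dir_deriv y' (\<lambda>w. F w (x0[k := a]) + of_real r * F w (x0[k := b])) z"
      by (rule dir_deriv_cong) (use lin[OF _ x0 km ab] z y(4) in auto)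
    also have "\<dots> = dir_deriv y' (\<lambda>w. F w (x0[k := a])) z + of_real r * dir_deriv y' (\<lambda>w. F w (x0[k := b])) z"
      using smooth_dir_deriv_add[OF sa smooth_on_cmult[OF sb] z y(4)] dir_deriv_cmult[OF sb z y(4)] by simp
    finally have 1: "dir_deriv y' (\<lambda>w. F w (x0[k := (\<lambda>j. a j + complex_of_real r * b j)])) z = \<dots>" .
    have "F z (x0[k := (\<lambda>j. a j + complex_of_real r * b j), j := X' j])
        = F z (x0[k := a, j := X' j]) + of_real r * F z (x0[k := b, j := X' j])" if "j < k" for j
      using lin[OF z vecs_update[OF x0 X(3)] km ab, of j j r] that km by (simp add: list_update_swap[of k j])
    then show "L (\<lambda>j. a j + complex_of_real r * b j) = L a + of_real r * L b"
      unfolding L_def 1 by (simp add: sum.distrib sum_distrib_left algebra_simps)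
  qed (rule that)
  define E where "E = (\<lambda>t. \<Sum>i<n. of_real (Re (X k t i)) * F (y t) ((xs t)[k := re_unit i])
      + of_real (Im (X k t i)) * F (y t) ((xs t)[k := im_unit i]))"
  have xs0: "xs 0 = x0" by (simp add: xs_def x0_def)
  have dRe: "((\<lambda>t. complex_of_real (Re (X k t i))) has_vector_derivative of_real (Re (X' k i))) (at 0)" for i
    using bounded_linear.has_vector_derivative[OF bounded_linear_compose[OF bounded_linear_of_real bounded_linear_Re] X(2)[OF km]] .
  have dIm: "((\<lambda>t. complex_of_real (Im (X k t i))) has_vector_derivative of_real (Im (X' k i))) (at 0)" for i
    using bounded_linear.has_vector_derivative[OF bounded_linear_compose[OF bounded_linear_of_real bounded_linear_Im] X(2)[OF km]] .
  have "(E has_vector_derivative (\<Sum>i<n.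
       (of_real (Re (X k 0 i)) * L (re_unit i) + of_real (Re (X' k i)) * F (y 0) ((xs 0)[k := re_unit i]))
     + (of_real (Im (X k 0 i)) * L (im_unit i) + of_real (Im (X' k i)) * F (y 0) ((xs 0)[k := im_unit i])))) (at 0)"
    unfolding E_def
    by (intro has_vector_derivative_sum has_vector_derivative_add has_vector_derivative_mult dRe dIm deriv_b
        re_unit_cspace im_unit_cspace) auto
  also have "(\<Sum>i<n.
       (of_real (Re (X k 0 i)) * L (re_unit i) + of_real (Re (X' k i)) * F (y 0) ((xs 0)[k := re_unit i]))
     + (of_real (Im (X k 0 i)) * L (im_unit i) + of_real (Im (X' k i)) * F (y 0) ((xs 0)[k := im_unit i])))
     = L (X k 0) + F z (x0[k := X' k])"
    unfolding Lexp[OF X0[OF km]] Fexp[OF z x0 X(3)[OF km]] xs0 y(1)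
    by (simp add: sum.distrib algebra_simps)
  also have "L (X k 0) + F z (x0[k := X' k]) = dir_deriv y' (\<lambda>w. F w x0) z + (\<Sum>j<Suc k. F z (x0[j := X' j]))"
  proof -
    have "x0[k := X k 0] = x0" using km by (intro nth_equalityI) (auto simp: x0_def nth_list_update)
    then show ?thesis by (simp add: L_def)
  qed
  finally have E: "(E has_vector_derivative dir_deriv y' (\<lambda>w. F w x0) z + (\<Sum>j<Suc k. F z (x0[j := X' j]))) (at 0)" .
  have evX: "eventually (\<lambda>t. \<forall>j\<in>{..<m}. X j t \<in> cspace n) (nhds 0)"
    using X(1) by (intro eventually_ball_finite) auto
  have ev: "eventually (\<lambda>t. F (y t) (map (\<lambda>j. X j (if j < Suc k then t else 0)) [0..<m]) = E t) (nhds 0)"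
    using y(2) evX
  proof eventually_elim
    case (elim t)
    have "map (\<lambda>j. X j (if j < Suc k then t else 0)) [0..<m] = (xs t)[k := X k t]"
      by (rule nth_equalityI) (auto simp: xs_def nth_list_update less_Suc_eq)
    moreover have "xs t \<in> vecs n m" using elim X0 by (auto simp: xs_def vecs_def)
    ultimately show ?case
      unfolding E_def using Fexp[OF elim(1), of "xs t" "X k t"] elim km by simp
  qed
  show ?case
    using E eventually_nhds_x_imp_x[OF ev] ev unfolding x0_def[symmetric]
    by (subst has_vector_derivative_cong_ev[where g = E]) (auto elim: eventually_mono)
qed

end

section \<open>The operators on forms\<close>

context complex_manifold
begin

lemma chart_cdomain: "(U, \<phi>) \<in> A \<Longrightarrow> cdomain n (\<phi> ` U)"
  using chart_range by (simp add: cdomain_def)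

lemma chart_inj:
  assumes "(U, \<phi>) \<in> A"
  shows "inj_on \<phi> U"
proof -
  have "topspace (subtopology X U) = U"
    using chart_domain[OF assms] openin_subset by fastforce
  then show ?thesis
    using chart_homeo[OF assms] homeomorphic_imp_injective_map by metis
qed

lemma overlap_cdomain:
  assumes U: "(U, \<phi>) \<in> A" and V: "(V, \<psi>) \<in> A"
  shows "cdomain n (\<phi> ` (U \<inter> V))"
proof -
  have "openin (subtopology X U) (U \<inter> V)"
    using chart_domain[OF V] by (auto simp: openin_subtopology)
  moreover have "open_map (subtopology X U) (top_of_set (\<phi> ` U)) \<phi>"
    using chart_homeo[OF U] by (rule homeomorphic_imp_open_map)
  ultimately have "openin (top_of_set (\<phi> ` U)) (\<phi> ` (U \<inter> V))"
    by (auto simp: open_map_def)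
  then show ?thesis
    unfolding cdomain_def using chart_range[OF U] openin_trans by blast
qed

lemma transition_apply:
  assumes "(U, \<phi>) \<in> A" "x \<in> U"
  shows "transition (U, \<phi>) (V, \<psi>) (\<phi> x) = \<psi> x"
  using chart_inj[OF assms(1)] assms(2) by (simp add: transition_def)

lemma transition_in_overlap:
  assumes "(U, \<phi>) \<in> A" "z \<in> \<phi> ` (U \<inter> V)"
  shows "transition (U, \<phi>) (V, \<psi>) z \<in> \<psi> ` (U \<inter> V)"
  using assms transition_apply[OF assms(1)] by auto

end

lemma is_form_alternating:
  assumes "is_form n A p q \<omega>" "(U, \<phi>) \<in> A" "z \<in> \<phi> ` U"
  shows "ws \<in> vecs n q \<Longrightarrow> alternating_multilinear n p (\<lambda>c. c) (\<lambda>vs. \<omega> (U, \<phi>) z vs ws)"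
    and "vs \<in> vecs n p \<Longrightarrow> alternating_multilinear n q cnj (\<lambda>ws. \<omega> (U, \<phi>) z vs ws)"
proof -
  note form = assms(1)[unfolded is_form_def]
  note alt = bspec[OF conjunct1[OF form] assms(2), unfolded prod.case, THEN bspec, OF assms(3)]
  show "ws \<in> vecs n q \<Longrightarrow> alternating_multilinear n p (\<lambda>c. c) (\<lambda>vs. \<omega> (U, \<phi>) z vs ws)"
    by (rule bspec[OF conjunct1[OF alt]])
  show "vs \<in> vecs n p \<Longrightarrow> alternating_multilinear n q cnj (\<lambda>ws. \<omega> (U, \<phi>) z vs ws)"
    by (rule bspec[OF conjunct2[OF alt]])
qed

lemma is_form_smooth:
  assumes "is_form n A p q \<omega>" "(U, \<phi>) \<in> A" "vs \<in> vecs n p" "ws \<in> vecs n q"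
  shows "smooth_on n (\<phi> ` U) (\<lambda>z. \<omega> (U, \<phi>) z vs ws)"
proof -
  note form = assms(1)[unfolded is_form_def]
  note sm = bspec[OF conjunct1[OF conjunct2[OF form]] assms(2), unfolded prod.case]
  show ?thesis by (rule bspec[OF bspec[OF sm assms(3)] assms(4)])
qed

lemma is_form_transition:
  assumes "is_form n A p q \<omega>" "(U, \<phi>) \<in> A" "(V, \<psi>) \<in> A" "z \<in> \<phi> ` (U \<inter> V)"
    "vs \<in> vecs n p" "ws \<in> vecs n q"
  shows "\<omega> (U, \<phi>) z vs ws = \<omega> (V, \<psi>) (transition (U, \<phi>) (V, \<psi>) z)
    (map (differential (transition (U, \<phi>) (V, \<psi>)) z) vs) (map (differential (transition (U, \<phi>) (V, \<psi>)) z) ws)"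
proof -
  note form = assms(1)[unfolded is_form_def Let_def]
  note 1 = bspec[OF conjunct1[OF conjunct2[OF conjunct2[OF form]]] assms(2), unfolded prod.case]
  note 2 = bspec[OF 1 assms(3), unfolded prod.case]
  show ?thesis by (rule bspec[OF bspec[OF bspec[OF 2 assms(4)] assms(5)] assms(6)])
qed

lemma is_form_outside:
  assumes "is_form n A p q \<omega>" "\<not> ((U, \<phi>) \<in> A \<and> z \<in> \<phi> ` U \<and> vs \<in> vecs n p \<and> ws \<in> vecs n q)"
  shows "\<omega> (U, \<phi>) z vs ws = 0"
proof -
  note form = assms(1)[unfolded is_form_def]
  note out = conjunct2[OF conjunct2[OF conjunct2[OF form]]]
  show ?thesis using out assms(2) by simp
qed

lemma alternating_multilinear_linear:
  assumes "alternating_multilinear n m \<sigma> F" "vs \<in> vecs n m" "i < m" "a \<in> cspace n" "b \<in> cspace n"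
  shows "F (vs[i := (\<lambda>j. a j + c * b j)]) = F (vs[i := a]) + \<sigma> c * F (vs[i := b])"
  using assms unfolding alternating_multilinear_def by blast

lemma alternating_multilinear_not_distinct:
  assumes "alternating_multilinear n m \<sigma> F" "vs \<in> vecs n m" "\<not> distinct vs"
  shows "F vs = 0"
  using assms unfolding alternating_multilinear_def by blast

lemma del_apply:
  assumes "(U, \<phi>) \<in> A" "z \<in> \<phi> ` U" "vs \<in> vecs n (Suc p)" "ws \<in> vecs n q"
  shows "del n A \<omega> (U, \<phi>) z vs ws =
    (\<Sum>i<Suc p. (-1) ^ i * dz_deriv (vs ! i) (\<lambda>z. \<omega> (U, \<phi>) z (omit i vs) ws) z)"
  using assms by (simp add: del_def vecs_def)

lemma delbar_apply:
  assumes "(U, \<phi>) \<in> A" "z \<in> \<phi> ` U" "vs \<in> vecs n p" "ws \<in> vecs n (Suc q)"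
  shows "delbar n A \<omega> (U, \<phi>) z vs ws = (-1) ^ p *
    (\<Sum>j<Suc q. (-1) ^ j * dzbar_deriv (ws ! j) (\<lambda>z. \<omega> (U, \<phi>) z vs (omit j ws)) z)"
  using assms by (simp add: delbar_def vecs_def)

locale holomorphic_change = cdomain +
  fixes \<tau> :: "cvec \<Rightarrow> cvec"
  assumes smooth_\<tau>: "smooth_on n W (\<lambda>z. \<tau> z i)"
    and holomorphic_\<tau>: "z \<in> W \<Longrightarrow> v \<in> cspace n \<Longrightarrow> dzbar_deriv v (\<lambda>z. \<tau> z i) z = 0"
    and \<tau>_cspace: "z \<in> W \<Longrightarrow> \<tau> z \<in> cspace n"
begin

lemma differential_cspace: "z \<in> W \<Longrightarrow> v \<in> cspace n \<Longrightarrow> differential \<tau> z v \<in> cspace n"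
proof -
  assume z: "z \<in> W" and v: "v \<in> cspace n"
  have "dir_deriv v (\<lambda>z. \<tau> z i) z = dir_deriv v (\<lambda>z. 0) z" if "i \<ge> n" for i
    by (rule dir_deriv_cong) (use \<tau>_cspace z v that in \<open>auto simp: cspace_def\<close>)
  then show ?thesis by (simp add: differential_def cspace_def)
qed

lemma differential_ii:
  assumes "z \<in> W" "v \<in> cspace n"
  shows "differential \<tau> z (\<lambda>j. \<i> * v j) = (\<lambda>j. \<i> * differential \<tau> z v j)"
proof
  fix j
  have "dir_deriv v (\<lambda>z. \<tau> z j) z + \<i> * dir_deriv (\<lambda>j. \<i> * v j) (\<lambda>z. \<tau> z j) z = 0"
    using holomorphic_\<tau>[OF assms, of j] by (simp add: dzbar_deriv_def)
  then have "\<i> * (dir_deriv v (\<lambda>z. \<tau> z j) z + \<i> * dir_deriv (\<lambda>j. \<i> * v j) (\<lambda>z. \<tau> z j) z) = 0"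
    by simp
  then show "differential \<tau> z (\<lambda>j. \<i> * v j) j = \<i> * differential \<tau> z v j"
    by (simp add: differential_def algebra_simps)
qed

definition hessian :: "cvec \<Rightarrow> cvec \<Rightarrow> cvec \<Rightarrow> cvec" where
  "hessian z v u = (\<lambda>i. dir_deriv v (dir_deriv u (\<lambda>z. \<tau> z i)) z)"

lemma hessian_commute:
  "z \<in> W \<Longrightarrow> u \<in> cspace n \<Longrightarrow> v \<in> cspace n \<Longrightarrow> hessian z u v = hessian z v u"
  unfolding hessian_def using dir_deriv_commute[OF smooth_\<tau>] by blast

lemma hessian_cspace:
  assumes z: "z \<in> W" and u: "u \<in> cspace n" and v: "v \<in> cspace n"
  shows "hessian z v u \<in> cspace n"
proof -
  have "dir_deriv v (dir_deriv u (\<lambda>z. \<tau> z i)) z = dir_deriv v (\<lambda>z. 0) z" if "i \<ge> n" for i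
    by (rule dir_deriv_cong)
       (use differential_cspace u z v that in \<open>auto simp: cspace_def differential_def\<close>)
  then show ?thesis by (simp add: hessian_def cspace_def)
qed

lemma hessian_ii:
  assumes z: "z \<in> W" and u: "u \<in> cspace n" and v: "v \<in> cspace n"
  shows "hessian z (\<lambda>j. \<i> * v j) u = (\<lambda>j. \<i> * hessian z v u j)"
proof
  fix j
  have "hessian z (\<lambda>j. \<i> * v j) u j = dir_deriv u (dir_deriv (\<lambda>j. \<i> * v j) (\<lambda>z. \<tau> z j)) z"
    unfolding hessian_def using dir_deriv_commute[OF smooth_\<tau> z cspace_scale[OF v] u] .
  also have "\<dots> = dir_deriv u (\<lambda>z. \<i> * dir_deriv v (\<lambda>z. \<tau> z j) z) z"
    by (rule dir_deriv_cong[OF _ z u]) (use differential_ii[OF _ v] in \<open>auto simp: differential_def fun_eq_iff\<close>)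
  also have "\<dots> = \<i> * dir_deriv u (dir_deriv v (\<lambda>z. \<tau> z j)) z"
    by (rule dir_deriv_cmult[OF smooth_on_dir_deriv[OF smooth_\<tau> v] z u])
  also have "\<dots> = \<i> * hessian z v u j"
    unfolding hessian_def using dir_deriv_commute[OF smooth_\<tau> z u v] by simp
  finally show "hessian z (\<lambda>j. \<i> * v j) u j = \<i> * hessian z v u j" .
qed

text \<open>
  Only the \<open>p\<close> complex-linear slots contribute second derivatives of \<open>\<tau>\<close> to the \<open>dz\<close>-derivative:
  in the conjugate-linear slots they cancel.
\<close>

lemma dz_deriv_pullback:
  fixes G :: "cvec \<Rightarrow> cvec list \<Rightarrow> cvec list \<Rightarrow> complex"
  assumes dom: "cdomain n W'" and \<tau>: "\<And>z. z \<in> W \<Longrightarrow> \<tau> z \<in> W'"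
    and alt1: "\<And>w us. w \<in> W' \<Longrightarrow> us \<in> vecs n q \<Longrightarrow> alternating_multilinear n p (\<lambda>c. c) (\<lambda>vs. G w vs us)"
    and alt2: "\<And>w vs. w \<in> W' \<Longrightarrow> vs \<in> vecs n p \<Longrightarrow> alternating_multilinear n q cnj (\<lambda>us. G w vs us)"
    and smooth: "\<And>vs us. vs \<in> vecs n p \<Longrightarrow> us \<in> vecs n q \<Longrightarrow> smooth_on n W' (\<lambda>w. G w vs us)"
    and z: "z \<in> W" and v: "v \<in> cspace n" and vs: "vs \<in> vecs n p" and us: "us \<in> vecs n q"
  shows "dz_deriv v (\<lambda>z. G (\<tau> z) (map (differential \<tau> z) vs) (map (differential \<tau> z) us)) z =
     dz_deriv (differential \<tau> z v) (\<lambda>w. G w (map (differential \<tau> z) vs) (map (differential \<tau> z) us)) (\<tau> z)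
     + (\<Sum>k<p. G (\<tau> z) ((map (differential \<tau> z) vs)[k := hessian z v (vs ! k)]) (map (differential \<tau> z) us))"
proof -
  interpret T: cdomain n W' by (rule dom)
  define P where "P = (\<lambda>z. G (\<tau> z) (map (differential \<tau> z) vs) (map (differential \<tau> z) us))"
  define dvs where "dvs = map (differential \<tau> z) vs"
  define dus where "dus = map (differential \<tau> z) us"
  have lvs: "length vs = p" and lus: "length us = q" using vs us by (auto simp: vecs_def)
  have dvs: "dvs \<in> vecs n p" using vs differential_cspace[OF z] by (auto simp: dvs_def vecs_def)
  have dus: "dus \<in> vecs n q" using us differential_cspace[OF z] by (auto simp: dus_def vecs_def)
  define F where "F = (\<lambda>w xs. G w (take p xs) (drop p xs))"
  have split_vecs: "take p xs \<in> vecs n p" "drop p xs \<in> vecs n q" if "xs \<in> vecs n (p + q)" for xs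
    using that by (auto simp: vecs_def dest: in_set_takeD in_set_dropD)
  have lin: "F w (xs[i := (\<lambda>j. a j + of_real r * b j)]) = F w (xs[i := a]) + of_real r * F w (xs[i := b])"
    if "w \<in> W'" "xs \<in> vecs n (p + q)" "i < p + q" "a \<in> cspace n" "b \<in> cspace n" for w xs i a b r
  proof (cases "i < p")
    case True
    then show ?thesis
      using alternating_multilinear_linear[OF alt1[OF that(1) split_vecs(2)[OF that(2)]] split_vecs(1)[OF that(2)] True that(4,5), of "of_real r"]
      by (simp add: F_def take_update_swap drop_update_cancel)
  next
    case False
    then have i: "i - p < q" using that(3) by simp
    show ?thesis
      using False alternating_multilinear_linear[OF alt2[OF that(1) split_vecs(1)[OF that(2)]] split_vecs(2)[OF that(2)] i that(4,5), of "of_real r"]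
      by (simp add: F_def drop_update_swap take_update_cancel)
  qed
  have smoothF: "smooth_on n W' (\<lambda>w. F w xs)" if "xs \<in> vecs n (p + q)" for xs
    unfolding F_def using that by (intro smooth split_vecs)
  have P': "dir_deriv v P z = dir_deriv (differential \<tau> z v) (\<lambda>w. G w dvs dus) (\<tau> z)
     + (\<Sum>k<p. G (\<tau> z) (dvs[k := hessian z v (vs ! k)]) dus)
     + (\<Sum>k<q. G (\<tau> z) dvs (dus[k := hessian z v (us ! k)]))"
    if v: "v \<in> cspace n" for v
  proof -
    define l where "l = (\<lambda>t::real. \<lambda>i. z i + of_real t * v i)"
    have l0: "l 0 = z" by (simp add: l_def)
    define S where "S = vs @ us"
    have S: "S \<in> vecs n (p + q)" using vs us by (auto simp: S_def vecs_def)
    define X where "X = (\<lambda>j t. differential \<tau> (l t) (S ! j))"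
    define X' where "X' = (\<lambda>j. hessian z v (S ! j))"
    have ev: "eventually (\<lambda>t. l t \<in> W) (nhds 0)"
      unfolding l_def by (rule eventually_line[OF z v])
    have x0: "map (\<lambda>j. X j 0) [0..<p+q] = dvs @ dus"
      using lvs lus
      by (intro nth_equalityI) (auto simp: X_def S_def l0 dvs_def dus_def nth_append)
    have "((\<lambda>t. F (\<tau> (l t)) (map (\<lambda>j. X j (if j < p + q then t else 0)) [0..<p+q])) has_vector_derivative
     dir_deriv (differential \<tau> z v) (\<lambda>w. F w (map (\<lambda>j. X j 0) [0..<p+q])) (\<tau> z)
     + (\<Sum>j<p+q. F (\<tau> z) ((map (\<lambda>j. X j 0) [0..<p+q])[j := X' j]))) (at 0)"
    proof (rule T.multilinear_curve_partial[OF lin smoothF \<tau>[OF z]])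
      show "\<tau> (l 0) = \<tau> z" by (simp add: l0)
      show "eventually (\<lambda>t. \<tau> (l t) \<in> W') (nhds 0)" using ev by eventually_elim (rule \<tau>)
      show "((\<lambda>t. \<tau> (l t) i) has_vector_derivative differential \<tau> z v i) (at 0)" for i
        using has_dir_deriv[OF smooth_on_Ck[OF smooth_\<tau>] z v, of i] by (simp add: l_def differential_def)
      show "differential \<tau> z v \<in> cspace n" by (rule differential_cspace[OF z v])
      show "eventually (\<lambda>t. X j t \<in> cspace n) (nhds 0)" if "j < p + q" for j
        using ev by eventually_elim (auto simp: X_def intro: differential_cspace vecs_nth[OF S that])
      show "((\<lambda>t. X j t i) has_vector_derivative X' j i) (at 0)" if "j < p + q" for j i
        using has_dir_deriv[OF smooth_on_Ck[OF smooth_on_dir_deriv[OF smooth_\<tau> vecs_nth[OF S that]]] z v, of i]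
        by (simp add: X_def X'_def l_def differential_def hessian_def)
      show "X' j \<in> cspace n" if "j < p + q" for j
        unfolding X'_def by (rule hessian_cspace[OF z vecs_nth[OF S that] v])
    qed auto
    moreover have "F (\<tau> (l t)) (map (\<lambda>j. X j (if j < p + q then t else 0)) [0..<p+q]) = P (l t)" for t
    proof -
      have "map (\<lambda>j. X j (if j < p + q then t else 0)) [0..<p+q] =
          map (differential \<tau> (l t)) vs @ map (differential \<tau> (l t)) us"
        using lvs lus by (intro nth_equalityI) (auto simp: X_def S_def nth_append)
      then show ?thesis using lvs by (simp add: F_def P_def)
    qed
    moreover have "F w (dvs @ dus) = G w dvs dus" for w
      using dvs by (simp add: F_def vecs_def)
    ultimately have "dir_deriv v P z = dir_deriv (differential \<tau> z v) (\<lambda>w. G w dvs dus) (\<tau> z)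
     + (\<Sum>j<p+q. F (\<tau> z) ((dvs @ dus)[j := X' j]))"
      by (intro dir_derivI) (simp add: x0 l_def)
    also have "(\<Sum>j<p+q. F (\<tau> z) ((dvs @ dus)[j := X' j]))
       = (\<Sum>j<p. F (\<tau> z) ((dvs @ dus)[j := X' j])) + (\<Sum>j<q. F (\<tau> z) ((dvs @ dus)[p + j := X' (p + j)]))"
      by (induction q) (simp_all add: add.assoc)
    also have "(\<Sum>j<p. F (\<tau> z) ((dvs @ dus)[j := X' j])) = (\<Sum>k<p. G (\<tau> z) (dvs[k := hessian z v (vs ! k)]) dus)"
      using dvs lvs by (intro sum.cong) (auto simp: F_def vecs_def list_update_append X'_def S_def nth_append)
    also have "(\<Sum>j<q. F (\<tau> z) ((dvs @ dus)[p + j := X' (p + j)])) = (\<Sum>k<q. G (\<tau> z) dvs (dus[k := hessian z v (us ! k)]))"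
      using dvs lvs by (intro sum.cong) (auto simp: F_def vecs_def list_update_append X'_def S_def nth_append)
    finally show ?thesis by (simp add: add.assoc)
  qed
  have s1: "G (\<tau> z) (dvs[k := hessian z (\<lambda>j. \<i> * v j) (vs ! k)]) dus = \<i> * G (\<tau> z) (dvs[k := hessian z v (vs ! k)]) dus"
    if "k < p" for k
    unfolding hessian_ii[OF z vecs_nth[OF vs that] v]
    using alternating_multilinear_scale[OF alt1[OF \<tau>[OF z] dus] _ dvs that hessian_cspace[OF z vecs_nth[OF vs that] v]] by simp
  have s2: "G (\<tau> z) dvs (dus[k := hessian z (\<lambda>j. \<i> * v j) (us ! k)]) = - \<i> * G (\<tau> z) dvs (dus[k := hessian z v (us ! k)])"
    if "k < q" for k
    unfolding hessian_ii[OF z vecs_nth[OF us that] v]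
    using alternating_multilinear_scale[OF alt2[OF \<tau>[OF z] dvs] _ dus that hessian_cspace[OF z vecs_nth[OF us that] v]] by simp
  have "dz_deriv v P z = dz_deriv (differential \<tau> z v) (\<lambda>w. G w dvs dus) (\<tau> z)
      + (\<Sum>k<p. G (\<tau> z) (dvs[k := hessian z v (vs ! k)]) dus)"
    unfolding dz_deriv_def P'[OF v] P'[OF cspace_scale[OF v]] differential_ii[OF z v]
    by (simp add: s1 s2 sum_distrib_left[symmetric] sum_negf field_simps)
  then show ?thesis by (simp add: P_def dvs_def dus_def)
qed

end

context complex_manifold
begin

lemma transition_holomorphic_change:
  assumes U: "(U, \<phi>) \<in> A" and V: "(V, \<psi>) \<in> A"
  shows "holomorphic_change n (\<phi> ` (U \<inter> V)) (transition (U, \<phi>) (V, \<psi>))"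
proof -
  interpret cdomain n "\<phi> ` (U \<inter> V)" by (rule overlap_cdomain[OF U V])
  interpret V: cdomain n "\<psi> ` V" by (rule chart_cdomain[OF V])
  let ?\<tau> = "transition (U, \<phi>) (V, \<psi>)"
  have cs: "?\<tau> z \<in> cspace n" if "z \<in> \<phi> ` (U \<inter> V)" for z
    using transition_in_overlap[OF U that, of \<psi>] V.W_cspace by blast
  have hol: "hol_map_on n (\<phi> ` (U \<inter> V)) ?\<tau>"
    by (rule transition_holomorphic[OF U V])
  have const: "?\<tau> z i = 0" if "z \<in> \<phi> ` (U \<inter> V)" "\<not> i < n" for z i
    using cs[OF that(1)] that(2) by (simp add: cspace_def)
  show ?thesis
  proof
    show "smooth_on n (\<phi> ` (U \<inter> V)) (\<lambda>z. ?\<tau> z i)" for i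
      using hol smooth_on_cong[OF smooth_on_const[of 0], of "\<lambda>z. ?\<tau> z i"] const
      by (cases "i < n") (auto simp: hol_map_on_def)
    show "dzbar_deriv v (\<lambda>z. ?\<tau> z i) z = 0" if "z \<in> \<phi> ` (U \<inter> V)" "v \<in> cspace n" for z v i
    proof (cases "i < n")
      case False
      then have "dzbar_deriv v (\<lambda>z. ?\<tau> z i) z = dzbar_deriv v (\<lambda>z. 0) z"
        using const that by (intro dzbar_deriv_cong) auto
      then show ?thesis by (simp add: dzbar_deriv_def)
    qed (use hol that in \<open>auto simp: hol_map_on_def\<close>)
  qed (rule cs)
qed

end

lemma is_formI:
  assumes "\<And>U \<phi> z ws. (U, \<phi>) \<in> A \<Longrightarrow> z \<in> \<phi> ` U \<Longrightarrow> ws \<in> vecs n q \<Longrightarrow>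
      alternating_multilinear n p (\<lambda>c. c) (\<lambda>vs. \<omega> (U, \<phi>) z vs ws)"
    and "\<And>U \<phi> z vs. (U, \<phi>) \<in> A \<Longrightarrow> z \<in> \<phi> ` U \<Longrightarrow> vs \<in> vecs n p \<Longrightarrow>
      alternating_multilinear n q cnj (\<lambda>ws. \<omega> (U, \<phi>) z vs ws)"
    and "\<And>U \<phi> vs ws. (U, \<phi>) \<in> A \<Longrightarrow> vs \<in> vecs n p \<Longrightarrow> ws \<in> vecs n q \<Longrightarrow>
      smooth_on n (\<phi> ` U) (\<lambda>z. \<omega> (U, \<phi>) z vs ws)"
    and "\<And>U \<phi> V \<psi> z vs ws. (U, \<phi>) \<in> A \<Longrightarrow> (V, \<psi>) \<in> A \<Longrightarrow> z \<in> \<phi> ` (U \<inter> V) \<Longrightarrow>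
      vs \<in> vecs n p \<Longrightarrow> ws \<in> vecs n q \<Longrightarrow>
      \<omega> (U, \<phi>) z vs ws = \<omega> (V, \<psi>) (transition (U, \<phi>) (V, \<psi>) z)
      (map (differential (transition (U, \<phi>) (V, \<psi>)) z) vs) (map (differential (transition (U, \<phi>) (V, \<psi>)) z) ws)"
    and "\<And>U \<phi> z vs ws. \<not> ((U, \<phi>) \<in> A \<and> z \<in> \<phi> ` U \<and> vs \<in> vecs n p \<and> ws \<in> vecs n q) \<Longrightarrow>
      \<omega> (U, \<phi>) z vs ws = 0"
  shows "is_form n A p q \<omega>"
  unfolding is_form_def Let_def
proof (intro conjI)
  show "\<forall>(U, \<phi>)\<in>A. \<forall>z\<in>\<phi> ` U.
        (\<forall>ws\<in>vecs n q. alternating_multilinear n p (\<lambda>c. c) (\<lambda>vs. \<omega> (U, \<phi>) z vs ws)) \<and>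
        (\<forall>vs\<in>vecs n p. alternating_multilinear n q cnj (\<lambda>ws. \<omega> (U, \<phi>) z vs ws))"
    using assms(1,2) by fast
  show "\<forall>(U, \<phi>)\<in>A. \<forall>vs\<in>vecs n p. \<forall>ws\<in>vecs n q. smooth_on n (\<phi> ` U) (\<lambda>z. \<omega> (U, \<phi>) z vs ws)"
    using assms(3) by fast
  show "\<forall>(U, \<phi>)\<in>A. \<forall>(V, \<psi>)\<in>A. \<forall>z\<in>\<phi> ` (U \<inter> V). \<forall>vs\<in>vecs n p. \<forall>ws\<in>vecs n q.
      \<omega> (U, \<phi>) z vs ws = \<omega> (V, \<psi>) (transition (U, \<phi>) (V, \<psi>) z)
      (map (differential (transition (U, \<phi>) (V, \<psi>)) z) vs) (map (differential (transition (U, \<phi>) (V, \<psi>)) z) ws)"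
    using assms(4) by fast
  show "\<forall>U \<phi> z vs ws. \<not> ((U, \<phi>) \<in> A \<and> z \<in> \<phi> ` U \<and> vs \<in> vecs n p \<and> ws \<in> vecs n q) \<longrightarrow> \<omega> (U, \<phi>) z vs ws = 0"
    using assms(5) by blast
qed

lemma form_eqI:
  fixes \<omega> \<eta> :: "'a form"
  assumes "\<And>U \<phi> z vs ws. (U, \<phi>) \<in> A \<Longrightarrow> z \<in> \<phi> ` U \<Longrightarrow> vs \<in> vecs n p \<Longrightarrow> ws \<in> vecs n q \<Longrightarrow>
      \<omega> (U, \<phi>) z vs ws = \<eta> (U, \<phi>) z vs ws"
    and "is_form n A p q \<omega>" "is_form n A p q \<eta>"
  shows "\<omega> = \<eta>"
proof (intro ext)
  fix c :: "'a chart" and z vs ws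
  obtain U \<phi> where c: "c = (U, \<phi>)" by fastforce
  show "\<omega> c z vs ws = \<eta> c z vs ws"
    unfolding c using assms(1) is_form_outside[OF assms(2)] is_form_outside[OF assms(3)]
    by (cases "(U, \<phi>) \<in> A \<and> z \<in> \<phi> ` U \<and> vs \<in> vecs n p \<and> ws \<in> vecs n q") auto
qed

context complex_manifold
begin

lemma alternating_del:
  assumes \<omega>: "is_form n A p q \<omega>" and U: "(U, \<phi>) \<in> A" and z: "z \<in> \<phi> ` U" and ws: "ws \<in> vecs n q"
  shows "alternating_multilinear n (Suc p) (\<lambda>c. c) (\<lambda>vs. del n A \<omega> (U, \<phi>) z vs ws)"
proof -
  interpret cdomain n "\<phi> ` U" by (rule chart_cdomain[OF U])
  let ?f = "\<lambda>vs z. \<omega> (U, \<phi>) z vs ws"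
  have alt: "alternating_multilinear n p (\<lambda>c. c) (\<lambda>vs. \<omega> (U, \<phi>) z vs ws)" if "z \<in> \<phi> ` U" for z
    using is_form_alternating(1)[OF \<omega> U that ws] .
  have sm: "smooth_on n (\<phi> ` U) (?f us)" if "us \<in> vecs n p" for us
    using is_form_smooth[OF \<omega> U that ws] .
  have "del n A \<omega> (U, \<phi>) z (vs[i := (\<lambda>j. a j + c * b j)]) ws =
      del n A \<omega> (U, \<phi>) z (vs[i := a]) ws + c * del n A \<omega> (U, \<phi>) z (vs[i := b]) ws"
    if vs: "vs \<in> vecs n (Suc p)" and i: "i < Suc p" and a: "a \<in> cspace n" and b: "b \<in> cspace n" for vs i a b c
  proof -
    let ?x = "\<lambda>j. a j + c * b j"
    have x: "?x \<in> cspace n" by (rule cspace_linear[OF a b])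
    have len: "length vs = Suc p" using vs by (simp add: vecs_def)
    have "dz_deriv (vs[i := ?x] ! k) (?f (omit k (vs[i := ?x]))) z =
        dz_deriv (vs[i := a] ! k) (?f (omit k (vs[i := a]))) z
        + c * dz_deriv (vs[i := b] ! k) (?f (omit k (vs[i := b]))) z" if k: "k < Suc p" for k
    proof -
      have om: "omit k vs \<in> vecs n p" using omit_vecs[OF vs] k by simp
      show ?thesis
      proof (cases "k = i")
        case True
        then show ?thesis
          using dz_deriv_linear[OF sm[OF om] z a b] i len by (simp add: omit_list_update_same)
      next
        case False
        define i' where "i' = (if i < k then i else i - 1)"
        have i': "i' < p" using False i k by (auto simp: i'_def)
        have o: "omit k (vs[i := y]) = (omit k vs)[i' := y]" for y
          using omit_list_update_neq[of k vs i y] False i k len by (simp add: i'_def)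
        have vk: "vs ! k \<in> cspace n" by (rule vecs_nth[OF vs k])
        note sa = sm[OF vecs_update[OF om a]] and sb = sm[OF vecs_update[OF om b]]
        have "dz_deriv (vs ! k) (?f ((omit k vs)[i' := ?x])) z =
            dz_deriv (vs ! k) (\<lambda>z. ?f ((omit k vs)[i' := a]) z + c * ?f ((omit k vs)[i' := b]) z) z"
          by (rule dz_deriv_cong[OF _ z vk]) (rule alternating_multilinear_linear[OF alt om i' a b])
        also have "\<dots> = dz_deriv (vs ! k) (?f ((omit k vs)[i' := a])) z
            + c * dz_deriv (vs ! k) (?f ((omit k vs)[i' := b])) z"
          using dz_deriv_add[OF sa smooth_on_cmult[OF sb] z vk] dz_deriv_cmult[OF sb z vk] by simp
        finally show ?thesis using False by (simp add: o)
      qed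
    qed
    then show ?thesis
      unfolding del_apply[OF U z vecs_update[OF vs x] ws] del_apply[OF U z vecs_update[OF vs a] ws]
        del_apply[OF U z vecs_update[OF vs b] ws] sum_distrib_left sum.distrib[symmetric]
      by (intro sum.cong refl) (auto simp: algebra_simps)
  qed
  moreover have "del n A \<omega> (U, \<phi>) z vs ws = 0" if vs: "vs \<in> vecs n (Suc p)" and nd: "\<not> distinct vs" for vs
  proof -
    have len: "length vs = Suc p" using vs by (simp add: vecs_def)
    obtain i j where ij: "i < j" "j < Suc p" "vs ! i = vs ! j"
      using nd len by (metis distinct_conv_nth linorder_neqE_nat)
    then obtain k where j: "j = Suc k" "i \<le> k" "k < p" by (cases j) auto
    define t where "t = (\<lambda>l. (-1) ^ l * dz_deriv (vs ! l) (?f (omit l vs)) z)"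
    have t0: "t l = 0" if "l < Suc p" "l \<noteq> i" "l \<noteq> j" for l
    proof -
      have "\<not> distinct (omit l vs)" using not_distinct_omit[OF ij(1) _ ij(3) _ that(2,3)] ij(2) that(1) len by simp
      then have "dz_deriv (vs ! l) (?f (omit l vs)) z = dz_deriv (vs ! l) (\<lambda>z. 0) z"
        using alternating_multilinear_not_distinct[OF alt omit_vecs[OF vs]] that(1)
        by (intro dz_deriv_cong z vecs_nth[OF vs]) auto
      then show ?thesis by (simp add: t_def)
    qed
    have vj: "vs ! j \<in> cspace n" by (rule vecs_nth[OF vs ij(2)])
    have u1: "(omit i vs)[k := vs ! j] = omit i vs"
      using len j by (intro nth_equalityI) (auto simp: nth_omit nth_list_update)
    have u2: "(omit (Suc k) vs)[i := vs ! j] = omit j vs"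
      using len j ij by (intro nth_equalityI) (auto simp: nth_omit nth_list_update)
    have "?f (omit i vs) w = (-1) ^ (k - i) * ?f (omit j vs) w" if "w \<in> \<phi> ` U" for w
      using alternating_multilinear_omit[OF alt[OF that] _ vs vj j(2,3)] unfolding u1 u2 by simp
    then have "dz_deriv (vs ! i) (?f (omit i vs)) z = dz_deriv (vs ! j) (\<lambda>z. (-1) ^ (k - i) * ?f (omit j vs) z) z"
      unfolding ij(3) by (intro dz_deriv_cong z vj)
    also have "\<dots> = (-1) ^ (k - i) * dz_deriv (vs ! j) (?f (omit j vs)) z"
      by (rule dz_deriv_cmult[OF sm[OF omit_vecs[OF vs]] z vj]) (use ij in simp)
    finally have "t i = ((-1) ^ i * (-1) ^ (k - i)) * dz_deriv (vs ! j) (?f (omit j vs)) z"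
      by (simp add: t_def)
    also have "(-1) ^ i * (-1) ^ (k - i) = ((-1) ^ k :: complex)"
      using j by (simp flip: power_add)
    finally have "t i + t j = 0" by (simp add: t_def j)
    moreover have "(\<Sum>l<Suc p. t l) = (\<Sum>l\<in>{i, j}. t l)"
      using ij t0 by (intro sum.mono_neutral_right) auto
    ultimately show ?thesis
      using ij(1) unfolding del_apply[OF U z vs ws] t_def[symmetric] by simp
  qed
  ultimately show ?thesis unfolding alternating_multilinear_def by blast
qed

lemma alternating_conj_del:
  assumes \<omega>: "is_form n A p q \<omega>" and U: "(U, \<phi>) \<in> A" and z: "z \<in> \<phi> ` U" and vs: "vs \<in> vecs n (Suc p)"
  shows "alternating_multilinear n q cnj (\<lambda>ws. del n A \<omega> (U, \<phi>) z vs ws)"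
proof -
  interpret cdomain n "\<phi> ` U" by (rule chart_cdomain[OF U])
  let ?f = "\<lambda>k ws z. \<omega> (U, \<phi>) z (omit k vs) ws"
  have alt: "alternating_multilinear n q cnj (\<lambda>ws. ?f k ws z)" if "z \<in> \<phi> ` U" "k < Suc p" for k z
    using is_form_alternating(2)[OF \<omega> U that(1) omit_vecs[OF vs]] that(2) by simp
  have sm: "smooth_on n (\<phi> ` U) (?f k us)" if "us \<in> vecs n q" "k < Suc p" for us k
    using is_form_smooth[OF \<omega> U omit_vecs[OF vs] that(1)] that(2) by simp
  have "del n A \<omega> (U, \<phi>) z vs (ws[i := (\<lambda>j. a j + c * b j)]) =
      del n A \<omega> (U, \<phi>) z vs (ws[i := a]) + cnj c * del n A \<omega> (U, \<phi>) z vs (ws[i := b])"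
    if ws: "ws \<in> vecs n q" and i: "i < q" and a: "a \<in> cspace n" and b: "b \<in> cspace n" for ws i a b c
  proof -
    let ?x = "\<lambda>j. a j + c * b j"
    have x: "?x \<in> cspace n" by (rule cspace_linear[OF a b])
    have "dz_deriv (vs ! k) (?f k (ws[i := ?x])) z =
        dz_deriv (vs ! k) (?f k (ws[i := a])) z + cnj c * dz_deriv (vs ! k) (?f k (ws[i := b])) z"
      if k: "k < Suc p" for k
    proof -
      have vk: "vs ! k \<in> cspace n" by (rule vecs_nth[OF vs k])
      note sa = sm[OF vecs_update[OF ws a] k] and sb = sm[OF vecs_update[OF ws b] k]
      have "dz_deriv (vs ! k) (?f k (ws[i := ?x])) z =
          dz_deriv (vs ! k) (\<lambda>z. ?f k (ws[i := a]) z + cnj c * ?f k (ws[i := b]) z) z"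
        by (rule dz_deriv_cong[OF _ z vk]) (rule alternating_multilinear_linear[OF alt[OF _ k] ws i a b])
      also have "\<dots> = dz_deriv (vs ! k) (?f k (ws[i := a])) z + cnj c * dz_deriv (vs ! k) (?f k (ws[i := b])) z"
        using dz_deriv_add[OF sa smooth_on_cmult[OF sb] z vk] dz_deriv_cmult[OF sb z vk] by simp
      finally show ?thesis .
    qed
    then show ?thesis
      unfolding del_apply[OF U z vs vecs_update[OF ws x]] del_apply[OF U z vs vecs_update[OF ws a]]
        del_apply[OF U z vs vecs_update[OF ws b]] sum_distrib_left sum.distrib[symmetric]
      by (intro sum.cong refl) (auto simp: algebra_simps)
  qed
  moreover have "del n A \<omega> (U, \<phi>) z vs ws = 0" if ws: "ws \<in> vecs n q" and nd: "\<not> distinct ws" for ws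
  proof -
    have "dz_deriv (vs ! k) (?f k ws) z = dz_deriv (vs ! k) (\<lambda>z. 0) z" if k: "k < Suc p" for k
      using alternating_multilinear_not_distinct[OF alt[OF _ k] ws nd]
      by (intro dz_deriv_cong z vecs_nth[OF vs k])
    then show ?thesis unfolding del_apply[OF U z vs ws] by simp
  qed
  ultimately show ?thesis unfolding alternating_multilinear_def by blast
qed

lemma smooth_del:
  assumes \<omega>: "is_form n A p q \<omega>" and U: "(U, \<phi>) \<in> A" and vs: "vs \<in> vecs n (Suc p)" and ws: "ws \<in> vecs n q"
  shows "smooth_on n (\<phi> ` U) (\<lambda>z. del n A \<omega> (U, \<phi>) z vs ws)"
proof -
  interpret cdomain n "\<phi> ` U" by (rule chart_cdomain[OF U])
  have "smooth_on n (\<phi> ` U) (\<lambda>z. \<Sum>i<Suc p. (-1) ^ i * dz_deriv (vs ! i) (\<lambda>z. \<omega> (U, \<phi>) z (omit i vs) ws) z)"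
    by (intro smooth_on_sum smooth_on_cmult smooth_on_dz_deriv is_form_smooth[OF \<omega> U _ ws]
        omit_vecs[OF vs] vecs_nth[OF vs]) auto
  then show ?thesis
    by (rule smooth_on_cong) (simp only: del_apply[OF U _ vs ws])
qed

lemma del_transition:
  assumes \<omega>: "is_form n A p q \<omega>" and U: "(U, \<phi>) \<in> A" and V: "(V, \<psi>) \<in> A" and z: "z \<in> \<phi> ` (U \<inter> V)"
    and vs: "vs \<in> vecs n (Suc p)" and ws: "ws \<in> vecs n q"
  shows "del n A \<omega> (U, \<phi>) z vs ws = del n A \<omega> (V, \<psi>) (transition (U, \<phi>) (V, \<psi>) z)
    (map (differential (transition (U, \<phi>) (V, \<psi>)) z) vs) (map (differential (transition (U, \<phi>) (V, \<psi>)) z) ws)"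
proof -
  define \<tau> where "\<tau> = transition (U, \<phi>) (V, \<psi>)"
  interpret holomorphic_change n "\<phi> ` (U \<inter> V)" \<tau>
    unfolding \<tau>_def by (rule transition_holomorphic_change[OF U V])
  let ?d = "differential \<tau> z"
  define VS where "VS = map ?d vs"
  define WS where "WS = map ?d ws"
  let ?G = "\<lambda>w us. \<omega> (V, \<psi>) w us WS"
  have len: "length vs = Suc p" using vs by (simp add: vecs_def)
  have \<tau>V: "\<tau> z \<in> \<psi> ` V" if "z \<in> \<phi> ` (U \<inter> V)" for z
    using transition_in_overlap[OF U that, of \<psi>] unfolding \<tau>_def by blast
  have VS: "VS \<in> vecs n (Suc p)" using vs differential_cspace[OF z] by (auto simp: VS_def vecs_def)
  have WS: "WS \<in> vecs n q" using ws differential_cspace[OF z] by (auto simp: WS_def vecs_def)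
  have zU: "z \<in> \<phi> ` U" using z by blast
  define t where "t = (\<lambda>i k. (-1) ^ i * ?G (\<tau> z) ((omit i VS)[k := hessian z (vs ! i) (omit i vs ! k)]))"
  have step: "(-1) ^ i * dz_deriv (vs ! i) (\<lambda>z. \<omega> (U, \<phi>) z (omit i vs) ws) z =
      (-1) ^ i * dz_deriv (VS ! i) (\<lambda>w. ?G w (omit i VS)) (\<tau> z) + (\<Sum>k<p. t i k)" if i: "i < Suc p" for i
  proof -
    have vi: "vs ! i \<in> cspace n" by (rule vecs_nth[OF vs i])
    have om: "omit i vs \<in> vecs n p" using omit_vecs[OF vs] i by simp
    have "dz_deriv (vs ! i) (\<lambda>z. \<omega> (U, \<phi>) z (omit i vs) ws) z =
        dz_deriv (vs ! i) (\<lambda>z. \<omega> (V, \<psi>) (\<tau> z) (map (differential \<tau> z) (omit i vs)) (map (differential \<tau> z) ws)) z"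
      by (rule dz_deriv_cong[OF _ z vi]) (use is_form_transition[OF \<omega> U V _ om ws] in \<open>simp add: \<tau>_def\<close>)
    also have "\<dots> = dz_deriv (?d (vs ! i)) (\<lambda>w. \<omega> (V, \<psi>) w (map ?d (omit i vs)) (map ?d ws)) (\<tau> z)
        + (\<Sum>k<p. \<omega> (V, \<psi>) (\<tau> z) ((map ?d (omit i vs))[k := hessian z (vs ! i) (omit i vs ! k)]) (map ?d ws))"
      by (rule dz_deriv_pullback[OF chart_cdomain[OF V] \<tau>V is_form_alternating(1)[OF \<omega> V]
            is_form_alternating(2)[OF \<omega> V] is_form_smooth[OF \<omega> V] z vi om ws])
    finally show ?thesis
      using i len by (simp add: map_omit VS_def WS_def t_def sum_distrib_left distrib_left)
  qed
  have "t i k = - t (Suc k) i" if ik: "i \<le> k" "k < p" for i k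
  proof -
    have vi: "vs ! i \<in> cspace n" and vk: "vs ! Suc k \<in> cspace n"
      using vecs_nth[OF vs] ik by simp_all
    note h = hessian_cspace[OF z vk vi]
    have "t i k = (-1) ^ i * ?G (\<tau> z) ((omit i VS)[k := hessian z (vs ! i) (vs ! Suc k)])"
      using ik len by (simp add: t_def nth_omit)
    also have "\<dots> = ((-1) ^ i * (-1) ^ (k - i)) * ?G (\<tau> z) ((omit (Suc k) VS)[i := hessian z (vs ! i) (vs ! Suc k)])"
      using alternating_multilinear_omit[OF is_form_alternating(1)[OF \<omega> V \<tau>V[OF z] WS] _ VS h ik] by simp
    also have "(-1) ^ i * (-1) ^ (k - i) = ((-1) ^ k :: complex)"
      using ik by (simp flip: power_add)
    finally show ?thesis
      using ik len hessian_commute[OF z vi vk] by (simp add: t_def nth_omit)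
  qed
  then have "(\<Sum>i<Suc p. \<Sum>k<p. t i k) = 0" by (rule double_sum_cancel)
  then have "del n A \<omega> (U, \<phi>) z vs ws =
      (\<Sum>i<Suc p. (-1) ^ i * dz_deriv (VS ! i) (\<lambda>w. ?G w (omit i VS)) (\<tau> z))"
    unfolding del_apply[OF U zU vs ws] using step by (simp add: sum.distrib del: sum.lessThan_Suc)
  also have "\<dots> = del n A \<omega> (V, \<psi>) (\<tau> z) VS WS"
    using del_apply[OF V \<tau>V[OF z] VS WS] by simp
  finally show ?thesis by (simp add: VS_def WS_def \<tau>_def)
qed

lemma is_form_del:
  assumes \<omega>: "is_form n A p q \<omega>"
  shows "is_form n A (Suc p) q (del n A \<omega>)"
proof (rule is_formI)
  fix U \<phi> z vs ws
  assume out: "\<not> ((U, \<phi>) \<in> A \<and> z \<in> \<phi> ` U \<and> vs \<in> vecs n (Suc p) \<and> ws \<in> vecs n q)"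
  show "del n A \<omega> (U, \<phi>) z vs ws = 0"
  proof (cases "(U, \<phi>) \<in> A \<and> z \<in> \<phi> ` U \<and> set vs \<subseteq> cspace n \<and> set ws \<subseteq> cspace n")
    case True
    have "\<omega> (U, \<phi>) w (omit i vs) ws = 0" if "i < length vs" for i w
      using out True that by (intro is_form_outside[OF \<omega>]) (auto simp: vecs_def)
    then show ?thesis by (simp add: del_def)
  qed (auto simp: del_def)
qed (auto intro: alternating_del[OF \<omega>] alternating_conj_del[OF \<omega>] smooth_del[OF \<omega>] del_transition[OF \<omega>])

end

lemma alternating_multilinear_add:
  "alternating_multilinear n m \<sigma> F \<Longrightarrow> alternating_multilinear n m \<sigma> G \<Longrightarrow>
   alternating_multilinear n m \<sigma> (\<lambda>vs. F vs + G vs)"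
  unfolding alternating_multilinear_def by (simp add: algebra_simps)

lemma alternating_multilinear_cmult:
  "alternating_multilinear n m \<sigma> F \<Longrightarrow> alternating_multilinear n m \<sigma> (\<lambda>vs. c * F vs)"
  unfolding alternating_multilinear_def by (simp add: algebra_simps)

lemma alternating_multilinear_cnj:
  "alternating_multilinear n m \<sigma> F \<Longrightarrow> alternating_multilinear n m (\<lambda>c. cnj (\<sigma> c)) (\<lambda>vs. cnj (F vs))"
  unfolding alternating_multilinear_def by simp

context cdomain
begin

lemma dz_deriv_lincomb:
  assumes "\<And>i. i \<in> I \<Longrightarrow> smooth_on n W (f i)" "z \<in> W" "v \<in> cspace n"
  shows "dz_deriv v (\<lambda>z. \<Sum>i\<in>I. c i * f i z) z = (\<Sum>i\<in>I. c i * dz_deriv v (f i) z)"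
  using assms by (simp add: dz_deriv_sum smooth_on_cmult dz_deriv_cmult)

lemma dzbar_deriv_lincomb:
  assumes "\<And>i. i \<in> I \<Longrightarrow> smooth_on n W (f i)" "z \<in> W" "v \<in> cspace n"
  shows "dzbar_deriv v (\<lambda>z. \<Sum>i\<in>I. c i * f i z) z = (\<Sum>i\<in>I. c i * dzbar_deriv v (f i) z)"
  using assms by (simp add: dzbar_deriv_sum smooth_on_cmult dzbar_deriv_cmult)

end

definition conj_form :: "'a form \<Rightarrow> 'a form" where
  "conj_form \<omega> = (\<lambda>c z vs ws. cnj (\<omega> c z ws vs))"

context complex_manifold
begin

lemma is_form_zero: "is_form n A p q (\<lambda>_ _ _ _. 0)"
  by (rule is_formI) (auto simp: alternating_multilinear_def intro: cdomain.smooth_on_const[OF chart_cdomain])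

lemma is_form_add:
  assumes "is_form n A p q \<omega>" "is_form n A p q \<eta>"
  shows "is_form n A p q (\<lambda>c z vs ws. \<omega> c z vs ws + \<eta> c z vs ws)"
  using is_form_transition[OF assms(1)] is_form_transition[OF assms(2)]
    is_form_outside[OF assms(1)] is_form_outside[OF assms(2)]
  by (intro is_formI alternating_multilinear_add cdomain.smooth_on_add[OF chart_cdomain]
        is_form_alternating[OF assms(1)] is_form_alternating[OF assms(2)]
        is_form_smooth[OF assms(1)] is_form_smooth[OF assms(2)]) simp_all

lemma is_form_cmult:
  assumes "is_form n A p q \<omega>"
  shows "is_form n A p q (\<lambda>c z vs ws. a * \<omega> c z vs ws)"
  using is_form_transition[OF assms] is_form_outside[OF assms]
  by (intro is_formI alternating_multilinear_cmult cdomain.smooth_on_cmult[OF chart_cdomain]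
        is_form_alternating[OF assms] is_form_smooth[OF assms]) simp_all

lemma is_form_conj_form:
  assumes "is_form n A p q \<omega>"
  shows "is_form n A q p (conj_form \<omega>)"
  unfolding conj_form_def
proof (rule is_formI)
  fix U \<phi> z ws assume "(U, \<phi>) \<in> A" "z \<in> \<phi> ` U" "ws \<in> vecs n p"
  then show "alternating_multilinear n q (\<lambda>c. c) (\<lambda>vs. cnj (\<omega> (U, \<phi>) z ws vs))"
    using alternating_multilinear_cnj[OF is_form_alternating(2)[OF assms]] by simp
next
  fix U \<phi> z vs assume "(U, \<phi>) \<in> A" "z \<in> \<phi> ` U" "vs \<in> vecs n q"
  then show "alternating_multilinear n p cnj (\<lambda>ws. cnj (\<omega> (U, \<phi>) z ws vs))"
    using alternating_multilinear_cnj[OF is_form_alternating(1)[OF assms]] by simp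
next
  fix U \<phi> vs ws assume "(U, \<phi>) \<in> A" "vs \<in> vecs n q" "ws \<in> vecs n p"
  then show "smooth_on n (\<phi> ` U) (\<lambda>z. cnj (\<omega> (U, \<phi>) z ws vs))"
    by (intro cdomain.smooth_on_cnj[OF chart_cdomain] is_form_smooth[OF assms])
qed (use is_form_transition[OF assms] is_form_outside[OF assms] in auto)

lemma del_add:
  assumes \<omega>: "is_form n A p q \<omega>" and \<eta>: "is_form n A p q \<eta>"
  shows "del n A (\<lambda>c z vs ws. \<omega> c z vs ws + \<eta> c z vs ws) =
    (\<lambda>c z vs ws. del n A \<omega> c z vs ws + del n A \<eta> c z vs ws)"
proof (rule form_eqI[OF _ is_form_del[OF is_form_add[OF assms]] is_form_add[OF is_form_del[OF \<omega>] is_form_del[OF \<eta>]]])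
  fix U \<phi> z vs ws
  assume U: "(U, \<phi>) \<in> A" and z: "z \<in> \<phi> ` U" and vs: "vs \<in> vecs n (Suc p)" and ws: "ws \<in> vecs n q"
  interpret cdomain n "\<phi> ` U" by (rule chart_cdomain[OF U])
  have "dz_deriv (vs ! i) (\<lambda>z. \<omega> (U, \<phi>) z (omit i vs) ws + \<eta> (U, \<phi>) z (omit i vs) ws) z =
      dz_deriv (vs ! i) (\<lambda>z. \<omega> (U, \<phi>) z (omit i vs) ws) z + dz_deriv (vs ! i) (\<lambda>z. \<eta> (U, \<phi>) z (omit i vs) ws) z"
    if "i < Suc p" for i
    using that by (intro dz_deriv_add is_form_smooth[OF \<omega> U] is_form_smooth[OF \<eta> U] omit_vecs[OF vs] z ws vecs_nth[OF vs]) auto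
  then show "del n A (\<lambda>c z vs ws. \<omega> c z vs ws + \<eta> c z vs ws) (U, \<phi>) z vs ws =
      del n A \<omega> (U, \<phi>) z vs ws + del n A \<eta> (U, \<phi>) z vs ws"
    unfolding del_apply[OF U z vs ws] sum.distrib[symmetric]
    by (intro sum.cong refl) (simp add: distrib_left)
qed

lemma del_cmult:
  assumes \<omega>: "is_form n A p q \<omega>"
  shows "del n A (\<lambda>c z vs ws. a * \<omega> c z vs ws) = (\<lambda>c z vs ws. a * del n A \<omega> c z vs ws)"
proof (rule form_eqI[OF _ is_form_del[OF is_form_cmult[OF \<omega>]] is_form_cmult[OF is_form_del[OF \<omega>]]])
  fix U \<phi> z vs ws
  assume U: "(U, \<phi>) \<in> A" and z: "z \<in> \<phi> ` U" and vs: "vs \<in> vecs n (Suc p)" and ws: "ws \<in> vecs n q"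
  interpret cdomain n "\<phi> ` U" by (rule chart_cdomain[OF U])
  have "dz_deriv (vs ! i) (\<lambda>z. a * \<omega> (U, \<phi>) z (omit i vs) ws) z =
      a * dz_deriv (vs ! i) (\<lambda>z. \<omega> (U, \<phi>) z (omit i vs) ws) z"
    if "i < Suc p" for i
    using that by (intro dz_deriv_cmult is_form_smooth[OF \<omega> U] omit_vecs[OF vs] z ws vecs_nth[OF vs]) auto
  then show "del n A (\<lambda>c z vs ws. a * \<omega> c z vs ws) (U, \<phi>) z vs ws = a * del n A \<omega> (U, \<phi>) z vs ws"
    unfolding del_apply[OF U z vs ws] sum_distrib_left
    by (intro sum.cong refl) simp
qed

lemma del_del:
  assumes \<omega>: "is_form n A p q \<omega>"
  shows "del n A (del n A \<omega>) = (\<lambda>_ _ _ _. 0)"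
proof (rule form_eqI[OF _ is_form_del[OF is_form_del[OF \<omega>]] is_form_zero])
  fix U \<phi> z vs ws
  assume U: "(U, \<phi>) \<in> A" and z: "z \<in> \<phi> ` U" and vs: "vs \<in> vecs n (Suc (Suc p))" and ws: "ws \<in> vecs n q"
  interpret cdomain n "\<phi> ` U" by (rule chart_cdomain[OF U])
  have len: "length vs = Suc (Suc p)" using vs by (simp add: vecs_def)
  have om: "omit i vs \<in> vecs n (Suc p)" if "i < Suc (Suc p)" for i
    using omit_vecs[OF vs] that by simp
  let ?f = "\<lambda>i k z. \<omega> (U, \<phi>) z (omit k (omit i vs)) ws"
  have sm: "smooth_on n (\<phi> ` U) (?f i k)" if "i < Suc (Suc p)" "k < Suc p" for i k
    using is_form_smooth[OF \<omega> U omit_vecs[OF om[OF that(1)]] ws] that(2) by simp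
  define t where "t = (\<lambda>i k. (-1) ^ i * (-1) ^ k * dz_deriv (vs ! i) (dz_deriv (omit i vs ! k) (?f i k)) z)"
  have "dz_deriv (vs ! i) (\<lambda>z. del n A \<omega> (U, \<phi>) z (omit i vs) ws) z =
      (\<Sum>k<Suc p. (-1) ^ k * dz_deriv (vs ! i) (dz_deriv (omit i vs ! k) (?f i k)) z)"
    if i: "i < Suc (Suc p)" for i
  proof -
    have "dz_deriv (vs ! i) (\<lambda>z. del n A \<omega> (U, \<phi>) z (omit i vs) ws) z =
        dz_deriv (vs ! i) (\<lambda>z. \<Sum>k<Suc p. (-1) ^ k * dz_deriv (omit i vs ! k) (?f i k) z) z"
      by (rule dz_deriv_cong[OF del_apply[OF U _ om[OF i] ws] z vecs_nth[OF vs i]])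
    also have "\<dots> = (\<Sum>k<Suc p. (-1) ^ k * dz_deriv (vs ! i) (dz_deriv (omit i vs ! k) (?f i k)) z)"
      by (intro dz_deriv_lincomb smooth_on_dz_deriv sm i z vecs_nth[OF vs] vecs_nth[OF om[OF i]]) auto
    finally show ?thesis .
  qed
  then have "del n A (del n A \<omega>) (U, \<phi>) z vs ws = (\<Sum>i<Suc (Suc p). \<Sum>k<Suc p. t i k)"
    unfolding del_apply[OF U z vs ws] t_def
    by (intro sum.cong refl) (simp add: sum_distrib_left mult.assoc del: sum.lessThan_Suc)
  also have "\<dots> = 0"
  proof (rule double_sum_cancel)
    fix i k assume ik: "i \<le> k" "k < Suc p"
    have vi: "vs ! i \<in> cspace n" and vk: "vs ! Suc k \<in> cspace n" using vecs_nth[OF vs] ik by simp_all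
    have "omit k (omit i vs) = omit i (omit (Suc k) vs)" using omit_omit[of i k vs] ik len by simp
    then show "t i k = - t (Suc k) i"
      using ik len dz_deriv_commute(1)[OF sm[of i k] z vi vk] by (simp add: t_def nth_omit)
  qed
  finally show "del n A (del n A \<omega>) (U, \<phi>) z vs ws = 0" .
qed

text \<open>Conjugation exchanges the two operators, so the properties of \<open>delbar\<close> follow from those of \<open>del\<close>.\<close>

lemma delbar_conj:
  assumes \<omega>: "is_form n A p q \<omega>"
  shows "delbar n A \<omega> = (\<lambda>c z vs ws. (-1) ^ p * conj_form (del n A (conj_form \<omega>)) c z vs ws)"
proof -
  note form = is_form_cmult[OF is_form_conj_form[OF is_form_del[OF is_form_conj_form[OF \<omega>]]], of "(-1) ^ p"]
  have "delbar n A \<omega> (U, \<phi>) z vs ws = (-1) ^ p * conj_form (del n A (conj_form \<omega>)) (U, \<phi>) z vs ws" for U \<phi> z vs ws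
  proof (cases "(U, \<phi>) \<in> A \<and> z \<in> \<phi> ` U \<and> vs \<in> vecs n p \<and> ws \<in> vecs n (Suc q)")
    case True
    then have U: "(U, \<phi>) \<in> A" and z: "z \<in> \<phi> ` U" and vs: "vs \<in> vecs n p" and ws: "ws \<in> vecs n (Suc q)"
      by auto
    interpret cdomain n "\<phi> ` U" by (rule chart_cdomain[OF U])
    have "dz_deriv (ws ! j) (\<lambda>z. cnj (\<omega> (U, \<phi>) z vs (omit j ws))) z =
        cnj (dzbar_deriv (ws ! j) (\<lambda>z. \<omega> (U, \<phi>) z vs (omit j ws)) z)" if "j < Suc q" for j
      using that by (intro dz_deriv_cnj is_form_smooth[OF \<omega> U vs] omit_vecs[OF ws] vecs_nth[OF ws] z) auto
    then have "conj_form (del n A (conj_form \<omega>)) (U, \<phi>) z vs ws =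
        (\<Sum>j<Suc q. (-1) ^ j * dzbar_deriv (ws ! j) (\<lambda>z. \<omega> (U, \<phi>) z vs (omit j ws)) z)"
      unfolding conj_form_def del_apply[OF U z ws vs] cnj_sum by (intro sum.cong refl) simp
    then show ?thesis unfolding delbar_apply[OF U z vs ws] by simp
  next
    case False
    have "delbar n A \<omega> (U, \<phi>) z vs ws = 0"
    proof (cases "(U, \<phi>) \<in> A \<and> z \<in> \<phi> ` U \<and> set vs \<subseteq> cspace n \<and> set ws \<subseteq> cspace n")
      case True
      have "\<omega> (U, \<phi>) w vs (omit j ws) = 0" if "j < length ws" for j w
        using False True that by (intro is_form_outside[OF \<omega>]) (auto simp: vecs_def)
      then show ?thesis by (simp add: delbar_def)
    qed (auto simp: delbar_def)
    then show ?thesis using is_form_outside[OF form False] by simp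
  qed
  then show ?thesis by (intro ext) (metis prod.exhaust)
qed

lemma is_form_delbar: "is_form n A p q \<omega> \<Longrightarrow> is_form n A p (Suc q) (delbar n A \<omega>)"
  unfolding delbar_conj by (intro is_form_cmult is_form_conj_form is_form_del)

lemma delbar_add:
  assumes \<omega>: "is_form n A p q \<omega>" and \<eta>: "is_form n A p q \<eta>"
  shows "delbar n A (\<lambda>c z vs ws. \<omega> c z vs ws + \<eta> c z vs ws) =
    (\<lambda>c z vs ws. delbar n A \<omega> c z vs ws + delbar n A \<eta> c z vs ws)"
  using del_add[OF is_form_conj_form[OF \<omega>] is_form_conj_form[OF \<eta>]]
  unfolding delbar_conj[OF is_form_add[OF \<omega> \<eta>]] delbar_conj[OF \<omega>] delbar_conj[OF \<eta>]
  by (simp add: conj_form_def distrib_left)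

lemma delbar_cmult:
  assumes \<omega>: "is_form n A p q \<omega>"
  shows "delbar n A (\<lambda>c z vs ws. a * \<omega> c z vs ws) = (\<lambda>c z vs ws. a * delbar n A \<omega> c z vs ws)"
  using del_cmult[OF is_form_conj_form[OF \<omega>], of "cnj a"]
  unfolding delbar_conj[OF is_form_cmult[OF \<omega>]] delbar_conj[OF \<omega>]
  by (simp add: conj_form_def mult.left_commute)

lemma delbar_delbar:
  assumes \<omega>: "is_form n A p q \<omega>"
  shows "delbar n A (delbar n A \<omega>) = (\<lambda>_ _ _ _. 0)"
proof -
  note c\<omega> = is_form_conj_form[OF \<omega>]
  have "conj_form (delbar n A \<omega>) = (\<lambda>c z vs ws. (-1) ^ p * del n A (conj_form \<omega>) c z vs ws)"
    unfolding delbar_conj[OF \<omega>] by (simp add: conj_form_def)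
  then have "del n A (conj_form (delbar n A \<omega>)) = (\<lambda>_ _ _ _. 0)"
    by (simp add: del_cmult[OF is_form_del[OF c\<omega>]] del_del[OF c\<omega>])
  then show ?thesis
    unfolding delbar_conj[OF is_form_delbar[OF \<omega>]] by (simp add: conj_form_def)
qed

lemma del_delbar_anticommute:
  assumes \<omega>: "is_form n A p q \<omega>"
  shows "del n A (delbar n A \<omega>) = (\<lambda>c z vs ws. -1 * delbar n A (del n A \<omega>) c z vs ws)"
proof (rule form_eqI[OF _ is_form_del[OF is_form_delbar[OF \<omega>]] is_form_cmult[OF is_form_delbar[OF is_form_del[OF \<omega>]]]])
  fix U \<phi> z vs ws
  assume U: "(U, \<phi>) \<in> A" and z: "z \<in> \<phi> ` U" and vs: "vs \<in> vecs n (Suc p)" and ws: "ws \<in> vecs n (Suc q)"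
  interpret cdomain n "\<phi> ` U" by (rule chart_cdomain[OF U])
  let ?f = "\<lambda>i j z. \<omega> (U, \<phi>) z (omit i vs) (omit j ws)"
  have om: "omit i vs \<in> vecs n p" if "i < Suc p" for i
    using omit_vecs[OF vs] that by simp
  have om': "omit j ws \<in> vecs n q" if "j < Suc q" for j
    using omit_vecs[OF ws] that by simp
  have sm: "smooth_on n (\<phi> ` U) (?f i j)" if "i < Suc p" "j < Suc q" for i j
    by (rule is_form_smooth[OF \<omega> U om[OF that(1)] om'[OF that(2)]])
  have 1: "dz_deriv (vs ! i) (\<lambda>z. delbar n A \<omega> (U, \<phi>) z (omit i vs) ws) z =
      (\<Sum>j<Suc q. ((-1) ^ p * (-1) ^ j) * dz_deriv (vs ! i) (dzbar_deriv (ws ! j) (?f i j)) z)"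
    if i: "i < Suc p" for i
  proof -
    have "dz_deriv (vs ! i) (\<lambda>z. delbar n A \<omega> (U, \<phi>) z (omit i vs) ws) z =
        dz_deriv (vs ! i) (\<lambda>z. \<Sum>j<Suc q. ((-1) ^ p * (-1) ^ j) * dzbar_deriv (ws ! j) (?f i j) z) z"
      by (rule dz_deriv_cong[OF _ z vecs_nth[OF vs i]])
         (simp only: delbar_apply[OF U _ om[OF i] ws] sum_distrib_left mult.assoc)
    also have "\<dots> = (\<Sum>j<Suc q. ((-1) ^ p * (-1) ^ j) * dz_deriv (vs ! i) (dzbar_deriv (ws ! j) (?f i j)) z)"
      by (intro dz_deriv_lincomb smooth_on_dzbar_deriv sm i z vecs_nth[OF vs] vecs_nth[OF ws]) auto
    finally show ?thesis .
  qed
  have 2: "dzbar_deriv (ws ! j) (\<lambda>z. del n A \<omega> (U, \<phi>) z vs (omit j ws)) z =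
      (\<Sum>i<Suc p. (-1) ^ i * dz_deriv (vs ! i) (dzbar_deriv (ws ! j) (?f i j)) z)"
    if j: "j < Suc q" for j
  proof -
    have "dzbar_deriv (ws ! j) (\<lambda>z. del n A \<omega> (U, \<phi>) z vs (omit j ws)) z =
        dzbar_deriv (ws ! j) (\<lambda>z. \<Sum>i<Suc p. (-1) ^ i * dz_deriv (vs ! i) (?f i j) z) z"
      by (rule dzbar_deriv_cong[OF del_apply[OF U _ vs om'[OF j]] z vecs_nth[OF ws j]])
    also have "\<dots> = (\<Sum>i<Suc p. (-1) ^ i * dzbar_deriv (ws ! j) (dz_deriv (vs ! i) (?f i j)) z)"
      by (intro dzbar_deriv_lincomb smooth_on_dz_deriv sm j z vecs_nth[OF vs] vecs_nth[OF ws]) auto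
    also have "\<dots> = (\<Sum>i<Suc p. (-1) ^ i * dz_deriv (vs ! i) (dzbar_deriv (ws ! j) (?f i j)) z)"
      using dz_deriv_commute(2)[OF sm[OF _ j] z vecs_nth[OF vs] vecs_nth[OF ws j]]
      by (intro sum.cong refl) simp
    finally show ?thesis .
  qed
  have "del n A (delbar n A \<omega>) (U, \<phi>) z vs ws =
      (\<Sum>i<Suc p. \<Sum>j<Suc q. (-1) ^ p * (-1) ^ i * (-1) ^ j * dz_deriv (vs ! i) (dzbar_deriv (ws ! j) (?f i j)) z)"
    unfolding del_apply[OF U z vs ws]
    by (intro sum.cong refl) (simp add: 1 sum_distrib_left algebra_simps del: sum.lessThan_Suc)
  moreover have "delbar n A (del n A \<omega>) (U, \<phi>) z vs ws =
      - (\<Sum>j<Suc q. \<Sum>i<Suc p. (-1) ^ p * (-1) ^ i * (-1) ^ j * dz_deriv (vs ! i) (dzbar_deriv (ws ! j) (?f i j)) z)"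
    unfolding delbar_apply[OF U z vs ws] sum_negf[symmetric] sum_distrib_left
    by (intro sum.cong refl) (simp add: 2 sum_distrib_left sum_negf algebra_simps del: sum.lessThan_Suc)
  ultimately show "del n A (delbar n A \<omega>) (U, \<phi>) z vs ws = -1 * delbar n A (del n A \<omega>) (U, \<phi>) z vs ws"
    using sum.swap[of "\<lambda>i j. (-1) ^ p * (-1) ^ i * (-1) ^ j * dz_deriv (vs ! i) (dzbar_deriv (ws ! j) (?f i j)) z" "{..<Suc q}" "{..<Suc p}"]
    by simp
qed

end

section \<open>Dimensions of quotients\<close>

lemma (in vectorspace) fin_dim_subspace:
  assumes fd: "fin_dim" and N: "VectorSpace.subspace K N V"
  shows "vectorspace.fin_dim K (vs N)"
proof -
  interpret N: vectorspace K "vs N" by (rule subspace_is_vs[OF N])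
  have sub: "LinearCombinations.submodule K N V" using N by (simp add: VectorSpace.subspace_def)
  have NV: "N \<subseteq> carrier V" using sub by (simp add: LinearCombinations.submodule_def)
  let ?P = "\<lambda>S. S \<subseteq> carrier (vs N) \<and> N.module.lin_indpt S"
  have "finite S \<and> card S \<le> dim" if "?P S" for S
    using that li_le_dim[OF fd, of S] NV span_li_not_depend(2)[OF _ sub, of S] by auto
  moreover have "?P {}" by (simp add: N.module.lin_dep_def)
  ultimately obtain S where S: "finite S" "maximal S ?P"
    using maximal_exists[of ?P dim "{}"] by blast
  then have "N.module.gen_set S" by (intro N.max_li_is_gen) simp
  then show ?thesis unfolding N.fin_dim_def using S by (auto simp: maximal_def)
qed

lemma (in linear_map) fin_dim_of_kernel_image:
  assumes W: "W.fin_dim" and surj: "T ` carrier V = carrier W"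
    and N: "vectorspace.fin_dim K (V.vs kerT)"
  shows "V.fin_dim"
proof -
  interpret N: vectorspace K "V.vs kerT" by (rule V.subspace_is_vs[OF kerT_is_subspace])
  have subN: "LinearCombinations.submodule K kerT V"
    using kerT_is_subspace by (simp add: VectorSpace.subspace_def)
  obtain B where B: "finite B" "B \<subseteq> carrier W" "W.module.span B = carrier W"
    using W unfolding W.fin_dim_def by blast
  obtain C where C: "finite C" "C \<subseteq> kerT" "N.module.span C = kerT"
    using N unfolding N.fin_dim_def by auto
  obtain B' where B': "B' \<subseteq> carrier V" "finite B'" "B = T ` B'"
    using finite_subset_image[OF B(1), of T "carrier V"] B(2) surj by blast
  have kerV: "kerT \<subseteq> carrier V" by (auto simp: ker_def)
  define S where "S = V.module.span (B' \<union> C)"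
  have sub: "B' \<union> C \<subseteq> carrier V" using B' C kerV by blast
  have S: "LinearCombinations.submodule K S V"
    unfolding S_def by (rule V.module.span_is_submodule[OF sub])
  note SD = S[unfolded LinearCombinations.submodule_def]
  have "V.module.span C = kerT" using V.module.span_li_not_depend(1)[OF C(2) subN] C(3) by simp
  then have kerS: "kerT \<subseteq> S" unfolding S_def using V.module.span_is_monotone[of C "B' \<union> C"] by auto
  have "LinearCombinations.submodule K (T ` S) W"
    unfolding LinearCombinations.submodule_def
  proof (intro conjI allI impI)
    show "Module.module K W" ..
    show "T ` S \<subseteq> carrier W" using SD by auto
    show "\<zero>\<^bsub>W\<^esub> \<in> T ` S" using SD T0_is_0 by (metis imageI)
  next
    fix v w assume "v \<in> T ` S" "w \<in> T ` S"
    then obtain a b where "a \<in> S" "b \<in> S" "v = T a" "w = T b" by blast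
    then show "v \<oplus>\<^bsub>W\<^esub> w \<in> T ` S" using SD T_add[of a b] by (metis imageI subsetD)
  next
    fix c v assume "c \<in> carrier K" "v \<in> T ` S"
    then obtain a where "a \<in> S" "v = T a" by blast
    then show "c \<odot>\<^bsub>W\<^esub> v \<in> T ` S" using SD T_smult[of c a] \<open>c \<in> carrier K\<close> by (metis imageI subsetD)
  qed
  moreover have "B \<subseteq> T ` S"
    unfolding B'(3) S_def using V.module.in_own_span[OF sub] by blast
  ultimately have TS: "carrier W \<subseteq> T ` S"
    using W.module.span_is_subset[of B "T ` S"] B(3) by simp
  have "carrier V \<subseteq> S"
  proof
    fix v assume v: "v \<in> carrier V"
    then obtain s where s: "s \<in> S" "T v = T s" using TS by (metis T_im imageE subsetD)
    have sV: "s \<in> carrier V" using s SD by blast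
    have "T (v \<ominus>\<^bsub>V\<^esub> s) = \<zero>\<^bsub>W\<^esub>" using v sV s by (simp add: T_minus a_minus_def W.module.M.r_neg)
    then have "v \<ominus>\<^bsub>V\<^esub> s \<in> S" using v sV kerS by (auto simp: ker_def)
    then have "(v \<ominus>\<^bsub>V\<^esub> s) \<oplus>\<^bsub>V\<^esub> s \<in> S" using SD s by blast
    then show "v \<in> S" using v sV by (simp add: a_minus_def V.module.M.a_assoc V.module.M.l_neg)
  qed
  then show ?thesis
    unfolding V.fin_dim_def using sub B' C V.module.span_is_subset2[OF sub] unfolding S_def by blast
qed

lemma edim_linear_map:
  fixes V :: "(complex, 'v) module" and W :: "(complex, 'w) module"
  assumes T: "linear_map class_ring V W T" and surj: "T ` carrier V = carrier W"
  shows "edim V = edim W + edim (V\<lparr>carrier := {v \<in> carrier V. T v = \<zero>\<^bsub>W\<^esub>}\<rparr>)"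
proof -
  interpret linear_map class_ring V W T by (rule T)
  have ker: "{v \<in> carrier V. T v = \<zero>\<^bsub>W\<^esub>} = kerT" by (simp add: ker_def)
  show ?thesis
  proof (cases "V.fin_dim")
    case True
    have "W.fin_dim" by (rule surj_fin_dim[OF True surj])
    moreover have "vectorspace.fin_dim class_ring (V.vs kerT)"
      by (rule V.fin_dim_subspace[OF True kerT_is_subspace])
    moreover have "W.vs imT = W" using surj by (simp add: im_def)
    ultimately show ?thesis
      using rank_nullity[OF True] True unfolding ker by (simp add: edim_def)
  next
    case False
    then have "\<not> (W.fin_dim \<and> vectorspace.fin_dim class_ring (V.vs kerT))"
      using fin_dim_of_kernel_image surj by blast
    then show ?thesis using False unfolding ker by (auto simp: edim_def)
  qed
qed

definition coset_space :: "(complex, 'v) module \<Rightarrow> 'v set \<Rightarrow> 'v set \<Rightarrow> (complex, 'v set) module" where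
  "coset_space M W Z = (quot_space M W)\<lparr>carrier := (\<lambda>z. W +>\<^bsub>M\<^esub> z) ` Z\<rparr>"

lemma quot_space_restrict: "quot_space (M\<lparr>carrier := Z\<rparr>) W = coset_space M W Z"
  by (simp add: quot_space_def coset_space_def a_r_coset_def' A_RCOSETS_def' set_add_def' image_def fun_eq_iff)
     blast

locale complex_space = vectorspace "class_ring :: complex ring" M for M :: "(complex, 'v) module"
begin

lemma subspace_closed:
  assumes "VectorSpace.subspace class_ring W M"
  shows "W \<subseteq> carrier M" "v \<in> W \<Longrightarrow> w \<in> W \<Longrightarrow> v \<oplus>\<^bsub>M\<^esub> w \<in> W" "\<zero>\<^bsub>M\<^esub> \<in> W" "v \<in> W \<Longrightarrow> c \<odot>\<^bsub>M\<^esub> v \<in> W"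
  using assms by (auto simp: VectorSpace.subspace_def LinearCombinations.submodule_def)

lemma subspace_neg:
  assumes W: "VectorSpace.subspace class_ring W M" and v: "v \<in> W"
  shows "\<ominus>\<^bsub>M\<^esub> v \<in> W"
proof -
  have vM: "v \<in> carrier M" using subspace_closed(1)[OF W] v by blast
  have "(\<ominus>\<^bsub>class_ring\<^esub> \<one>\<^bsub>class_ring\<^esub>) \<odot>\<^bsub>M\<^esub> v = \<ominus>\<^bsub>M\<^esub> v"
    using vM smult_l_minus[of "\<one>\<^bsub>class_ring\<^esub>" v] smult_one[of v] by simp
  then show ?thesis using subspace_closed(4)[OF W v] by metis
qed

lemma subspaceI:
  assumes "W \<subseteq> carrier M" "\<And>v w. v \<in> W \<Longrightarrow> w \<in> W \<Longrightarrow> v \<oplus>\<^bsub>M\<^esub> w \<in> W" "\<zero>\<^bsub>M\<^esub> \<in> W"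
    "\<And>c v. v \<in> W \<Longrightarrow> c \<odot>\<^bsub>M\<^esub> v \<in> W"
  shows "VectorSpace.subspace class_ring W M"
  using assms module_axioms vectorspace_axioms
  unfolding VectorSpace.subspace_def LinearCombinations.submodule_def by blast

lemma subspace_Int:
  assumes "VectorSpace.subspace class_ring W M" "VectorSpace.subspace class_ring Z M"
  shows "VectorSpace.subspace class_ring (W \<inter> Z) M"
  using subspace_closed[OF assms(1)] subspace_closed[OF assms(2)] by (intro subspaceI) auto

lemma set_addI: "a \<in> W \<Longrightarrow> b \<in> Z \<Longrightarrow> a \<oplus>\<^bsub>M\<^esub> b \<in> W <+>\<^bsub>M\<^esub> Z"
  by (auto simp: set_add_def')

lemma subspace_set_add:
  assumes W: "VectorSpace.subspace class_ring W M" and Z: "VectorSpace.subspace class_ring Z M"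
  shows "VectorSpace.subspace class_ring (W <+>\<^bsub>M\<^esub> Z) M"
proof (rule subspaceI)
  note c = subspace_closed[OF W] subspace_closed[OF Z]
  show "W <+>\<^bsub>M\<^esub> Z \<subseteq> carrier M" using c by (auto simp: set_add_def')
  show "\<zero>\<^bsub>M\<^esub> \<in> W <+>\<^bsub>M\<^esub> Z"
    unfolding set_add_def' using c by (auto intro!: bexI[of _ "\<zero>\<^bsub>M\<^esub>"])
next
  note c = subspace_closed[OF W] subspace_closed[OF Z]
  fix v w assume "v \<in> W <+>\<^bsub>M\<^esub> Z" "w \<in> W <+>\<^bsub>M\<^esub> Z"
  then obtain a b a' b' where ab: "a \<in> W" "b \<in> Z" "v = a \<oplus>\<^bsub>M\<^esub> b" "a' \<in> W" "b' \<in> Z" "w = a' \<oplus>\<^bsub>M\<^esub> b'"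
    by (auto simp: set_add_def')
  moreover have "a \<in> carrier M" "b \<in> carrier M" "a' \<in> carrier M" "b' \<in> carrier M"
    using ab c by auto
  ultimately have "v \<oplus>\<^bsub>M\<^esub> w = (a \<oplus>\<^bsub>M\<^esub> a') \<oplus>\<^bsub>M\<^esub> (b \<oplus>\<^bsub>M\<^esub> b')"
    by (simp add: M.a_ac)
  then show "v \<oplus>\<^bsub>M\<^esub> w \<in> W <+>\<^bsub>M\<^esub> Z"
    using ab c by (simp add: set_addI)
next
  note c = subspace_closed[OF W] subspace_closed[OF Z]
  fix k v assume "v \<in> W <+>\<^bsub>M\<^esub> Z"
  then obtain a b where ab: "a \<in> W" "b \<in> Z" "v = a \<oplus>\<^bsub>M\<^esub> b"
    by (auto simp: set_add_def')
  then have "k \<odot>\<^bsub>M\<^esub> v = k \<odot>\<^bsub>M\<^esub> a \<oplus>\<^bsub>M\<^esub> k \<odot>\<^bsub>M\<^esub> b"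
    using subsetD[OF c(1)] subsetD[OF c(5)] smult_r_distr[of k a b] by simp
  then show "k \<odot>\<^bsub>M\<^esub> v \<in> W <+>\<^bsub>M\<^esub> Z"
    using ab c by (simp add: set_addI)
qed

lemma abelian_subgroup_subspace:
  assumes W: "VectorSpace.subspace class_ring W M"
  shows "abelian_subgroup W M"
proof (rule abelian_subgroupI3)
  show "additive_subgroup W M"
    unfolding additive_subgroup_def
    using subspace_closed[OF W] subspace_neg[OF W]
    by (intro group.subgroupI[OF M.a_group]) (auto simp: a_inv_def)
  show "abelian_group M" ..
qed

context
  fixes W assumes W: "VectorSpace.subspace class_ring W M"
begin

interpretation abelian_subgroup W M by (rule abelian_subgroup_subspace[OF W])

lemma coset_add:
  "a \<in> carrier M \<Longrightarrow> b \<in> carrier M \<Longrightarrow> (W +>\<^bsub>M\<^esub> a) <+>\<^bsub>M\<^esub> (W +>\<^bsub>M\<^esub> b) = W +>\<^bsub>M\<^esub> (a \<oplus>\<^bsub>M\<^esub> b)"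
  by (rule a_rcos_sum)

lemma coset_absorb: "w \<in> W \<Longrightarrow> a \<in> carrier M \<Longrightarrow> W +>\<^bsub>M\<^esub> (w \<oplus>\<^bsub>M\<^esub> a) = W +>\<^bsub>M\<^esub> a"
  by (rule a_repr_independence[symmetric, OF _ _ a_subgroup]) (auto simp: a_r_coset_def')

lemma coset_eqD:
  assumes "a \<in> carrier M" "W +>\<^bsub>M\<^esub> a = W" shows "a \<in> W"
  using a_rcos_self[OF assms(1)] assms(2) by simp

lemma coset_const: "a \<in> W \<Longrightarrow> W +>\<^bsub>M\<^esub> a = W"
  by (rule a_rcos_const)

lemma coset_Union:
  assumes "\<And>w. w \<in> W' \<Longrightarrow> w \<in> W" "\<zero>\<^bsub>M\<^esub> \<in> W'" "a \<in> carrier M"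
  shows "(\<Union>v\<in>W' +>\<^bsub>M\<^esub> a. W +>\<^bsub>M\<^esub> v) = W +>\<^bsub>M\<^esub> a"
  using assms coset_absorb[OF _ assms(3)] by (auto simp: a_r_coset_def'[of _ W'])

lemma coset_smult:
  assumes a: "a \<in> carrier M"
  shows "(\<Union>v\<in>W +>\<^bsub>M\<^esub> a. W +>\<^bsub>M\<^esub> (c \<odot>\<^bsub>M\<^esub> v)) = W +>\<^bsub>M\<^esub> (c \<odot>\<^bsub>M\<^esub> a)"
proof -
  have "W +>\<^bsub>M\<^esub> (c \<odot>\<^bsub>M\<^esub> (w \<oplus>\<^bsub>M\<^esub> a)) = W +>\<^bsub>M\<^esub> (c \<odot>\<^bsub>M\<^esub> a)" if w: "w \<in> W" for w
  proof -
    have "w \<in> carrier M" using subspace_closed(1)[OF W] w by blast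
    then have "c \<odot>\<^bsub>M\<^esub> (w \<oplus>\<^bsub>M\<^esub> a) = c \<odot>\<^bsub>M\<^esub> w \<oplus>\<^bsub>M\<^esub> c \<odot>\<^bsub>M\<^esub> a"
      using a smult_r_distr[of c w a] by simp
    then show ?thesis using coset_absorb[OF subspace_closed(4)[OF W w]] a by simp
  qed
  moreover have "W \<noteq> {}" using subspace_closed(3)[OF W] by blast
  ultimately show ?thesis by (auto simp: a_r_coset_def'[of _ W a])
qed

lemma vectorspace_coset_space:
  assumes Z: "VectorSpace.subspace class_ring Z M"
  shows "vectorspace class_ring (coset_space M W Z)"
proof -
  note c = subspace_closed[OF Z]
  have zM: "z \<in> carrier M" if "z \<in> Z" for z using c that by blast
  have carr: "carrier (coset_space M W Z) = (\<lambda>z. W +>\<^bsub>M\<^esub> z) ` Z"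
    and add: "add (coset_space M W Z) = set_add M"
    and zero: "zero (coset_space M W Z) = W"
    and smult: "a \<odot>\<^bsub>coset_space M W Z\<^esub> S = (\<Union>v\<in>S. W +>\<^bsub>M\<^esub> (a \<odot>\<^bsub>M\<^esub> v))" for a S
    by (simp_all add: coset_space_def quot_space_def)
  have W0: "W = W +>\<^bsub>M\<^esub> \<zero>\<^bsub>M\<^esub>" using coset_const[OF subspace_closed(3)[OF W]] by simp
  have neg: "\<ominus>\<^bsub>M\<^esub> z \<in> Z" if "z \<in> Z" for z by (rule subspace_neg[OF Z that])
  show ?thesis
  proof (rule vs_criteria)
    show "field (class_ring :: complex ring)" ..
    show "\<zero>\<^bsub>coset_space M W Z\<^esub> \<in> carrier (coset_space M W Z)"
      unfolding carr zero using W0 c by blast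
    show "\<forall>v w. v \<in> carrier (coset_space M W Z) \<and> w \<in> carrier (coset_space M W Z) \<longrightarrow>
        v \<oplus>\<^bsub>coset_space M W Z\<^esub> w \<in> carrier (coset_space M W Z)"
      unfolding carr add using c by (auto simp: coset_add zM)
    show "\<forall>v\<in>carrier (coset_space M W Z). \<exists>neg_v\<in>carrier (coset_space M W Z).
        v \<oplus>\<^bsub>coset_space M W Z\<^esub> neg_v = \<zero>\<^bsub>coset_space M W Z\<^esub>"
    proof
      fix v assume "v \<in> carrier (coset_space M W Z)"
      then obtain z where z: "z \<in> Z" "v = W +>\<^bsub>M\<^esub> z" unfolding carr by blast
      have "v <+>\<^bsub>M\<^esub> (W +>\<^bsub>M\<^esub> \<ominus>\<^bsub>M\<^esub> z) = W"
        unfolding z(2) using zM[OF z(1)] W0 by (simp add: coset_add M.r_neg)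
      then show "\<exists>neg_v\<in>carrier (coset_space M W Z). v \<oplus>\<^bsub>coset_space M W Z\<^esub> neg_v = \<zero>\<^bsub>coset_space M W Z\<^esub>"
        unfolding carr add zero using neg[OF z(1)] by blast
    qed
    show "\<forall>a v. a \<in> carrier class_ring \<and> v \<in> carrier (coset_space M W Z) \<longrightarrow>
        a \<odot>\<^bsub>coset_space M W Z\<^esub> v \<in> carrier (coset_space M W Z)"
      unfolding carr smult using c by (auto simp: coset_smult zM)
    show "\<forall>v w. v \<in> carrier (coset_space M W Z) \<and> w \<in> carrier (coset_space M W Z) \<longrightarrow>
        v \<oplus>\<^bsub>coset_space M W Z\<^esub> w = w \<oplus>\<^bsub>coset_space M W Z\<^esub> v"
      unfolding carr add by (auto simp: coset_add zM M.a_comm)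
    show "\<forall>v w x. v \<in> carrier (coset_space M W Z) \<and> w \<in> carrier (coset_space M W Z) \<and>
        x \<in> carrier (coset_space M W Z) \<longrightarrow>
        v \<oplus>\<^bsub>coset_space M W Z\<^esub> w \<oplus>\<^bsub>coset_space M W Z\<^esub> x = v \<oplus>\<^bsub>coset_space M W Z\<^esub> (w \<oplus>\<^bsub>coset_space M W Z\<^esub> x)"
      unfolding carr add by (auto simp: coset_add zM M.a_assoc)
    show "\<forall>v\<in>carrier (coset_space M W Z). v \<oplus>\<^bsub>coset_space M W Z\<^esub> \<zero>\<^bsub>coset_space M W Z\<^esub> = v"
    proof
      fix v assume "v \<in> carrier (coset_space M W Z)"
      then obtain z where z: "z \<in> Z" "v = W +>\<^bsub>M\<^esub> z" unfolding carr by blast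
      have "v <+>\<^bsub>M\<^esub> (W +>\<^bsub>M\<^esub> \<zero>\<^bsub>M\<^esub>) = v" unfolding z(2) using zM[OF z(1)] by (simp add: coset_add)
      then show "v \<oplus>\<^bsub>coset_space M W Z\<^esub> \<zero>\<^bsub>coset_space M W Z\<^esub> = v" unfolding add zero using W0 by simp
    qed
    show "\<forall>a b v. a \<in> carrier class_ring \<and> b \<in> carrier class_ring \<and> v \<in> carrier (coset_space M W Z) \<longrightarrow>
        a \<otimes>\<^bsub>class_ring\<^esub> b \<odot>\<^bsub>coset_space M W Z\<^esub> v = a \<odot>\<^bsub>coset_space M W Z\<^esub> (b \<odot>\<^bsub>coset_space M W Z\<^esub> v)"
    proof (intro allI impI, elim conjE)
      fix a b v assume "v \<in> carrier (coset_space M W Z)"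
      then obtain z where z: "z \<in> Z" "v = W +>\<^bsub>M\<^esub> z" unfolding carr by blast
      note bz = zM[OF c(4)[OF z(1), of b]]
      show "a \<otimes>\<^bsub>class_ring\<^esub> b \<odot>\<^bsub>coset_space M W Z\<^esub> v = a \<odot>\<^bsub>coset_space M W Z\<^esub> (b \<odot>\<^bsub>coset_space M W Z\<^esub> v)"
        unfolding smult z(2) coset_smult[OF zM[OF z(1)]] coset_smult[OF bz]
        using smult_assoc1[of a b z] zM[OF z(1)] by simp
    qed
    show "\<forall>v\<in>carrier (coset_space M W Z). \<one>\<^bsub>class_ring\<^esub> \<odot>\<^bsub>coset_space M W Z\<^esub> v = v"
      unfolding carr smult using smult_one by (clarsimp simp: coset_smult zM)
    show "\<forall>a b v. a \<in> carrier class_ring \<and> b \<in> carrier class_ring \<and> v \<in> carrier (coset_space M W Z) \<longrightarrow>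
        (a \<oplus>\<^bsub>class_ring\<^esub> b) \<odot>\<^bsub>coset_space M W Z\<^esub> v =
        a \<odot>\<^bsub>coset_space M W Z\<^esub> v \<oplus>\<^bsub>coset_space M W Z\<^esub> b \<odot>\<^bsub>coset_space M W Z\<^esub> v"
      unfolding carr smult add using smult_l_distr by (clarsimp simp: coset_smult coset_add zM)
    show "\<forall>a v w. a \<in> carrier class_ring \<and> v \<in> carrier (coset_space M W Z) \<and> w \<in> carrier (coset_space M W Z) \<longrightarrow>
        a \<odot>\<^bsub>coset_space M W Z\<^esub> (v \<oplus>\<^bsub>coset_space M W Z\<^esub> w) =
        a \<odot>\<^bsub>coset_space M W Z\<^esub> v \<oplus>\<^bsub>coset_space M W Z\<^esub> a \<odot>\<^bsub>coset_space M W Z\<^esub> w"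
      unfolding carr smult add using smult_r_distr by (clarsimp simp: coset_smult coset_add zM)
  qed
qed

end

lemma carrier_coset_space: "carrier (coset_space M W Z) = (\<lambda>z. W +>\<^bsub>M\<^esub> z) ` Z"
  by (simp add: coset_space_def)

theorem edim_coset_space_split:
  assumes B: "VectorSpace.subspace class_ring B M" and N: "VectorSpace.subspace class_ring N M"
    and Z: "VectorSpace.subspace class_ring Z M" and BZ: "B \<inter> Z \<subseteq> N" and NZ: "N \<subseteq> Z"
  shows "edim (coset_space M B Z) = edim (coset_space M N Z) + edim (coset_space M B N)"
proof -
  define T where "T = (\<lambda>S. \<Union>v\<in>S \<inter> Z. N +>\<^bsub>M\<^esub> v)"
  note ZM = subspace_closed(1)[OF Z] and BM = subspace_closed(1)[OF B]
  have zM: "z \<in> carrier M" if "z \<in> Z" for z using ZM that by blast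
  have T: "T (B +>\<^bsub>M\<^esub> z) = N +>\<^bsub>M\<^esub> z" if z: "z \<in> Z" for z
  proof -
    have "N +>\<^bsub>M\<^esub> v = N +>\<^bsub>M\<^esub> z" if v: "v \<in> B +>\<^bsub>M\<^esub> z" "v \<in> Z" for v
    proof -
      obtain b where b: "b \<in> B" "v = b \<oplus>\<^bsub>M\<^esub> z" using v(1) by (auto simp: a_r_coset_def')
      have bM: "b \<in> carrier M" using b BM by blast
      have "v \<oplus>\<^bsub>M\<^esub> \<ominus>\<^bsub>M\<^esub> z = b"
        unfolding b(2) using bM zM[OF z] by (simp add: M.a_assoc M.r_neg)
      then have "b \<in> Z" using subspace_closed(2)[OF Z v(2) subspace_neg[OF Z z]] by simp
      then have "b \<in> N" using b BZ by blast
      then show ?thesis unfolding b(2) using coset_absorb[OF N] zM[OF z] by blast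
    qed
    moreover have "z \<in> B +>\<^bsub>M\<^esub> z"
      using abelian_subgroup.a_rcos_self[OF abelian_subgroup_subspace[OF B] zM[OF z]] .
    ultimately show ?thesis unfolding T_def using z by blast
  qed
  interpret V: vectorspace class_ring "coset_space M B Z" by (rule vectorspace_coset_space[OF B Z])
  interpret W: vectorspace class_ring "coset_space M N Z" by (rule vectorspace_coset_space[OF N Z])
  have ops: "add (coset_space M W Z) = set_add M" "zero (coset_space M W Z) = W"
    "a \<odot>\<^bsub>coset_space M W Z\<^esub> S = (\<Union>v\<in>S. W +>\<^bsub>M\<^esub> (a \<odot>\<^bsub>M\<^esub> v))" for a S W
    by (simp_all add: coset_space_def quot_space_def)
  have hom: "T \<in> LinearCombinations.module_hom class_ring (coset_space M B Z) (coset_space M N Z)"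
    unfolding LinearCombinations.module_hom_def carrier_coset_space ops
  proof (intro CollectI conjI allI impI Pi_I)
    fix S assume "S \<in> (\<lambda>z. B +>\<^bsub>M\<^esub> z) ` Z"
    then obtain z where z: "z \<in> Z" and S: "S = B +>\<^bsub>M\<^esub> z" by blast
    show "T S \<in> (\<lambda>z. N +>\<^bsub>M\<^esub> z) ` Z" unfolding S T[OF z] using z by (rule imageI)
  next
    fix S S' assume "S \<in> (\<lambda>z. B +>\<^bsub>M\<^esub> z) ` Z \<and> S' \<in> (\<lambda>z. B +>\<^bsub>M\<^esub> z) ` Z"
    then obtain z z' where z: "z \<in> Z" "z' \<in> Z" and S: "S = B +>\<^bsub>M\<^esub> z" "S' = B +>\<^bsub>M\<^esub> z'" by blast
    show "T (S <+>\<^bsub>M\<^esub> S') = T S <+>\<^bsub>M\<^esub> T S'"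
      unfolding S coset_add[OF B zM[OF z(1)] zM[OF z(2)]] T[OF z(1)] T[OF z(2)]
        T[OF subspace_closed(2)[OF Z z]] coset_add[OF N zM[OF z(1)] zM[OF z(2)]] ..
  next
    fix k :: complex and S assume "k \<in> carrier class_ring \<and> S \<in> (\<lambda>z. B +>\<^bsub>M\<^esub> z) ` Z"
    then obtain z where z: "z \<in> Z" and S: "S = B +>\<^bsub>M\<^esub> z" by blast
    show "T (\<Union>v\<in>S. B +>\<^bsub>M\<^esub> (k \<odot>\<^bsub>M\<^esub> v)) = (\<Union>v\<in>T S. N +>\<^bsub>M\<^esub> (k \<odot>\<^bsub>M\<^esub> v))"
      unfolding S coset_smult[OF B zM[OF z]] T[OF z] T[OF subspace_closed(4)[OF Z z]] coset_smult[OF N zM[OF z]] ..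
  qed
  have lin: "linear_map class_ring (coset_space M B Z) (coset_space M N Z) T"
    unfolding linear_map_def mod_hom_def mod_hom_axioms_def
    using hom V.vectorspace_axioms W.vectorspace_axioms unfolding vectorspace_def by simp
  have surj: "T ` carrier (coset_space M B Z) = carrier (coset_space M N Z)"
    unfolding carrier_coset_space image_image by (rule image_cong[OF refl T])
  have "{v \<in> carrier (coset_space M B Z). T v = \<zero>\<^bsub>coset_space M N Z\<^esub>} = (\<lambda>z. B +>\<^bsub>M\<^esub> z) ` N"
    unfolding carrier_coset_space ops
  proof (intro equalityI subsetI)
    fix S assume "S \<in> {v \<in> (\<lambda>z. B +>\<^bsub>M\<^esub> z) ` Z. T v = N}"
    then have "S \<in> (\<lambda>z. B +>\<^bsub>M\<^esub> z) ` Z" and TS: "T S = N" by simp_all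
    then obtain z where z: "z \<in> Z" "S = B +>\<^bsub>M\<^esub> z" by blast
    then have "z \<in> N" using coset_eqD[OF N zM[OF z(1)]] T[OF z(1)] TS by simp
    then show "S \<in> (\<lambda>z. B +>\<^bsub>M\<^esub> z) ` N" unfolding z(2) by (rule imageI)
  next
    fix S assume "S \<in> (\<lambda>z. B +>\<^bsub>M\<^esub> z) ` N"
    then obtain z where z: "z \<in> N" "S = B +>\<^bsub>M\<^esub> z" by blast
    then have "z \<in> Z" using NZ by blast
    then have "T S = N" using z T coset_const[OF N z(1)] by simp
    moreover have "S \<in> (\<lambda>z. B +>\<^bsub>M\<^esub> z) ` Z" unfolding z(2) by (rule imageI) fact
    ultimately show "S \<in> {v \<in> (\<lambda>z. B +>\<^bsub>M\<^esub> z) ` Z. T v = N}" by simp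
  qed
  moreover have "(coset_space M B Z)\<lparr>carrier := (\<lambda>z. B +>\<^bsub>M\<^esub> z) ` N\<rparr> = coset_space M B N"
    by (simp add: coset_space_def)
  ultimately show ?thesis using edim_linear_map[OF lin surj] by simp
qed

end

section \<open>The cohomology spaces\<close>

context complex_manifold
begin

lemma forms_simps [simp]:
  "carrier (forms n A p q) = {\<omega>. is_form n A p q \<omega>}"
  "\<zero>\<^bsub>forms n A p q\<^esub> = (\<lambda>_ _ _ _. 0)"
  "\<omega> \<oplus>\<^bsub>forms n A p q\<^esub> \<eta> = (\<lambda>c z vs ws. \<omega> c z vs ws + \<eta> c z vs ws)"
  "a \<odot>\<^bsub>forms n A p q\<^esub> \<omega> = (\<lambda>c z vs ws. a * \<omega> c z vs ws)"
  by (simp_all add: forms_def)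

lemma complex_space_forms: "complex_space (forms n A p q)"
  unfolding complex_space_def
proof (rule vs_criteria)
  show "field (class_ring :: complex ring)" ..
  have "is_form n A p q \<omega> \<Longrightarrow> \<exists>\<eta>. is_form n A p q \<eta> \<and> (\<lambda>c z vs ws. \<omega> c z vs ws + \<eta> c z vs ws) = (\<lambda>_ _ _ _. 0)" for \<omega>
    using is_form_cmult[of p q \<omega> "-1"] by (intro exI[of _ "\<lambda>c z vs ws. -1 * \<omega> c z vs ws"]) auto
  then show "\<forall>v\<in>carrier (forms n A p q). \<exists>neg_v\<in>carrier (forms n A p q).
      v \<oplus>\<^bsub>forms n A p q\<^esub> neg_v = \<zero>\<^bsub>forms n A p q\<^esub>"
    by auto
qed (auto simp: is_form_zero is_form_add is_form_cmult algebra_simps)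

lemma ker_del_iff: "\<omega> \<in> ker_del n A p q \<longleftrightarrow> is_form n A p q \<omega> \<and> del n A \<omega> = (\<lambda>_ _ _ _. 0)"
  by (simp add: ker_del_def a_kernel_def')

lemma ker_delbar_iff: "\<omega> \<in> ker_delbar n A p q \<longleftrightarrow> is_form n A p q \<omega> \<and> delbar n A \<omega> = (\<lambda>_ _ _ _. 0)"
  by (simp add: ker_delbar_def a_kernel_def')

lemma del_zero: "del n A (\<lambda>_ _ _ _. 0) = (\<lambda>_ _ _ _. 0)"
  using del_cmult[OF is_form_zero, of 0] by simp

lemma delbar_zero: "delbar n A (\<lambda>_ _ _ _. 0) = (\<lambda>_ _ _ _. 0)"
  using delbar_cmult[OF is_form_zero, of 0] by simp

lemma subspace_formsI:
  assumes "\<And>\<omega>. \<omega> \<in> W \<Longrightarrow> is_form n A p q \<omega>" "(\<lambda>_ _ _ _. 0) \<in> W"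
    "\<And>\<omega> \<eta>. \<omega> \<in> W \<Longrightarrow> \<eta> \<in> W \<Longrightarrow> (\<lambda>c z vs ws. \<omega> c z vs ws + \<eta> c z vs ws) \<in> W"
    "\<And>a \<omega>. \<omega> \<in> W \<Longrightarrow> (\<lambda>c z vs ws. a * \<omega> c z vs ws) \<in> W"
  shows "VectorSpace.subspace class_ring W (forms n A p q)"
  by (rule complex_space.subspaceI[OF complex_space_forms]) (use assms in auto)

lemma subspace_ker_del: "VectorSpace.subspace class_ring (ker_del n A p q) (forms n A p q)"
  by (rule subspace_formsI) (auto simp: ker_del_iff is_form_zero del_zero is_form_add is_form_cmult del_add del_cmult)

lemma subspace_ker_delbar: "VectorSpace.subspace class_ring (ker_delbar n A p q) (forms n A p q)"
  by (rule subspace_formsI)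
     (auto simp: ker_delbar_iff is_form_zero delbar_zero is_form_add is_form_cmult delbar_add delbar_cmult)

lemma im_del_Suc: "im_del n A (Suc p) q = del n A ` {\<omega>. is_form n A p q \<omega>}"
  by (simp add: im_del_def)

lemma im_delbar_Suc: "im_delbar n A p (Suc q) = delbar n A ` {\<omega>. is_form n A p q \<omega>}"
  by (simp add: im_delbar_def)

lemma im_del_subset_ker_del: "im_del n A p q \<subseteq> ker_del n A p q"
  by (cases p) (auto simp: im_del_def ker_del_iff is_form_zero del_zero is_form_del del_del)

lemma im_delbar_subset_ker_delbar: "im_delbar n A p q \<subseteq> ker_delbar n A p q"
  by (cases q) (auto simp: im_delbar_def ker_delbar_iff is_form_zero delbar_zero is_form_delbar delbar_delbar)

lemma subspace_im_del: "VectorSpace.subspace class_ring (im_del n A p q) (forms n A p q)"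
proof (rule subspace_formsI)
  show "is_form n A p q \<omega>" if "\<omega> \<in> im_del n A p q" for \<omega>
    using that im_del_subset_ker_del ker_del_iff by blast
  show "(\<lambda>_ _ _ _. 0) \<in> im_del n A p q"
    using is_form_zero del_zero by (cases p) (auto simp: im_del_def image_iff intro: exI[of _ "\<lambda>_ _ _ _. 0"])
  show "(\<lambda>c z vs ws. \<omega> c z vs ws + \<eta> c z vs ws) \<in> im_del n A p q"
    if mem: "\<omega> \<in> im_del n A p q" "\<eta> \<in> im_del n A p q" for \<omega> \<eta>
  proof (cases p)
    case (Suc p')
    obtain \<omega>' \<eta>' where f: "is_form n A p' q \<omega>'" "is_form n A p' q \<eta>'" "\<omega> = del n A \<omega>'" "\<eta> = del n A \<eta>'"
      using mem unfolding Suc im_del_Suc by blast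
    show ?thesis
      unfolding Suc im_del_Suc f(3,4) del_add[OF f(1,2), symmetric] by (rule imageI) (simp add: is_form_add[OF f(1,2)])
  qed (use that in \<open>simp add: im_del_def\<close>)
  show "(\<lambda>c z vs ws. a * \<omega> c z vs ws) \<in> im_del n A p q" if mem: "\<omega> \<in> im_del n A p q" for a \<omega>
  proof (cases p)
    case (Suc p')
    obtain \<omega>' where f: "is_form n A p' q \<omega>'" "\<omega> = del n A \<omega>'"
      using mem unfolding Suc im_del_Suc by blast
    show ?thesis
      unfolding Suc im_del_Suc f(2) del_cmult[OF f(1), symmetric] by (rule imageI) (simp add: is_form_cmult[OF f(1)])
  qed (use that in \<open>simp add: im_del_def\<close>)
qed

lemma subspace_im_delbar: "VectorSpace.subspace class_ring (im_delbar n A p q) (forms n A p q)"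
proof (rule subspace_formsI)
  show "is_form n A p q \<omega>" if "\<omega> \<in> im_delbar n A p q" for \<omega>
    using that im_delbar_subset_ker_delbar ker_delbar_iff by blast
  show "(\<lambda>_ _ _ _. 0) \<in> im_delbar n A p q"
    using is_form_zero delbar_zero by (cases q) (auto simp: im_delbar_def image_iff intro: exI[of _ "\<lambda>_ _ _ _. 0"])
  show "(\<lambda>c z vs ws. \<omega> c z vs ws + \<eta> c z vs ws) \<in> im_delbar n A p q"
    if mem: "\<omega> \<in> im_delbar n A p q" "\<eta> \<in> im_delbar n A p q" for \<omega> \<eta>
  proof (cases q)
    case (Suc q')
    obtain \<omega>' \<eta>' where f: "is_form n A p q' \<omega>'" "is_form n A p q' \<eta>'" "\<omega> = delbar n A \<omega>'" "\<eta> = delbar n A \<eta>'"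
      using mem unfolding Suc im_delbar_Suc by blast
    show ?thesis
      unfolding Suc im_delbar_Suc f(3,4) delbar_add[OF f(1,2), symmetric] by (rule imageI) (simp add: is_form_add[OF f(1,2)])
  qed (use that in \<open>simp add: im_delbar_def\<close>)
  show "(\<lambda>c z vs ws. a * \<omega> c z vs ws) \<in> im_delbar n A p q" if mem: "\<omega> \<in> im_delbar n A p q" for a \<omega>
  proof (cases q)
    case (Suc q')
    obtain \<omega>' where f: "is_form n A p q' \<omega>'" "\<omega> = delbar n A \<omega>'"
      using mem unfolding Suc im_delbar_Suc by blast
    show ?thesis
      unfolding Suc im_delbar_Suc f(2) delbar_cmult[OF f(1), symmetric] by (rule imageI) (simp add: is_form_cmult[OF f(1)])
  qed (use that in \<open>simp add: im_delbar_def\<close>)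
qed

lemma zero_in_im_deldelbar: "(\<lambda>_ _ _ _. 0) \<in> im_deldelbar n A p q"
proof -
  have "(\<lambda>_ _ _ _. 0) = (del n A \<circ> delbar n A) (\<lambda>_ _ _ _. 0)" by (simp add: del_zero delbar_zero)
  then show ?thesis
    unfolding im_deldelbar_def using is_form_zero by (auto simp del: comp_apply)
qed

lemma im_deldelbar_subset_im_delbar: "im_deldelbar n A p q \<subseteq> im_delbar n A p q"
proof
  fix \<omega> assume \<omega>: "\<omega> \<in> im_deldelbar n A p q"
  show "\<omega> \<in> im_delbar n A p q"
  proof (cases "p = 0 \<or> q = 0")
    case True
    then show ?thesis
      using \<omega> complex_space.subspace_closed(3)[OF complex_space_forms subspace_im_delbar[of p q]]
      by (simp add: im_deldelbar_def)
  next
    case False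
    then obtain p' q' where pq: "p = Suc p'" "q = Suc q'" by (metis not0_implies_Suc)
    then obtain \<eta> where \<eta>: "is_form n A p' q' \<eta>" "\<omega> = del n A (delbar n A \<eta>)"
      using \<omega> by (auto simp: im_deldelbar_def)
    have "\<omega> = delbar n A (\<lambda>c z vs ws. -1 * del n A \<eta> c z vs ws)"
      unfolding \<eta>(2) del_delbar_anticommute[OF \<eta>(1)] delbar_cmult[OF is_form_del[OF \<eta>(1)]] ..
    then show ?thesis
      unfolding pq im_delbar_Suc using is_form_cmult[OF is_form_del[OF \<eta>(1)], of "-1"] by blast
  qed
qed

theorem edim_im_pi_delbar:
  "edim ((H_delbar n A p q)\<lparr>carrier := pi_delbar n A p q ` carrier (H_BC n A p q)\<rparr>) =
     edim (K_space n A p q) +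
     edim ((H_delbar n A p q)
       \<lparr>carrier := a_kernel (H_delbar n A p q) (H_A n A p q) (pi_A n A p q)\<rparr>)"
proof -
  define M where "M = forms n A p q"
  define R B D Zd Zb where "R = im_del n A p q" and "B = im_delbar n A p q" and "D = im_deldelbar n A p q"
    and "Zd = ker_del n A p q" and "Zb = ker_delbar n A p q"
  note defs = M_def R_def B_def D_def Zd_def Zb_def
  define Z where "Z = Zd \<inter> Zb"
  define N where "N = (R \<inter> Zb) <+>\<^bsub>M\<^esub> (B \<inter> Zd)"
  define C where "C = R <+>\<^bsub>M\<^esub> B"
  interpret complex_space M unfolding M_def by (rule complex_space_forms)
  have R: "VectorSpace.subspace class_ring R M" and B: "VectorSpace.subspace class_ring B M"
    and Zd: "VectorSpace.subspace class_ring Zd M" and Zb: "VectorSpace.subspace class_ring Zb M"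
    unfolding defs by (rule subspace_im_del subspace_im_delbar subspace_ker_del subspace_ker_delbar)+
  have RZ: "R \<subseteq> Zd" and BZ: "B \<subseteq> Zb" and DB: "D \<subseteq> B" and D0: "\<zero>\<^bsub>M\<^esub> \<in> D"
    unfolding defs using im_del_subset_ker_del im_delbar_subset_ker_delbar im_deldelbar_subset_im_delbar
      zero_in_im_deldelbar by auto
  have Z: "VectorSpace.subspace class_ring Z M" unfolding Z_def by (rule subspace_Int[OF Zd Zb])
  have N: "VectorSpace.subspace class_ring N M"
    unfolding N_def by (intro subspace_set_add subspace_Int R B Zd Zb)
  have C: "VectorSpace.subspace class_ring C M" unfolding C_def by (rule subspace_set_add[OF R B])
  note Rc = subspace_closed[OF R] and Bc = subspace_closed[OF B] and Zc = subspace_closed[OF Z]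
    and Zbc = subspace_closed[OF Zb]
  have NZ: "N \<subseteq> Z"
  proof
    fix x assume "x \<in> N"
    then obtain r b where rb: "r \<in> R \<inter> Zb" "b \<in> B \<inter> Zd" "x = r \<oplus>\<^bsub>M\<^esub> b" by (auto simp: N_def set_add_def')
    then have "r \<in> Z" "b \<in> Z" using RZ BZ by (auto simp: Z_def)
    then show "x \<in> Z" unfolding rb(3) by (rule Zc(2))
  qed
  have BN: "B \<inter> Z \<subseteq> N"
  proof
    fix b assume b: "b \<in> B \<inter> Z"
    then have "\<zero>\<^bsub>M\<^esub> \<oplus>\<^bsub>M\<^esub> b \<in> N"
      unfolding N_def using Rc(3) Zbc(3) by (intro set_addI) (auto simp: Z_def)
    then show "b \<in> N" using b Bc(1) by (simp add: subset_iff)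
  qed
  have BC: "b \<in> C" if "b \<in> B" for b
    using set_addI[OF Rc(3) that] that Bc(1) unfolding C_def by (simp add: subset_iff)
  have zM: "z \<in> carrier M" if "z \<in> Zb" for z using that Zbc(1) by blast
  have "pi_delbar n A p q (D +>\<^bsub>M\<^esub> z) = B +>\<^bsub>M\<^esub> z" if "z \<in> Z" for z
    unfolding pi_delbar_def quot_map_def M_def[symmetric] B_def[symmetric]
    by (rule coset_Union[OF B _ D0]) (use DB zM that in \<open>auto simp: Z_def\<close>)
  then have im: "pi_delbar n A p q ` carrier (H_BC n A p q) = (\<lambda>z. B +>\<^bsub>M\<^esub> z) ` Z"
    unfolding H_BC_def quot_space_restrict M_def[symmetric] D_def[symmetric] Zd_def[symmetric]
      Zb_def[symmetric] Z_def[symmetric] carrier_coset_space image_image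
    by (intro image_cong refl)
  have H: "H_delbar n A p q = coset_space M B Zb"
    unfolding H_delbar_def quot_space_restrict M_def B_def Zb_def ..
  have K: "K_space n A p q = coset_space M N Z"
    unfolding K_space_def quot_space_restrict N_def Z_def defs ..
  have zeroA: "\<zero>\<^bsub>H_A n A p q\<^esub> = C"
    by (simp add: H_A_def quot_space_def C_def defs)
  have piA: "pi_A n A p q (B +>\<^bsub>M\<^esub> z) = C +>\<^bsub>M\<^esub> z" if "z \<in> Zb" for z
    unfolding pi_A_def quot_map_def M_def[symmetric] R_def[symmetric] B_def[symmetric] C_def[symmetric]
    by (rule coset_Union[OF C BC Bc(3) zM[OF that]])
  have ker: "a_kernel (H_delbar n A p q) (H_A n A p q) (pi_A n A p q) = (\<lambda>z. B +>\<^bsub>M\<^esub> z) ` N"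
    unfolding a_kernel_def' zeroA H carrier_coset_space
  proof (intro equalityI subsetI)
    fix S assume "S \<in> {S \<in> (\<lambda>z. B +>\<^bsub>M\<^esub> z) ` Zb. pi_A n A p q S = C}"
    then have "S \<in> (\<lambda>z. B +>\<^bsub>M\<^esub> z) ` Zb" and pS: "pi_A n A p q S = C" by simp_all
    then obtain z where z: "z \<in> Zb" and S: "S = B +>\<^bsub>M\<^esub> z" by blast
    have "z \<in> C" using coset_eqD[OF C zM[OF z]] pS piA[OF z] S by simp
    then obtain r b where rb: "r \<in> R" "b \<in> B" "z = r \<oplus>\<^bsub>M\<^esub> b" by (auto simp: C_def set_add_def')
    have rM: "r \<in> carrier M" and bM: "b \<in> carrier M" using rb Rc(1) Bc(1) by auto
    have "z \<oplus>\<^bsub>M\<^esub> \<ominus>\<^bsub>M\<^esub> b = r" unfolding rb(3) using rM bM by (simp add: M.a_assoc M.r_neg)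
    moreover have "b \<in> Zb" using BZ rb(2) by blast
    ultimately have "r \<in> Zb" using Zbc(2)[OF z subspace_neg[OF Zb]] by auto
    then have "r \<oplus>\<^bsub>M\<^esub> \<zero>\<^bsub>M\<^esub> \<in> N"
      unfolding N_def using rb(1) Bc(3) subspace_closed(3)[OF Zd] by (intro set_addI) auto
    then have "r \<in> N" using rM by simp
    moreover have "S = B +>\<^bsub>M\<^esub> r"
      unfolding S rb(3) M.a_comm[OF rM bM] by (rule coset_absorb[OF B rb(2) rM])
    ultimately show "S \<in> (\<lambda>z. B +>\<^bsub>M\<^esub> z) ` N" by blast
  next
    fix S assume "S \<in> (\<lambda>z. B +>\<^bsub>M\<^esub> z) ` N"
    then obtain z where z: "z \<in> N" and S: "S = B +>\<^bsub>M\<^esub> z" by blast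
    have zZ: "z \<in> Zb" using z NZ by (auto simp: Z_def)
    have "z \<in> C" using z by (auto simp: N_def C_def set_add_def')
    then have "pi_A n A p q S = C" unfolding S piA[OF zZ] by (rule coset_const[OF C])
    moreover have "S \<in> (\<lambda>z. B +>\<^bsub>M\<^esub> z) ` Zb" unfolding S using zZ by (rule imageI)
    ultimately show "S \<in> {S \<in> (\<lambda>z. B +>\<^bsub>M\<^esub> z) ` Zb. pi_A n A p q S = C}" by simp
  qed
  have carrier_update: "(coset_space M B Zb)\<lparr>carrier := (\<lambda>z. B +>\<^bsub>M\<^esub> z) ` Y\<rparr> = coset_space M B Y" for Y
    by (simp add: coset_space_def)
  show ?thesis
    unfolding im ker unfolding H K carrier_update by (rule edim_coset_space_split[OF B N Z BN NZ])
qed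

end

theorem proposition2p1:
  fixes n p q :: nat and X :: "'a topology" and A :: "'a chart set"
  assumes "compact_complex_manifold n X A"
    and "p \<le> n" and "q \<le> n"
  shows "edim ((H_delbar n A p q)\<lparr>carrier := pi_delbar n A p q ` carrier (H_BC n A p q)\<rparr>) =
         edim (K_space n A p q) +
         edim ((H_delbar n A p q)
           \<lparr>carrier := a_kernel (H_delbar n A p q) (H_A n A p q) (pi_A n A p q)\<rparr>)"
  by (rule complex_manifold.edim_im_pi_delbar[OF compact_complex_manifold.axioms(1)[OF assms(1)]])

end
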